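(* Let $V=\bigoplus_{k=1}^r V_{d_k}$ be an $\operatorname{SL}_2$-representation with $V^{\operatorname{SL}_2}=\{0\}$. Let $\boldsymbol a=(a_{k,i}:(k,i)\in\Lambda)$ and let $\boldsymbol b=(b_{k,i}:(k,i)\in\Lambda)$ where the $b_{k,i}$ are real parameters. The $\mathbb{N}$-graded Hilbert series is given by $$\operatorname{Hilb}_V(t)=\lim_{\boldsymbol b\to\boldsymbol a}\ \sum_{(K,I)\in\Lambda}\ \sum_{\zeta^{a_{K,I}}=1}\frac{1-\zeta^2t^{2/b_{K,I}}}{b_{K,I}(1-t^2)(1-t)^e\prod\limits_{(k,i)\in\Lambda\smallsetminus\{(K,I)\}}\beta_{K,I,k,i,\zeta}(t)},$$ where $$\beta_{K,I,k,i,\zeta}(t)=\big(1-\zeta^{-a_{k,i}}t^{(b_{K,I}-b_{k,i})/b_{K,I}}\big)\big(1-\zeta^{a_{k,i}}t^{(b_{K,I}+b_{k,i})/b_{K,I}}\big).$$ Alternatively, with $\boldsymbol a_\Theta=(a_{k,i}:(k,i)\in\Theta)$ and real parameters $\boldsymbol b_\Theta=(b_{k,i}:(k,i)\in\Theta)$, $$\operatorname{Hilb}_V(t)=\lim_{\boldsymbol b_\Theta\to\boldsymbol a_\Theta}\ \sum_{(K,I)\in\Lambda}\ \sum_{\zeta^{a_{K,I}}=1}\frac{1-\zeta^2t^{2/b_{K,I}}}{b_{K,I}\prod\limits_{(k,i)\in\Theta\smallsetminus\{(K,I)\}}\big(1-\zeta^{-a_{k,i}}t^{(b_{K,I}-b_{k,i})/b_{K,I}}\big)}.$$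 Here $0<|t|<1$, and the limits are taken over parameter values for which all terms are defined; the inner sums run over all complex $a_{K,I}$-th roots of unity $\zeta$.
   Context: $V_d$ is the $(d+1)$-dimensional irreducible representation of $\operatorname{SL}_2=\operatorname{SL}_2(\mathbb{C})$ on binary forms of degree $d$; $V^{\operatorname{SL}_2}=\{0\}$ means all $d_k\ge1$; the $d_k$ need not be distinct. $\operatorname{Hilb}_V(t)=\sum_{n\ge0}\dim\big(\mathbb{C}[V]^{\operatorname{SL}_2}_n\big)t^n$ is the Hilbert series of the algebra of invariant polynomials graded by degree. $a_{k,i}=2i-d_k$ for $1\le k\le r$, $0\le i\le d_k$; $\Theta=\{(k,i)\in\mathbb{Z}^2:1\le k\le r,\ 0\le i\le d_k\}$; $\Lambda=\{(k,i)\in\mathbb{Z}^2:1\le k\le r,\ \lfloor d_k/2\rfloor+1\le i\le d_k\}$, the set of pairs with $a_{k,i}>0$; $e$ is the number of $k$ with $d_k$ even (equivalently the number of $(k,i)\in\Theta$ with $a_{k,i}=0$). Real powers $t^s=\exp(s\log t)$ are defined by a fixed branch of the logarithm. *)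

theory Defs
  imports "HOL-Analysis.Analysis" "HOL-Library.Function_Algebras"
begin

definition SL2 :: "(complex^2^2) set" where
  "SL2 = {g. det g = 1}"

definition binary_form :: "nat \<Rightarrow> (nat \<Rightarrow> complex) \<Rightarrow> complex^2 \<Rightarrow> complex" where
  "binary_form m c = (\<lambda>z. \<Sum>i\<le>m. c i * (z $ 1) ^ i * (z $ 2) ^ (m - i))"

definition Theta :: "nat \<Rightarrow> (nat \<Rightarrow> nat) \<Rightarrow> (nat \<times> nat) set" where
  "Theta r d = {(k, i). 1 \<le> k \<and> k \<le> r \<and> i \<le> d k}"

definition Lambda :: "nat \<Rightarrow> (nat \<Rightarrow> nat) \<Rightarrow> (nat \<times> nat) set" where
  "Lambda r d = {(k, i). 1 \<le> k \<and> k \<le> r \<and> d k div 2 + 1 \<le> i \<and> i \<le> d k}"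

(* An element of the direct sum of V_{d 1}, ..., V_{d r} is a family F of forms indexed by
   1..r, extended by the zero function to all other indices.  rep_vec r d is the linear
   parametrisation of this space by the coefficients (c (k, i)) with (k, i) in Theta r d;
   the other values of c are irrelevant. *)

definition rep_vec ::
    "nat \<Rightarrow> (nat \<Rightarrow> nat) \<Rightarrow> (nat \<times> nat \<Rightarrow> complex) \<Rightarrow> nat \<Rightarrow> complex^2 \<Rightarrow> complex" where
  "rep_vec r d c = (\<lambda>k. if 1 \<le> k \<and> k \<le> r then binary_form (d k) (\<lambda>i. c (k, i)) else 0)"

definition rep_space :: "nat \<Rightarrow> (nat \<Rightarrow> nat) \<Rightarrow> (nat \<Rightarrow> complex^2 \<Rightarrow> complex) set" where
  "rep_space r d = range (rep_vec r d)"

definition sl2_act ::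
    "complex^2^2 \<Rightarrow> (nat \<Rightarrow> complex^2 \<Rightarrow> complex) \<Rightarrow> nat \<Rightarrow> complex^2 \<Rightarrow> complex" where
  "sl2_act g F = (\<lambda>k z. F k (matrix_inv g *v z))"

definition rep_fixed :: "nat \<Rightarrow> (nat \<Rightarrow> nat) \<Rightarrow> (nat \<Rightarrow> complex^2 \<Rightarrow> complex) set" where
  "rep_fixed r d = {F \<in> rep_space r d. \<forall>g\<in>SL2. sl2_act g F = F}"

definition exponents :: "nat \<Rightarrow> (nat \<Rightarrow> nat) \<Rightarrow> nat \<Rightarrow> (nat \<times> nat \<Rightarrow> nat) set" where
  "exponents r d n = {m. (\<forall>x. x \<notin> Theta r d \<longrightarrow> m x = 0) \<and> (\<Sum>x\<in>Theta r d. m x) = n}"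

(* Homogeneous polynomial functions of degree n on V, in the coefficient coordinates.
   They are set to 0 outside V so that equality of functions is equality on V. *)

definition hom_poly_funs ::
    "nat \<Rightarrow> (nat \<Rightarrow> nat) \<Rightarrow> nat \<Rightarrow> ((nat \<Rightarrow> complex^2 \<Rightarrow> complex) \<Rightarrow> complex) set" where
  "hom_poly_funs r d n =
     {p. (\<forall>F. F \<notin> rep_space r d \<longrightarrow> p F = 0) \<and>
         (\<exists>q. \<forall>c. p (rep_vec r d c) =
                (\<Sum>m\<in>exponents r d n. q m * (\<Prod>x\<in>Theta r d. c x ^ m x)))}"

definition invariant_polys ::
    "nat \<Rightarrow> (nat \<Rightarrow> nat) \<Rightarrow> nat \<Rightarrow> ((nat \<Rightarrow> complex^2 \<Rightarrow> complex) \<Rightarrow> complex) set" where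
  "invariant_polys r d n =
     {p \<in> hom_poly_funs r d n. \<forall>g\<in>SL2. \<forall>F\<in>rep_space r d. p (sl2_act g F) = p F}"

definition hilbert_function :: "nat \<Rightarrow> (nat \<Rightarrow> nat) \<Rightarrow> nat \<Rightarrow> nat" where
  "hilbert_function r d n =
     vector_space.dim (\<lambda>(c::complex) p F. c * p F) (invariant_polys r d n)"

definition Hilb :: "nat \<Rightarrow> (nat \<Rightarrow> nat) \<Rightarrow> complex \<Rightarrow> complex" where
  "Hilb r d t = (\<Sum>n. of_nat (hilbert_function r d n) * t ^ n)"

definition wt :: "(nat \<Rightarrow> nat) \<Rightarrow> nat \<times> nat \<Rightarrow> int" where
  "wt d = (\<lambda>(k, i). 2 * int i - int (d k))"

definition num_even :: "nat \<Rightarrow> (nat \<Rightarrow> nat) \<Rightarrow> nat" where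
  "num_even r d = card {k \<in> {1..r}. even (d k)}"

definition unit_roots :: "int \<Rightarrow> complex set" where
  "unit_roots a = {\<zeta>. \<zeta> powi a = 1}"

(* The real power t^s, for a chosen value l of log t. *)

definition rpow :: "complex \<Rightarrow> real \<Rightarrow> complex" where
  "rpow l s = exp (of_real s * l)"

definition beta ::
    "(nat \<Rightarrow> nat) \<Rightarrow> complex \<Rightarrow> (nat \<times> nat \<Rightarrow> real) \<Rightarrow> nat \<times> nat \<Rightarrow> nat \<times> nat \<Rightarrow> complex \<Rightarrow> complex" where
  "beta d l b X x \<zeta> =
     (1 - \<zeta> powi (- wt d x) * rpow l ((b X - b x) / b X)) *
     (1 - \<zeta> powi (wt d x) * rpow l ((b X + b x) / b X))"

definition denom_Lambda ::
    "nat \<Rightarrow> (nat \<Rightarrow> nat) \<Rightarrow> complex \<Rightarrow> complex \<Rightarrow> (nat \<times> nat \<Rightarrow> real) \<Rightarrow> nat \<times> nat \<Rightarrow> complex \<Rightarrow> complex" where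
  "denom_Lambda r d t l b X \<zeta> =
     of_real (b X) * (1 - t ^ 2) * (1 - t) ^ num_even r d *
     (\<Prod>x\<in>Lambda r d - {X}. beta d l b X x \<zeta>)"

definition denom_Theta ::
    "nat \<Rightarrow> (nat \<Rightarrow> nat) \<Rightarrow> complex \<Rightarrow> (nat \<times> nat \<Rightarrow> real) \<Rightarrow> nat \<times> nat \<Rightarrow> complex \<Rightarrow> complex" where
  "denom_Theta r d l b X \<zeta> =
     of_real (b X) *
     (\<Prod>x\<in>Theta r d - {X}. 1 - \<zeta> powi (- wt d x) * rpow l ((b X - b x) / b X))"

definition sum_Lambda ::
    "nat \<Rightarrow> (nat \<Rightarrow> nat) \<Rightarrow> complex \<Rightarrow> complex \<Rightarrow> (nat \<times> nat \<Rightarrow> real) \<Rightarrow> complex" where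
  "sum_Lambda r d t l b =
     (\<Sum>X\<in>Lambda r d. \<Sum>\<zeta>\<in>unit_roots (wt d X).
        (1 - \<zeta> ^ 2 * rpow l (2 / b X)) / denom_Lambda r d t l b X \<zeta>)"

definition sum_Theta ::
    "nat \<Rightarrow> (nat \<Rightarrow> nat) \<Rightarrow> complex \<Rightarrow> (nat \<times> nat \<Rightarrow> real) \<Rightarrow> complex" where
  "sum_Theta r d l b =
     (\<Sum>X\<in>Lambda r d. \<Sum>\<zeta>\<in>unit_roots (wt d X).
        (1 - \<zeta> ^ 2 * rpow l (2 / b X)) / denom_Theta r d l b X \<zeta>)"

(* A parameter family (b x) indexed by a finite set S is a function in extensional S;
   on extensional S the topology of pointwise convergence is that of R^S.
   The sets below consist of the parameter families for which no denominator vanishes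
   (in particular b X is nonzero, being a factor of the denominator). *)

definition params_Lambda ::
    "nat \<Rightarrow> (nat \<Rightarrow> nat) \<Rightarrow> complex \<Rightarrow> complex \<Rightarrow> (nat \<times> nat \<Rightarrow> real) set" where
  "params_Lambda r d t l =
     {b \<in> extensional (Lambda r d).
        \<forall>X\<in>Lambda r d. \<forall>\<zeta>\<in>unit_roots (wt d X). denom_Lambda r d t l b X \<zeta> \<noteq> 0}"

definition params_Theta ::
    "nat \<Rightarrow> (nat \<Rightarrow> nat) \<Rightarrow> complex \<Rightarrow> (nat \<times> nat \<Rightarrow> real) set" where
  "params_Theta r d l =
     {b \<in> extensional (Theta r d).
        \<forall>X\<in>Lambda r d. \<forall>\<zeta>\<in>unit_roots (wt d X). denom_Theta r d l b X \<zeta> \<noteq> 0}"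

definition base_params :: "(nat \<Rightarrow> nat) \<Rightarrow> (nat \<times> nat) set \<Rightarrow> nat \<times> nat \<Rightarrow> real" where
  "base_params d S = restrict (\<lambda>x. of_int (wt d x)) S"

end

theory Submission
  imports Defs "HOL-Complex_Analysis.Residue_Theorem"
begin

text \<open>
  The invariants of degree \<open>n\<close> are the polynomials killed by the raising and lowering operators of
  \<open>sl\<^sub>2\<close>.  These are adjoint for a suitable inner product, which shows that the invariants are the
  kernel of the raising operator on weight 0, and that this operator maps weight 0 onto weight 2.
  So their dimension is the number of monomials of weight 0 minus the number of those of weight 2,
  and the Hilbert series is the Molien-Weyl integral of
  \<open>(1 - z\<^sup>2) / (z \<Prod> (1 - t z powi (- a)))\<close> over the unit circle.

  By the residue theorem it is the sum of the residues at the points \<open>z\<close> with \<open>z powi a = t\<close>, \<open>a > 0\<close>,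
  some of which are multiple poles.  Replacing the weights \<open>a\<close> by generic real parameters \<open>b\<close> near one
  such point splits the multiple pole into simple poles, whose residues are the summands of the
  formula; their sum is an integral over a small fixed circle, hence continuous in \<open>b\<close>.
\<close>

section \<open>Differential operators on coefficient families\<close>

text \<open>There is no single perturbed integrand on the disc: for real \<open>b\<close> the powers
  of \<open>z\<close> are multivalued around 0. So the perturbation is carried out separately for
  every weight \<alpha> > 0 and every \<zeta> with \<zeta> powi \<alpha> = 1, with a branch of the
  logarithm near \<zeta> exp (l / \<alpha>). The modulus exp (Re l / \<alpha>) determines \<alpha>,
  so these centres enumerate the poles without repetition, and the summands belonging to weight
  \<alpha> and root \<zeta> are the residues at the simple poles that split off from one centre.
  When weights coincide, a single summand may blow up in the limit; the sum over a cluster is the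
  quantity that converges.

  On the algebraic side, invariance under SL2 is reduced to two one-parameter groups of shears,
  whose derivatives in the parameter are the raising and lowering operators. The formula over
  \<open>Lambda\<close> is the formula over \<open>Theta\<close> at parameters that change sign when
  the coefficients of each form are reversed: there the denominators agree.\<close>

text \<open>
  A polynomial in the variables \<open>c x\<close> is represented by its coefficients, a function of the
  exponents \<open>m\<close>.  On coefficients, \<open>mult_var x\<close> is multiplication by \<open>c x\<close> and \<open>deriv_var x\<close> is
  the derivative in direction \<open>c x\<close>.
\<close>

definition mult_var :: "'a \<Rightarrow> (('a \<Rightarrow> nat) \<Rightarrow> complex) \<Rightarrow> ('a \<Rightarrow> nat) \<Rightarrow> complex" where
  "mult_var x q m = (if m x = 0 then 0 else q (m(x := m x - 1)))"

definition deriv_var :: "'a \<Rightarrow> (('a \<Rightarrow> nat) \<Rightarrow> complex) \<Rightarrow> ('a \<Rightarrow> nat) \<Rightarrow> complex" where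
  "deriv_var x q m = of_nat (Suc (m x)) * q (m(x := Suc (m x)))"

text \<open>Exponents after one factor \<open>c x\<close> of a monomial is replaced by
  \<open>c y\<close>. The subtraction truncates, hence the hypothesis \<open>m x \<noteq> 0\<close>
  in the facts below.\<close>

definition move :: "'a \<Rightarrow> 'a \<Rightarrow> ('a \<Rightarrow> nat) \<Rightarrow> 'a \<Rightarrow> nat" where
  "move x y m = m(x := m x - 1, y := Suc (m y))"

definition degs :: "'a set \<Rightarrow> nat \<Rightarrow> ('a \<Rightarrow> nat) set" where
  "degs S n = {m. (\<forall>x. x \<notin> S \<longrightarrow> m x = 0) \<and> (\<Sum>x\<in>S. m x) = n}"

lemma finite_degs: "finite S \<Longrightarrow> finite (degs S n)"
proof -
  assume S: "finite S"
  have "degs S n \<subseteq> {m. \<forall>x. (x \<in> S \<longrightarrow> m x \<in> {..n}) \<and> (x \<notin> S \<longrightarrow> m x = 0)}"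
    using member_le_sum[of _ S] S by (fastforce simp: degs_def)
  then show ?thesis
    using finite_set_of_finite_funs[OF S finite_atMost] finite_subset by blast
qed

lemma deriv_var_mult_var: "deriv_var x (mult_var y q) m = mult_var y (deriv_var x q) m + (if x = y then q m else 0)"
proof (cases "x = y")
  case True
  then show ?thesis by (cases "m y") (auto simp: deriv_var_def mult_var_def algebra_simps fun_upd_idem)
qed (auto simp: deriv_var_def mult_var_def fun_upd_twist)

lemma mult_var_mult_var: "mult_var x (mult_var y q) m = mult_var y (mult_var x q) m"
  by (auto simp: mult_var_def fun_upd_twist)

lemma deriv_var_deriv_var: "deriv_var x (deriv_var y q) m = deriv_var y (deriv_var x q) m"
  by (auto simp: deriv_var_def fun_upd_twist)

lemma mult_var_deriv_var_same: "mult_var x (deriv_var x q) m = of_nat (m x) * q m"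
  by (auto simp: deriv_var_def mult_var_def)

lemma mult_var_add: "mult_var x (\<lambda>m. p m + q m) m = mult_var x p m + mult_var x q m"
  by (auto simp: mult_var_def)

lemma mult_var_deriv_var_move:
  assumes "x \<noteq> y"
  shows "mult_var y (deriv_var x q) m = (if m y = 0 then 0 else of_nat (Suc (m x)) * q (move y x m))"
  using assms by (auto simp: mult_var_def deriv_var_def move_def)

text \<open>The commutator relation of elementary matrices. Both products are brought to the order
  multiplications before derivatives; the second-order parts then agree, and the differences come
  from \<open>deriv_var_mult_var\<close>.\<close>

lemma mult_var_deriv_var_commutator:
  "mult_var x' (deriv_var x (mult_var y (deriv_var y' q))) m - mult_var y (deriv_var y' (mult_var x' (deriv_var x q))) m =
   (if x = y then mult_var x' (deriv_var y' q) m else 0) - (if x' = y' then mult_var y (deriv_var x q) m else 0)"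
proof -
  have "mult_var x' (deriv_var x (mult_var y (deriv_var y' q))) m =
      mult_var x' (mult_var y (deriv_var x (deriv_var y' q))) m + (if x = y then mult_var x' (deriv_var y' q) m else 0)"
    unfolding deriv_var_mult_var[abs_def] mult_var_add by (auto simp: mult_var_def)
  moreover have "mult_var y (deriv_var y' (mult_var x' (deriv_var x q))) m =
      mult_var x' (mult_var y (deriv_var x (deriv_var y' q))) m + (if x' = y' then mult_var y (deriv_var x q) m else 0)"
    unfolding deriv_var_mult_var[abs_def] mult_var_add mult_var_mult_var[of y x' _ m] deriv_var_deriv_var[abs_def, of y' x]
    by (auto simp: mult_var_def)
  ultimately show ?thesis by simp
qed

text \<open>Used with f = 1 to see that the degree is preserved, and with f = \<open>wt\<close> to
  follow the weight.\<close>

lemma sum_move: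
  fixes f :: "'a \<Rightarrow> 'b::comm_ring_1"
  assumes "finite S" "x \<in> S" "y \<in> S" "x \<noteq> y" "m x \<noteq> 0"
  shows "(\<Sum>z\<in>S. f z * of_nat (move x y m z)) = (\<Sum>z\<in>S. f z * of_nat (m z)) - f x + f y"
proof -
  have split: "(\<Sum>z\<in>S. f z * of_nat (m z)) = f x * of_nat (m x) + (f y * of_nat (m y) + (\<Sum>z\<in>S - {x} - {y}. f z * of_nat (m z)))"
    for m :: "'a \<Rightarrow> nat"
    using assms by (simp add: sum.remove[of S x] sum.remove[of "S - {x}" y])
  have *: "(\<Sum>z\<in>S - {x} - {y}. f z * of_nat (move x y m z)) = (\<Sum>z\<in>S - {x} - {y}. f z * of_nat (m z))"
    by (intro sum.cong) (auto simp: move_def)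
  obtain k where "m x = Suc k" using assms(5) not0_implies_Suc by blast
  then show ?thesis
    unfolding split * using assms by (simp add: move_def algebra_simps)
qed

lemma move_in_degs:
  assumes "finite S" "x \<in> S" "y \<in> S" "x \<noteq> y" "m x \<noteq> 0" "m \<in> degs S n"
  shows "move x y m \<in> degs S n"
proof -
  have "(\<Sum>z\<in>S. int (move x y m z)) = int n"
    using sum_move[of S x y m "\<lambda>_. 1::int"] assms by (simp add: degs_def flip: of_nat_sum)
  then have "(\<Sum>z\<in>S. move x y m z) = n" by (simp flip: of_nat_sum)
  then show ?thesis using assms by (auto simp: degs_def move_def)
qed

lemma move_move: "x \<noteq> y \<Longrightarrow> m x \<noteq> 0 \<Longrightarrow> move y x (move x y m) = m"
  by (auto simp: move_def)

text \<open>Reindexing by \<open>move\<close> transposes the operator onto the test function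
  \<open>G\<close>. Taking for \<open>G\<close> the values of monomials gives the evaluation of
  polynomials, taking conjugate coefficients times \<open>mu\<close> gives adjointness.\<close>

lemma sum_mult_var_deriv_var:
  assumes "finite S" "x \<in> S" "y \<in> S" "x \<noteq> y"
  shows "(\<Sum>m\<in>degs S n. mult_var y (deriv_var x q) m * G m) =
         (\<Sum>m\<in>degs S n. of_nat (m x) * q m * G (move x y m))"
proof -
  have "(\<Sum>m\<in>degs S n. mult_var y (deriv_var x q) m * G m) =
        (\<Sum>m\<in>{m\<in>degs S n. m y \<noteq> 0}. of_nat (Suc (m x)) * q (move y x m) * G m)"
    unfolding mult_var_deriv_var_move[OF \<open>x \<noteq> y\<close>]
    by (rule sum.mono_neutral_cong_right) (auto simp: finite_degs assms)
  also have "\<dots> = (\<Sum>m\<in>{m\<in>degs S n. m x \<noteq> 0}. of_nat (m x) * q m * G (move x y m))"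
    using assms by (intro sum.reindex_bij_witness[of _ "move x y" "move y x"])
      (auto simp: move_move move_in_degs, auto simp: move_def)
  also have "\<dots> = (\<Sum>m\<in>degs S n. of_nat (m x) * q m * G (move x y m))"
    by (rule sum.mono_neutral_left) (auto simp: finite_degs assms)
  finally show ?thesis .
qed

lemma mult_var_deriv_var_support:
  assumes "finite S" "x \<in> S" "y \<in> S" "x \<noteq> y" "\<And>m. m \<notin> degs S n \<Longrightarrow> q m = 0" "m \<notin> degs S n"
  shows "mult_var y (deriv_var x q) m = 0"
proof (cases "m y = 0")
  case False
  have "move y x m \<notin> degs S n"
  proof
    assume "move y x m \<in> degs S n"
    moreover have "move y x m x \<noteq> 0" by (simp add: move_def)
    ultimately have "move x y (move y x m) \<in> degs S n" using move_in_degs[of S x y "move y x m" n] assms by blast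
    then show False using assms False move_move[of y x m] by auto
  qed
  then show ?thesis using assms by (simp add: mult_var_deriv_var_move)
qed (simp add: mult_var_def)

text \<open>
  The derivations \<open>c x \<mapsto> \<alpha> x * c (\<sigma> x)\<close> and \<open>c (\<sigma> x) \<mapsto> \<beta> x * c x\<close> generate an \<open>sl\<^sub>2\<close>-action.  The
  numbers \<open>w x\<close> are the squared lengths of the variables for an inner product that makes the two
  derivations adjoint to each other.
\<close>

locale sl2_module =
  fixes S J :: "'a set" and \<sigma> :: "'a \<Rightarrow> 'a" and \<alpha> \<beta> w :: "'a \<Rightarrow> real" and wt :: "'a \<Rightarrow> int"
  assumes finite_S: "finite S" and J_subset: "J \<subseteq> S" and \<sigma>_in: "x \<in> J \<Longrightarrow> \<sigma> x \<in> S"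
    and \<sigma>_inj: "inj_on \<sigma> J" and wt_\<sigma>: "x \<in> J \<Longrightarrow> wt (\<sigma> x) = wt x + 2"
    and w_pos: "x \<in> S \<Longrightarrow> w x > 0" and w_adjoint: "x \<in> J \<Longrightarrow> w (\<sigma> x) * \<alpha> x = \<beta> x * w x"
    and wt_commutator: "(\<Sum>x\<in>J. \<alpha> x * \<beta> x * (real (m (\<sigma> x)) - real (m x))) =
                        (\<Sum>x\<in>S. of_int (wt x) * real (m x))"
begin

definition raise :: "(('a \<Rightarrow> nat) \<Rightarrow> complex) \<Rightarrow> ('a \<Rightarrow> nat) \<Rightarrow> complex" where
  "raise q m = (\<Sum>x\<in>J. of_real (\<alpha> x) * mult_var (\<sigma> x) (deriv_var x q) m)"

definition lower :: "(('a \<Rightarrow> nat) \<Rightarrow> complex) \<Rightarrow> ('a \<Rightarrow> nat) \<Rightarrow> complex" where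
  "lower q m = (\<Sum>x\<in>J. of_real (\<beta> x) * mult_var x (deriv_var (\<sigma> x) q) m)"

definition weight :: "('a \<Rightarrow> nat) \<Rightarrow> int" where
  "weight m = (\<Sum>x\<in>S. wt x * int (m x))"

text \<open>The squared length of a monomial in the Fischer inner product, for which multiplication
  by \<open>c x\<close> is adjoint to \<open>w x\<close> times the derivative in direction
  \<open>c x\<close>.\<close>

definition mu :: "('a \<Rightarrow> nat) \<Rightarrow> real" where
  "mu m = (\<Prod>x\<in>S. fact (m x) * w x ^ m x)"

definition form :: "nat \<Rightarrow> (('a \<Rightarrow> nat) \<Rightarrow> complex) \<Rightarrow> (('a \<Rightarrow> nat) \<Rightarrow> complex) \<Rightarrow> complex" where
  "form n p q = (\<Sum>m\<in>degs S n. p m * cnj (q m) * of_real (mu m))"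

definition homog :: "nat \<Rightarrow> int \<Rightarrow> (('a \<Rightarrow> nat) \<Rightarrow> complex) set" where
  "homog n k = {q. \<forall>m. q m \<noteq> 0 \<longrightarrow> m \<in> degs S n \<and> weight m = k}"

lemma \<sigma>_neq: "x \<in> J \<Longrightarrow> \<sigma> x \<noteq> x"
  using wt_\<sigma>[of x] by auto

lemma mult_var_scale_sum: "mult_var x (deriv_var y (\<lambda>m. \<Sum>i\<in>I. c i * f i m)) m = (\<Sum>i\<in>I. c i * mult_var x (deriv_var y (f i)) m)"
  by (auto simp: mult_var_def deriv_var_def sum_distrib_left intro!: sum.cong)

text \<open>Injectivity of \<open>\<sigma>\<close> leaves only the terms x = y of the double sum.
  They multiply \<open>q m\<close> by differences of exponents, which \<open>wt_commutator\<close>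
  adds up to the weight.\<close>

lemma commutator: "raise (lower q) m = lower (raise q) m + of_int (weight m) * q m" if "m \<in> degs S n"
proof -
  have finJ: "finite J" using finite_S J_subset finite_subset by blast
  have "raise (lower q) m = (\<Sum>x\<in>J. \<Sum>y\<in>J. of_real (\<alpha> x * \<beta> y) * mult_var (\<sigma> x) (deriv_var x (mult_var y (deriv_var (\<sigma> y) q))) m)"
    unfolding raise_def lower_def[abs_def] mult_var_scale_sum by (simp add: sum_distrib_left mult.assoc)
  moreover have "lower (raise q) m = (\<Sum>y\<in>J. \<Sum>x\<in>J. of_real (\<alpha> x * \<beta> y) * mult_var y (deriv_var (\<sigma> y) (mult_var (\<sigma> x) (deriv_var x q))) m)"
    unfolding lower_def raise_def[abs_def] mult_var_scale_sum by (simp add: sum_distrib_left mult_ac)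
  moreover have "\<dots> = (\<Sum>x\<in>J. \<Sum>y\<in>J. of_real (\<alpha> x * \<beta> y) * mult_var y (deriv_var (\<sigma> y) (mult_var (\<sigma> x) (deriv_var x q))) m)"
    by (rule sum.swap)
  ultimately have "raise (lower q) m - lower (raise q) m =
      (\<Sum>x\<in>J. \<Sum>y\<in>J. of_real (\<alpha> x * \<beta> y) *
        ((if x = y then mult_var (\<sigma> x) (deriv_var (\<sigma> y) q) m else 0) - (if \<sigma> x = \<sigma> y then mult_var y (deriv_var x q) m else 0)))"
    by (simp add: sum_subtractf[symmetric] right_diff_distrib[symmetric] mult_var_deriv_var_commutator)
  also have "\<dots> = (\<Sum>x\<in>J. \<Sum>y\<in>J. if x = y then of_real (\<alpha> x * \<beta> x) * ((of_nat (m (\<sigma> x)) - of_nat (m x)) * q m) else 0)"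
    using \<sigma>_inj by (intro sum.cong refl) (auto simp: mult_var_deriv_var_same algebra_simps dest: inj_onD)
  also have "\<dots> = of_real (\<Sum>x\<in>J. \<alpha> x * \<beta> x * (real (m (\<sigma> x)) - real (m x))) * q m"
    using finJ by (simp add: sum_distrib_right mult.assoc)
  also have "\<dots> = of_int (weight m) * q m"
    unfolding wt_commutator by (simp add: weight_def)
  finally show ?thesis by (simp add: algebra_simps)
qed

lemma mu_pos: "mu m > 0"
  unfolding mu_def using w_pos by (auto intro!: prod_pos)

lemma mu_move:
  assumes "x \<in> S" "y \<in> S" "x \<noteq> y" "m x \<noteq> 0"
  shows "real (m x) * w x * mu (move x y m) = real (Suc (m y)) * w y * mu m"
proof -
  define f where "f m z = fact (m z) * w z ^ m z" for m z
  have mu: "mu m = f m x * (f m y * (\<Prod>z\<in>S - {x} - {y}. f m z))" for m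
    unfolding mu_def f_def[symmetric] using assms finite_S
    by (simp add: prod.remove[of S x] prod.remove[of "S - {x}" y])
  have "(\<Prod>z\<in>S - {x} - {y}. f (move x y m) z) = (\<Prod>z\<in>S - {x} - {y}. f m z)"
    by (intro prod.cong) (auto simp: move_def f_def)
  moreover obtain k where "m x = Suc k" using assms(4) not0_implies_Suc by blast
  ultimately show ?thesis using assms by (simp add: mu f_def move_def algebra_simps)
qed

text \<open>The factor \<open>m x\<close> produced by the derivative is traded by
  \<open>mu_move\<close> for the factor \<open>Suc (m y)\<close> of the opposite operator.\<close>

lemma form_mult_var_deriv_var:
  assumes "x \<in> S" "y \<in> S" "x \<noteq> y"
  shows "of_real (w x) * form n (mult_var y (deriv_var x p)) q = of_real (w y) * form n p (mult_var x (deriv_var y q))"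
proof -
  have "of_real (w x) * form n (mult_var y (deriv_var x p)) q =
      (\<Sum>m\<in>degs S n. of_real (w x) * (of_nat (m x) * p m * (cnj (q (move x y m)) * of_real (mu (move x y m)))))"
    unfolding form_def mult.assoc using sum_mult_var_deriv_var[OF finite_S assms, of p "\<lambda>m. cnj (q m) * of_real (mu m)" n]
    by (simp add: sum_distrib_left mult.assoc)
  also have "\<dots> = (\<Sum>m\<in>degs S n. of_real (w y) * (p m * cnj (mult_var x (deriv_var y q) m) * of_real (mu m)))"
  proof (rule sum.cong[OF refl])
    fix m
    show "of_real (w x) * (of_nat (m x) * p m * (cnj (q (move x y m)) * of_real (mu (move x y m)))) =
        of_real (w y) * (p m * cnj (mult_var x (deriv_var y q) m) * of_real (mu m))"
    proof (cases "m x = 0")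
      case False
      have "of_real (w x) * (of_nat (m x) * p m * (cnj (q (move x y m)) * of_real (mu (move x y m)))) =
          complex_of_real (real (m x) * w x * mu (move x y m)) * p m * cnj (q (move x y m))"
        by (simp add: mult_ac)
      also have "\<dots> = complex_of_real (real (Suc (m y)) * w y * mu m) * p m * cnj (q (move x y m))"
        using mu_move[of x y m] assms False by simp
      also have "\<dots> = of_real (w y) * (p m * cnj (mult_var x (deriv_var y q) m) * of_real (mu m))"
        using assms False by (subst mult_var_deriv_var_move) (auto simp: algebra_simps)
      finally show ?thesis .
    qed (simp add: mult_var_def)
  qed
  finally show ?thesis by (simp add: form_def sum_distrib_left)
qed

lemma form_sum_left: "form n (\<lambda>m. \<Sum>x\<in>I. of_real (c x) * f x m) q = (\<Sum>x\<in>I. of_real (c x) * form n (f x) q)"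
  unfolding form_def by (simp add: sum_distrib_left sum_distrib_right mult_ac sum.swap[of _ I])

lemma form_sum_right: "form n p (\<lambda>m. \<Sum>x\<in>I. of_real (c x) * f x m) = (\<Sum>x\<in>I. of_real (c x) * form n p (f x))"
  unfolding form_def by (simp add: sum_distrib_left sum_distrib_right mult_ac sum.swap[of _ I])

lemma form_raise: "form n (raise p) q = form n p (lower q)"
proof -
  have "of_real (\<alpha> x) * form n (mult_var (\<sigma> x) (deriv_var x p)) q = of_real (\<beta> x) * form n p (mult_var x (deriv_var (\<sigma> x) q))"
    if x: "x \<in> J" for x
  proof -
    have S: "x \<in> S" "\<sigma> x \<in> S" using x J_subset \<sigma>_in by auto
    have "of_real (w x) * (of_real (\<alpha> x) * form n (mult_var (\<sigma> x) (deriv_var x p)) q) =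
        complex_of_real (w (\<sigma> x) * \<alpha> x) * form n p (mult_var x (deriv_var (\<sigma> x) q))"
      using form_mult_var_deriv_var[OF S \<sigma>_neq[OF x, symmetric], of n p q] by (simp add: mult_ac)
    also have "\<dots> = of_real (w x) * (of_real (\<beta> x) * form n p (mult_var x (deriv_var (\<sigma> x) q)))"
      unfolding w_adjoint[OF x] by simp
    finally show ?thesis using w_pos[OF S(1)] by simp
  qed
  then show ?thesis unfolding raise_def[abs_def] lower_def[abs_def] form_sum_left form_sum_right by simp
qed

lemma cnj_form: "cnj (form n p q) = form n q p"
  by (simp add: form_def mult_ac)

lemma form_lower: "form n (lower p) q = form n p (raise q)"
  by (metis cnj_form form_raise)

lemma form_self: "form n q q = of_real (\<Sum>m\<in>degs S n. (cmod (q m))\<^sup>2 * mu m)"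
  by (simp add: form_def complex_norm_square[symmetric] del: of_real_power flip: of_real_mult)

text \<open>An upper bound is assumed because \<open>raise_lower_inj\<close> obtains a comparison of
  signs.\<close>

lemma form_eq_0:
  assumes "(\<Sum>m\<in>degs S n. (cmod (q m))\<^sup>2 * mu m) \<le> 0" "m \<in> degs S n"
  shows "q m = 0"
proof -
  have "(\<Sum>m\<in>degs S n. (cmod (q m))\<^sup>2 * mu m) = 0"
    using assms(1) mu_pos by (intro antisym sum_nonneg) (auto simp: less_imp_le)
  then have "(cmod (q m))\<^sup>2 * mu m = 0"
    using assms(2) finite_degs[OF finite_S] mu_pos
    by (subst (asm) sum_nonneg_eq_0_iff) (auto simp: less_imp_le)
  then show ?thesis using mu_pos[of m] by simp
qed

lemma weight_move:
  assumes "x \<in> S" "y \<in> S" "x \<noteq> y" "m x \<noteq> 0"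
  shows "weight (move x y m) = weight m - wt x + wt y"
  using sum_move[of S x y m wt] finite_S assms by (simp add: weight_def)

lemma mult_var_deriv_var_homog:
  assumes "x \<in> S" "y \<in> S" "x \<noteq> y" "q \<in> homog n k"
  shows "mult_var y (deriv_var x q) \<in> homog n (k - wt x + wt y)"
  unfolding homog_def
proof safe
  fix m assume nz: "mult_var y (deriv_var x q) m \<noteq> 0"
  then show "m \<in> degs S n" using mult_var_deriv_var_support[OF finite_S assms(1-3), of n q m] assms(4) by (auto simp: homog_def)
  have my: "m y \<noteq> 0" and "q (move y x m) \<noteq> 0" using nz assms by (auto simp: mult_var_deriv_var_move split: if_splits)
  then have "weight (move y x m) = k" using assms by (auto simp: homog_def)
  then show "weight m = k - wt x + wt y" using weight_move[of y x m] assms my by auto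
qed

lemma homog_sum: "(\<And>x. x \<in> I \<Longrightarrow> f x \<in> homog n k) \<Longrightarrow> (\<lambda>m. \<Sum>x\<in>I. c x * f x m) \<in> homog n k"
  unfolding homog_def by (fastforce elim: sum.not_neutral_contains_not_neutral)

lemma raise_homog: "q \<in> homog n k \<Longrightarrow> raise q \<in> homog n (k + 2)"
  unfolding raise_def[abs_def]
proof (rule homog_sum)
  fix x assume "x \<in> J" "q \<in> homog n k"
  then show "mult_var (\<sigma> x) (deriv_var x q) \<in> homog n (k + 2)"
    using mult_var_deriv_var_homog[of x "\<sigma> x" q n k] J_subset \<sigma>_in \<sigma>_neq[of x] wt_\<sigma> by (auto simp: algebra_simps)
qed

lemma lower_homog: "q \<in> homog n k \<Longrightarrow> lower q \<in> homog n (k - 2)"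
  unfolding lower_def[abs_def]
proof (rule homog_sum)
  fix x assume "x \<in> J" "q \<in> homog n k"
  then show "mult_var x (deriv_var (\<sigma> x) q) \<in> homog n (k - 2)"
    using mult_var_deriv_var_homog[of "\<sigma> x" x q n k] J_subset \<sigma>_in \<sigma>_neq[of x] wt_\<sigma> by auto
qed

text \<open>
  Since the operators are adjoint, the squared length of \<open>lower q\<close> is the inner product of \<open>q\<close> with
  \<open>raise (lower q) = lower (raise q) + weight * q\<close>.
\<close>

lemma lower_eq_0:
  assumes "q \<in> homog n 0" "raise q = 0"
  shows "lower q = 0"
proof -
  have "raise (lower q) m = 0" if "m \<in> degs S n" for m
  proof -
    have "deriv_var x 0 = 0" "mult_var x 0 = 0" for x :: 'a by (auto simp: deriv_var_def mult_var_def fun_eq_iff)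
    then have "lower (raise q) m = 0" by (simp add: assms lower_def)
    then show ?thesis using commutator[OF that, of q] assms(1) by (auto simp: homog_def)
  qed
  then have "form n (lower q) (lower q) = 0"
    unfolding form_lower by (simp add: form_def)
  then have "(\<Sum>m\<in>degs S n. (cmod (lower q m))\<^sup>2 * mu m) = 0" unfolding form_self of_real_eq_0_iff .
  then show ?thesis
    using form_eq_0[of "lower q" n] lower_homog[OF assms(1)] by (auto simp: homog_def fun_eq_iff)
qed

text \<open>On weight 2 the commutator turns the hypothesis into lower (raise q) = - 2 q. By
  adjointness the squared length of \<open>raise q\<close> is - 2 times that of \<open>q\<close>, so
  both vanish.\<close>

lemma raise_lower_inj:
  assumes "q \<in> homog n 2" "raise (lower q) = 0"
  shows "q = 0"
proof -
  have "form n (raise q) (raise q) = form n q (lower (raise q))" by (rule form_raise)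
  also have "\<dots> = form n q (\<lambda>m. - 2 * q m)"
    unfolding form_def
  proof (rule sum.cong[OF refl])
    fix m assume m: "m \<in> degs S n"
    have "lower (raise q) m = - of_int (weight m) * q m"
      using commutator[OF m, of q] assms(2) by (simp add: algebra_simps eq_neg_iff_add_eq_0)
    moreover have "q m = 0 \<or> weight m = 2" using assms(1) by (auto simp: homog_def)
    ultimately show "q m * cnj (lower (raise q) m) * of_real (mu m) = q m * cnj (- 2 * q m) * of_real (mu m)"
      by auto
  qed
  also have "\<dots> = - 2 * form n q q" by (simp add: form_def sum_distrib_left mult_ac)
  finally have "form n (raise q) (raise q) = - 2 * form n q q" .
  moreover have "a = - 2 * b" if "complex_of_real a = - 2 * complex_of_real b" for a b
    using that by (simp add: complex_eq_iff)
  ultimately have "(\<Sum>m\<in>degs S n. (cmod (raise q m))\<^sup>2 * mu m) = - 2 * (\<Sum>m\<in>degs S n. (cmod (q m))\<^sup>2 * mu m)"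
    unfolding form_self by blast
  moreover have "(\<Sum>m\<in>degs S n. (cmod (raise q m))\<^sup>2 * mu m) \<ge> 0"
    using mu_pos by (intro sum_nonneg) (auto simp: less_imp_le)
  ultimately have "(\<Sum>m\<in>degs S n. (cmod (q m))\<^sup>2 * mu m) \<le> 0" by linarith
  then show ?thesis using form_eq_0[of q n] assms(1) by (auto simp: homog_def fun_eq_iff)
qed

end

section \<open>Dimension counts\<close>

lemma (in vector_space) subspace_eq_if_dim_eq:
  assumes "subspace U" "U \<subseteq> V" "V \<subseteq> span T" "finite T" "dim U = dim V"
  shows "U = V"
proof -
  obtain B where B: "B \<subseteq> U" "independent B" "U \<subseteq> span B"
    using maximal_independent_subset .
  obtain C where C: "B \<subseteq> C" "C \<subseteq> V" "independent C" "V \<subseteq> span C"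
    using maximal_independent_subset_extend[of B V] B assms(2) by blast
  have "finite C" using independent_span_bound[OF assms(4) C(3)] C(2) assms(3) by blast
  moreover have "card B = card C"
    using basis_card_eq_dim[OF B(1,3,2)] basis_card_eq_dim[OF C(2,4,3)] assms(5) by simp
  ultimately have "B = C" using C(1) card_subset_eq by blast
  then have "V \<subseteq> U" using C(4) B(1) assms(1) span_minimal by blast
  then show ?thesis using assms(2) by blast
qed

lemma (in vector_space) span_disjoint_Int:
  assumes "independent (B \<union> D)" "B \<inter> D = {}" "x \<in> span B" "x \<in> span D"
  shows "x = 0"
proof -
  have eq: "representation (B \<union> D) x = representation B x" "representation (B \<union> D) x = representation D x"
    using assms by (auto intro!: representation_extend)
  then have "representation B x b = 0" for b
    using representation_ne_zero[of B x b] representation_ne_zero[of D x b] assms(2) by auto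
  then show ?thesis
    using sum_nonzero_representation_eq[of B x] assms(1,3) independent_mono[of "B \<union> D" B] by auto
qed

text \<open>Rank-nullity on a subspace: a basis of the kernel is extended to a basis of
  \<open>V\<close>, and \<open>f\<close> is injective on the span of the added vectors. The finite
  set \<open>T\<close> certifies finite dimension inside a possibly infinite-dimensional function
  space.\<close>

lemma (in vector_space_pair) dim_kernel_plus_image:
  assumes lin: "Vector_Spaces.linear s1 s2 f" and V: "vs1.subspace V" "V \<subseteq> vs1.span T" "finite T"
  shows "vs1.dim V = vs1.dim {x \<in> V. f x = 0} + vs2.dim (f ` V)"
proof -
  interpret f: Vector_Spaces.linear s1 s2 f by (rule lin)
  define K where "K = {x \<in> V. f x = 0}"
  obtain B where B: "B \<subseteq> K" "vs1.independent B" "K \<subseteq> vs1.span B"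
    using vs1.maximal_independent_subset .
  obtain C where C: "B \<subseteq> C" "C \<subseteq> V" "vs1.independent C" "V \<subseteq> vs1.span C"
    using vs1.maximal_independent_subset_extend[of B V] B K_def by blast
  have fin: "finite C" using vs1.independent_span_bound[OF V(3) C(3)] C(2) V(2) by blast
  define D where "D = C - B"
  have CD: "C = B \<union> D" "B \<inter> D = {}" using C(1) by (auto simp: D_def)
  have DV: "vs1.span D \<subseteq> V" using vs1.span_minimal[of D V] C(2) V(1) by (auto simp: D_def)
  have inj: "inj_on f (vs1.span D)"
    unfolding f.inj_on_iff_eq_0[OF vs1.subspace_span]
  proof safe
    fix x assume x: "x \<in> vs1.span D" "f x = 0"
    then have "x \<in> vs1.span B" using DV B(3) by (auto simp: K_def)
    then show "x = 0" using vs1.span_disjoint_Int[of B D x] x C(3) CD by auto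
  qed
  have "vs2.independent (f ` D)"
    using f.independent_injective_image[OF _ inj] C(3) CD vs1.independent_mono by blast
  moreover have "f ` V \<subseteq> vs2.span (f ` D)"
  proof -
    have "f ` V \<subseteq> vs2.span (f ` C)" using C(4) f.spans_image by blast
    also have "f ` C \<subseteq> vs2.span (f ` D)"
      using B(1) vs2.span_zero vs2.span_superset[of "f ` D"] unfolding CD(1) K_def by fastforce
    then have "vs2.span (f ` C) \<subseteq> vs2.span (f ` D)" using vs2.span_minimal by blast
    finally show ?thesis .
  qed
  moreover have "f ` D \<subseteq> f ` V" using C(2) by (auto simp: D_def)
  moreover have "card (f ` D) = card D"
    using inj inj_on_subset[OF _ vs1.span_superset] card_image by blast
  ultimately have "vs2.dim (f ` V) = card D" using vs2.basis_card_eq_dim by metis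
  moreover have "vs1.dim V = card C" using vs1.basis_card_eq_dim[OF C(2,4,3)] by simp
  moreover have "vs1.dim K = card B" using vs1.basis_card_eq_dim[OF B(1,3,2)] by simp
  moreover have "card C = card B + card D"
    using fin C(1) unfolding D_def by (simp add: card_Diff_subset card_mono finite_subset)
  ultimately show ?thesis unfolding K_def by simp
qed

text \<open>The scaling is the one in \<open>hilbert_function\<close>, so \<open>fun_vs.dim\<close>
  is the dimension occurring there.\<close>

interpretation fun_vs: vector_space "\<lambda>(c::complex) (p :: 'x \<Rightarrow> complex) F. c * p F"
  by unfold_locales (auto simp: fun_eq_iff algebra_simps)

interpretation fun_vs_pair: vector_space_pair "\<lambda>(c::complex) (p :: 'x \<Rightarrow> complex) F. c * p F"
  "\<lambda>(c::complex) (p :: 'y \<Rightarrow> complex) F. c * p F"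
  by unfold_locales

lemma linear_funI:
  assumes "\<And>p q. f (p + q) = f p + f q" "\<And>c p. f (\<lambda>x. c * p x) = (\<lambda>y. c * f p y)"
  shows "Vector_Spaces.linear (\<lambda>(c::complex) (p :: 'x \<Rightarrow> complex) F. c * p F)
    (\<lambda>(c::complex) (p :: 'y \<Rightarrow> complex) F. c * p F) f"
  using assms by unfold_locales auto

definition supp_in :: "'x set \<Rightarrow> ('x \<Rightarrow> complex) set" where
  "supp_in M = {q. \<forall>m. q m \<noteq> 0 \<longrightarrow> m \<in> M}"

lemma subspace_supp_in: "fun_vs.subspace (supp_in M)"
  unfolding fun_vs.subspace_def supp_in_def by auto (metis add.right_neutral)

lemma supp_in_basis:
  fixes M :: "'x set"
  assumes "finite M"
  defines "B \<equiv> (\<lambda>x y. if y = x then 1 else 0 :: complex) ` M"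
  shows "supp_in M \<subseteq> fun_vs.span B" "finite B" "fun_vs.dim (supp_in M) = card M"
proof -
  let ?e = "\<lambda>x y. if y = x then 1 else 0 :: complex"
  have inj: "inj_on ?e M" by (rule inj_onI) (metis zero_neq_one)
  show "finite B" using assms by auto
  have eval: "(\<Sum>v\<in>B. (\<lambda>F. u v * v F)) y = (if y \<in> M then u (?e y) else 0)" for u y
  proof -
    have "(\<Sum>v\<in>B. (\<lambda>F. u v * v F)) y = (\<Sum>v\<in>B. u v * v y)"
      using \<open>finite B\<close> by induction auto
    also have "\<dots> = (\<Sum>x\<in>M. u (?e x) * ?e x y)"
      unfolding B_def using inj by (simp add: sum.reindex)
    also have "\<dots> = (\<Sum>x\<in>M. if y = x then u (?e x) else 0)"
      by (intro sum.cong) auto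
    finally show ?thesis using assms by simp
  qed
  show sp: "supp_in M \<subseteq> fun_vs.span B"
  proof
    fix q assume q: "q \<in> supp_in M"
    define u where "u v = q (the_inv_into M ?e v)" for v
    have "q = (\<Sum>v\<in>B. (\<lambda>F. u v * v F))"
      using q by (auto simp: fun_eq_iff eval u_def the_inv_into_f_f[OF inj] supp_in_def)
    moreover have "(\<Sum>v\<in>B. (\<lambda>F. u v * v F)) \<in> fun_vs.span B"
      by (intro fun_vs.span_sum fun_vs.span_scale fun_vs.span_base)
    ultimately show "q \<in> fun_vs.span B" by simp
  qed
  have "fun_vs.independent B"
  proof (rule fun_vs.independent_if_scalars_zero)
    fix u v assume "(\<Sum>x\<in>B. (\<lambda>F. u x * x F)) = 0" "v \<in> B"
    then show "u v = 0" using eval[of u] by (auto simp: B_def) (metis zero_fun_apply)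
  qed fact
  moreover have "B \<subseteq> supp_in M" by (auto simp: B_def supp_in_def split: if_splits)
  ultimately show "fun_vs.dim (supp_in M) = card M"
    using fun_vs.basis_card_eq_dim[of B "supp_in M"] sp card_image[OF inj] B_def by auto
qed

context sl2_module begin

lemma homog_eq_supp_in: "homog n k = supp_in {m \<in> degs S n. weight m = k}"
  by (auto simp: homog_def supp_in_def)

lemma linear_raise: "Vector_Spaces.linear (\<lambda>(c::complex) p F. c * p F) (\<lambda>(c::complex) p F. c * p F) raise"
  by (rule linear_funI) (auto simp: raise_def mult_var_def deriv_var_def fun_eq_iff distrib_left sum.distrib[symmetric] sum_distrib_left intro!: sum.cong)

lemma linear_lower: "Vector_Spaces.linear (\<lambda>(c::complex) p F. c * p F) (\<lambda>(c::complex) p F. c * p F) lower"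
  by (rule linear_funI) (auto simp: lower_def mult_var_def deriv_var_def fun_eq_iff distrib_left sum.distrib[symmetric] sum_distrib_left intro!: sum.cong)

text \<open>By \<open>raise_lower_inj\<close>, \<open>raise \<circ> lower\<close> is an injective
  endomorphism of the finite-dimensional space of weight 2, hence onto; a preimage under
  \<open>raise\<close> is then supplied by \<open>lower\<close>.\<close>

lemma raise_surj: "raise ` homog n 0 = homog n 2"
proof
  show "raise ` homog n 0 \<subseteq> homog n 2" using raise_homog[of _ n 0] by auto
  define T where "T = raise \<circ> lower"
  have fin: "finite {m \<in> degs S n. weight m = 2}" using finite_degs[OF finite_S] by simp
  have lin: "Vector_Spaces.linear (\<lambda>(c::complex) p F. c * p F) (\<lambda>(c::complex) p F. c * p F) T"
    unfolding T_def by (rule Vector_Spaces.linear_compose[OF linear_lower linear_raise])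
  have sub: "T ` homog n 2 \<subseteq> homog n 2"
    using lower_homog[of _ n 2] raise_homog[of _ n 0] by (auto simp: T_def)
  interpret T: module_hom "\<lambda>(c::complex) p F. c * p F" "\<lambda>(c::complex) p F. c * p F" T
    using lin by (simp add: linear_iff_module_hom)
  have "{x \<in> homog n 2. T x = 0} = {0}"
    using raise_lower_inj T.zero by (auto simp: T_def homog_def)
  moreover have "fun_vs.dim {0 :: ('a \<Rightarrow> nat) \<Rightarrow> complex} = 0"
    by (rule fun_vs.dim_unique[of "{}"]) (auto simp: fun_vs.independent_empty)
  ultimately have "fun_vs.dim (T ` homog n 2) = fun_vs.dim (homog n 2)"
    using fun_vs_pair.dim_kernel_plus_image[OF lin subspace_supp_in supp_in_basis(1,2)[OF fin]]
    unfolding homog_eq_supp_in by simp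
  then have "T ` homog n 2 = homog n 2"
    using fun_vs.subspace_eq_if_dim_eq[OF T.subspace_image[OF subspace_supp_in] sub[unfolded homog_eq_supp_in] supp_in_basis(1,2)[OF fin]]
    unfolding homog_eq_supp_in by simp
  then show "homog n 2 \<subseteq> raise ` homog n 0"
    using lower_homog[of _ n 2] by (force simp: T_def)
qed

lemma dim_raise_kernel:
  "fun_vs.dim {q \<in> homog n 0. raise q = 0} + card {m \<in> degs S n. weight m = 2} =
   card {m \<in> degs S n. weight m = 0}"
proof -
  have fin: "finite {m \<in> degs S n. weight m = k}" for k using finite_degs[OF finite_S] by simp
  show ?thesis
    using fun_vs_pair.dim_kernel_plus_image[OF linear_raise subspace_supp_in supp_in_basis(1,2)[OF fin], of 0]
    unfolding homog_eq_supp_in[symmetric] raise_surj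
    unfolding homog_eq_supp_in supp_in_basis(3)[OF fin] by simp
qed

text \<open>Both operators kill \<open>q\<close> only if their commutator, the weight, does.\<close>
lemma raise_lower_kernel:
  "{q \<in> supp_in (degs S n). raise q = 0 \<and> lower q = 0} = {q \<in> homog n 0. raise q = 0}"
proof (intro equalityI subsetI)
  fix q assume q: "q \<in> {q \<in> supp_in (degs S n). raise q = 0 \<and> lower q = 0}"
  have "raise 0 = 0" "lower 0 = 0"
    using linear_raise linear_lower by (auto simp: linear_iff_module_hom dest: module_hom.zero)
  then have "of_int (weight m) * q m = 0" if "m \<in> degs S n" for m
    using commutator[OF that, of q] q by simp
  then show "q \<in> {q \<in> homog n 0. raise q = 0}" using q by (auto simp: homog_def supp_in_def)
next
  fix q assume q: "q \<in> {q \<in> homog n 0. raise q = 0}"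
  then show "q \<in> {q \<in> supp_in (degs S n). raise q = 0 \<and> lower q = 0}"
    using lower_eq_0[of q n] by (auto simp: homog_def supp_in_def)
qed

end

section \<open>Polynomials as functions: uniqueness of coefficients and the chain rule\<close>

lemma monomials_independent:
  fixes q :: "('a \<Rightarrow> nat) \<Rightarrow> complex"
  assumes "finite S" "finite M" "\<And>m m'. m \<in> M \<Longrightarrow> m' \<in> M \<Longrightarrow> (\<forall>x\<in>S. m x = m' x) \<Longrightarrow> m = m'"
    and "\<And>c. (\<Sum>m\<in>M. q m * (\<Prod>x\<in>S. c x ^ m x)) = 0" "m0 \<in> M"
  shows "q m0 = 0"
  using assms
\<comment> \<open>For fixed values of the other variables the sum is a polynomial in the new
  variable, so each coefficient vanishes. The exponents in \<open>M' k\<close> share the value at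
  \<open>x\<close>, so they are still separated by their values on the smaller set.\<close>
proof (induction S arbitrary: M)
  case empty
  then have "M = {m0}" by auto
  then show ?case using empty.prems(3) by simp
next
  case (insert x S)
  define k where "k = m0 x"
  define M' where "M' i = {m \<in> M. m x = i}" for i
  define N where "N = Max ((\<lambda>m. m x) ` M)"
  have N: "m x \<le> N" if "m \<in> M" for m using that insert.prems(1) by (simp add: N_def)
  have "(\<Sum>m\<in>M' k. q m * (\<Prod>z\<in>S. c z ^ m z)) = 0" for c
  proof -
    have "(\<Sum>i\<le>N. (\<Sum>m\<in>M' i. q m * (\<Prod>z\<in>S. c z ^ m z)) * y ^ i) = 0" for y
    proof -
      have "(\<Sum>i\<le>N. (\<Sum>m\<in>M' i. q m * (\<Prod>z\<in>S. c z ^ m z)) * y ^ i) =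
          (\<Sum>i\<le>N. \<Sum>m\<in>M' i. q m * (\<Prod>z\<in>S. c z ^ m z) * y ^ m x)"
        by (simp add: sum_distrib_right M'_def)
      also have "\<dots> = (\<Sum>m\<in>M. q m * (\<Prod>z\<in>S. c z ^ m z) * y ^ m x)"
        unfolding M'_def using insert.prems(1) N by (intro sum.group) auto
      also have "\<dots> = (\<Sum>m\<in>M. q m * (\<Prod>z\<in>insert x S. (c(x := y)) z ^ m z))"
      proof (rule sum.cong[OF refl])
        fix m
        have "(\<Prod>z\<in>S. (c(x := y)) z ^ m z) = (\<Prod>z\<in>S. c z ^ m z)"
          using insert.hyps by (intro prod.cong) auto
        then show "q m * (\<Prod>z\<in>S. c z ^ m z) * y ^ m x = q m * (\<Prod>z\<in>insert x S. (c(x := y)) z ^ m z)"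
          using insert.hyps by simp
      qed
      finally show ?thesis using insert.prems(3) by simp
    qed
    then have "\<forall>i\<le>N. (\<Sum>m\<in>M' i. q m * (\<Prod>z\<in>S. c z ^ m z)) = 0"
      using zero_polynom_imp_zero_coeffs[where c = "\<lambda>i. \<Sum>m\<in>M' i. q m * (\<Prod>z\<in>S. c z ^ m z)"] by blast
    then show ?thesis using N insert.prems(4) by (auto simp: k_def)
  qed
  moreover have "m = m'" if "m \<in> M' k" "m' \<in> M' k" "\<forall>x\<in>S. m x = m' x" for m m'
    using that insert.prems(2)[of m m'] by (auto simp: M'_def)
  ultimately show ?case
    using insert.IH[of "M' k"] insert.prems(1,4) by (auto simp: M'_def k_def)
qed

definition poly_ev :: "'a set \<Rightarrow> nat \<Rightarrow> (('a \<Rightarrow> nat) \<Rightarrow> complex) \<Rightarrow> ('a \<Rightarrow> complex) \<Rightarrow> complex" where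
  "poly_ev S n q c = (\<Sum>m\<in>degs S n. q m * (\<Prod>x\<in>S. c x ^ m x))"

text \<open>The partial derivative of \<open>poly_ev\<close> with respect to \<open>c x\<close>;
  where \<open>m x = 0\<close> the truncated exponent is cancelled by the factor
  \<open>of_nat (m x)\<close>.\<close>

definition poly_part :: "'a set \<Rightarrow> nat \<Rightarrow> (('a \<Rightarrow> nat) \<Rightarrow> complex) \<Rightarrow> 'a \<Rightarrow> ('a \<Rightarrow> complex) \<Rightarrow> complex" where
  "poly_part S n q x c =
    (\<Sum>m\<in>degs S n. q m * (of_nat (m x) * c x ^ (m x - 1) * (\<Prod>z\<in>S - {x}. c z ^ m z)))"

lemma poly_ev_eq_0:
  assumes "finite S" "q \<in> supp_in (degs S n)" "\<And>c. poly_ev S n q c = 0"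
  shows "q = 0"
proof -
  have "q m = 0" if "m \<in> degs S n" for m
  proof (rule monomials_independent[OF assms(1) finite_degs[OF assms(1)] _ _ that])
    show "m = m'" if "m \<in> degs S n" "m' \<in> degs S n" "\<forall>x\<in>S. m x = m' x" for m m'
      using that by (auto simp: degs_def fun_eq_iff)
  qed (use assms(3) in \<open>simp add: poly_ev_def\<close>)
  then show ?thesis using assms(2) by (auto simp: supp_in_def fun_eq_iff)
qed

lemma poly_ev_cong: "(\<And>x. x \<in> S \<Longrightarrow> c x = c' x) \<Longrightarrow> poly_ev S n q c = poly_ev S n q c'"
  unfolding poly_ev_def by (auto intro!: sum.cong prod.cong)

lemma poly_ev_mult_var_deriv_var:
  assumes "finite S" "x \<in> S" "y \<in> S" "x \<noteq> y"
  shows "poly_ev S n (mult_var y (deriv_var x q)) c = c y * poly_part S n q x c"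
proof -
  have "of_nat (m x) * q m * (\<Prod>z\<in>S. c z ^ move x y m z) =
      c y * (q m * (of_nat (m x) * c x ^ (m x - 1) * (\<Prod>z\<in>S - {x}. c z ^ m z)))" for m
  proof -
    have *: "(\<Prod>z\<in>S - {x} - {y}. c z ^ move x y m z) = (\<Prod>z\<in>S - {x} - {y}. c z ^ m z)"
      by (intro prod.cong) (auto simp: move_def)
    have "(\<Prod>z\<in>S. c z ^ move x y m z) =
        c x ^ move x y m x * (c y ^ move x y m y * (\<Prod>z\<in>S - {x} - {y}. c z ^ move x y m z))"
      using assms by (simp add: prod.remove[of S x] prod.remove[of "S - {x}" y])
    moreover have "(\<Prod>z\<in>S - {x}. c z ^ m z) = c y ^ m y * (\<Prod>z\<in>S - {x} - {y}. c z ^ m z)"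
      using assms by (simp add: prod.remove[of "S - {x}" y])
    ultimately show ?thesis unfolding * using assms by (simp add: move_def)
  qed
  then show ?thesis
    unfolding poly_ev_def sum_mult_var_deriv_var[OF assms] poly_part_def sum_distrib_left by (rule sum.cong[OF refl])
qed

lemma poly_ev_deriv:
  assumes "finite S" "\<And>x. x \<in> S \<Longrightarrow> ((\<lambda>s. \<gamma> s x) has_field_derivative \<gamma>' x) (at s)"
  shows "((\<lambda>s. poly_ev S n q (\<gamma> s)) has_field_derivative
           (\<Sum>x\<in>S. \<gamma>' x * poly_part S n q x (\<gamma> s))) (at s)"
proof -
  have "((\<lambda>s. \<Prod>x\<in>S. \<gamma> s x ^ m x) has_field_derivative
      (\<Sum>x\<in>S. of_nat (m x) * (\<gamma>' x * \<gamma> s x ^ (m x - Suc 0)) * (\<Prod>z\<in>S - {x}. \<gamma> s z ^ m z))) (at s)" for m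
    by (rule has_field_derivative_prod DERIV_power assms)+
  then have "((\<lambda>s. poly_ev S n q (\<gamma> s)) has_field_derivative
      (\<Sum>m\<in>degs S n. q m * (\<Sum>x\<in>S. of_nat (m x) * (\<gamma>' x * \<gamma> s x ^ (m x - Suc 0)) * (\<Prod>z\<in>S - {x}. \<gamma> s z ^ m z)))) (at s)"
    unfolding poly_ev_def by (intro DERIV_sum DERIV_cmult)
  moreover have "(\<Sum>m\<in>degs S n. q m * (\<Sum>x\<in>S. of_nat (m x) * (\<gamma>' x * \<gamma> s x ^ (m x - Suc 0)) * (\<Prod>z\<in>S - {x}. \<gamma> s z ^ m z))) =
      (\<Sum>x\<in>S. \<gamma>' x * poly_part S n q x (\<gamma> s))"
    unfolding poly_part_def sum_distrib_left by (subst sum.swap) (simp add: mult_ac)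
  ultimately show ?thesis by simp
qed

lemma poly_ev_sum: "poly_ev S n (\<lambda>m. \<Sum>x\<in>I. a x * f x m) c = (\<Sum>x\<in>I. a x * poly_ev S n (f x) c)"
  unfolding poly_ev_def by (simp add: sum_distrib_left sum_distrib_right mult_ac sum.swap[of _ I])

context sl2_module begin

text \<open>The hypotheses say that \<open>\<gamma>\<close> follows at \<open>s\<close> the linear
  vector field whose derivation is \<open>raise\<close>, so the claim is the chain rule.\<close>

lemma poly_ev_raise_deriv:
  assumes "\<And>x. x \<in> J \<Longrightarrow> ((\<lambda>s. \<gamma> s x) has_field_derivative of_real (\<alpha> x) * \<gamma> s (\<sigma> x)) (at s)"
    and "\<And>x. x \<in> S - J \<Longrightarrow> ((\<lambda>s. \<gamma> s x) has_field_derivative 0) (at s)"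
  shows "((\<lambda>s. poly_ev S n q (\<gamma> s)) has_field_derivative poly_ev S n (raise q) (\<gamma> s)) (at s)"
proof -
  have "((\<lambda>s. poly_ev S n q (\<gamma> s)) has_field_derivative
      (\<Sum>x\<in>S. (if x \<in> J then of_real (\<alpha> x) * \<gamma> s (\<sigma> x) else 0) * poly_part S n q x (\<gamma> s))) (at s)"
    by (rule poly_ev_deriv[OF finite_S]) (use assms in auto)
  moreover have "(\<Sum>x\<in>S. (if x \<in> J then of_real (\<alpha> x) * \<gamma> s (\<sigma> x) else 0) * poly_part S n q x (\<gamma> s)) =
      (\<Sum>x\<in>J. of_real (\<alpha> x) * \<gamma> s (\<sigma> x) * poly_part S n q x (\<gamma> s))"
    using J_subset finite_S by (intro sum.mono_neutral_cong_right) auto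
  moreover have "\<dots> = poly_ev S n (raise q) (\<gamma> s)"
    unfolding raise_def[abs_def] poly_ev_sum
  proof (rule sum.cong[OF refl])
    fix x assume x: "x \<in> J"
    show "of_real (\<alpha> x) * \<gamma> s (\<sigma> x) * poly_part S n q x (\<gamma> s) =
        of_real (\<alpha> x) * poly_ev S n (mult_var (\<sigma> x) (deriv_var x q)) (\<gamma> s)"
      using poly_ev_mult_var_deriv_var[OF finite_S _ \<sigma>_in[OF x] \<sigma>_neq[OF x, symmetric], of n q] J_subset x by auto
  qed
  ultimately show ?thesis by simp
qed

lemma poly_ev_lower_deriv:
  assumes "\<And>x. x \<in> J \<Longrightarrow> ((\<lambda>s. \<gamma> s (\<sigma> x)) has_field_derivative of_real (\<beta> x) * \<gamma> s x) (at s)"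
    and "\<And>x. x \<in> S - \<sigma> ` J \<Longrightarrow> ((\<lambda>s. \<gamma> s x) has_field_derivative 0) (at s)"
  shows "((\<lambda>s. poly_ev S n q (\<gamma> s)) has_field_derivative poly_ev S n (lower q) (\<gamma> s)) (at s)"
proof -
  \<comment> \<open>\<open>lower\<close> is indexed by \<open>x\<close>, the chain rule by the
    moving variable \<open>\<sigma> x\<close>; \<open>\<tau>\<close> translates between the
    two.\<close>
  define \<tau> where "\<tau> = the_inv_into J \<sigma>"
  have \<tau>: "\<tau> (\<sigma> x) = x" if "x \<in> J" for x using the_inv_into_f_f[OF \<sigma>_inj that] by (simp add: \<tau>_def)
  define g where "g y = (if y \<in> \<sigma> ` J then of_real (\<beta> (\<tau> y)) * \<gamma> s (\<tau> y) else 0)" for y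
  have "((\<lambda>s. poly_ev S n q (\<gamma> s)) has_field_derivative
      (\<Sum>y\<in>S. g y * poly_part S n q y (\<gamma> s))) (at s)"
    by (rule poly_ev_deriv[OF finite_S]) (use assms \<tau> in \<open>auto simp: g_def\<close>)
  moreover have "(\<Sum>y\<in>S. g y * poly_part S n q y (\<gamma> s)) = (\<Sum>y\<in>\<sigma> ` J. g y * poly_part S n q y (\<gamma> s))"
    using \<sigma>_in finite_S by (intro sum.mono_neutral_cong_right) (auto simp: g_def)
  moreover have "\<dots> = (\<Sum>x\<in>J. of_real (\<beta> x) * \<gamma> s x * poly_part S n q (\<sigma> x) (\<gamma> s))"
    using \<sigma>_inj \<tau> by (simp add: sum.reindex g_def)
  moreover have "\<dots> = poly_ev S n (lower q) (\<gamma> s)"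
    unfolding lower_def[abs_def] poly_ev_sum
  proof (rule sum.cong[OF refl])
    fix x assume x: "x \<in> J"
    show "of_real (\<beta> x) * \<gamma> s x * poly_part S n q (\<sigma> x) (\<gamma> s) =
        of_real (\<beta> x) * poly_ev S n (mult_var x (deriv_var (\<sigma> x) q)) (\<gamma> s)"
      using poly_ev_mult_var_deriv_var[OF finite_S \<sigma>_in[OF x] _ \<sigma>_neq[OF x], of n q] J_subset x by auto
  qed
  ultimately show ?thesis by simp
qed

end

section \<open>Invariants of binary forms\<close>

context sl2_module begin

lemma raise_supp_in:
  assumes "q \<in> supp_in (degs S n)"
  shows "raise q \<in> supp_in (degs S n)"
proof -
  have "raise q m = 0" if "m \<notin> degs S n" for m
    unfolding raise_def
  proof (intro sum.neutral ballI)
    fix x assume x: "x \<in> J"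
    show "of_real (\<alpha> x) * mult_var (\<sigma> x) (deriv_var x q) m = 0"
      using mult_var_deriv_var_support[OF finite_S _ \<sigma>_in[OF x] \<sigma>_neq[OF x, symmetric] _ that] assms J_subset x
      by (auto simp: supp_in_def)
  qed
  then show ?thesis by (auto simp: supp_in_def)
qed

lemma lower_supp_in:
  assumes "q \<in> supp_in (degs S n)"
  shows "lower q \<in> supp_in (degs S n)"
proof -
  have "lower q m = 0" if "m \<notin> degs S n" for m
    unfolding lower_def
  proof (intro sum.neutral ballI)
    fix x assume x: "x \<in> J"
    show "of_real (\<beta> x) * mult_var x (deriv_var (\<sigma> x) q) m = 0"
      using mult_var_deriv_var_support[OF finite_S \<sigma>_in[OF x] _ \<sigma>_neq[OF x] _ that] assms J_subset x
      by (auto simp: supp_in_def)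
  qed
  then show ?thesis by (auto simp: supp_in_def)
qed

end

lemma Theta_Sigma: "Theta r d = Sigma {1..r} (\<lambda>k. {..d k})"
  by (auto simp: Theta_def)

definition steps :: "nat \<Rightarrow> (nat \<Rightarrow> nat) \<Rightarrow> (nat \<times> nat) set" where
  "steps r d = Sigma {1..r} (\<lambda>k. {..<d k})"

text \<open>Summation by parts, resting on i (D - i + 1) - (i + 1) (D - i) = 2 i - D. The boundary
  terms vanish through the factors i at 0 and D - i at D.\<close>

lemma sl2_weight_identity:
  fixes f :: "nat \<Rightarrow> real"
  shows "(\<Sum>i<D. (real i + 1) * (real D - real i) * (f (Suc i) - f i)) =
    (\<Sum>i\<le>D. (2 * real i - real D) * f i)"
proof -
  have "(\<Sum>i<D. (real i + 1) * (real D - real i) * f (Suc i)) = (\<Sum>i\<le>D. real i * (real D - real i + 1) * f i)"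
    unfolding lessThan_Suc_atMost[symmetric] by (subst sum.lessThan_Suc_shift) (simp add: algebra_simps)
  moreover have "(\<Sum>i<D. (real i + 1) * (real D - real i) * f i) = (\<Sum>i\<le>D. (real i + 1) * (real D - real i) * f i)"
    by (simp flip: lessThan_Suc_atMost)
  ultimately have "(\<Sum>i<D. (real i + 1) * (real D - real i) * (f (Suc i) - f i)) =
      (\<Sum>i\<le>D. real i * (real D - real i + 1) * f i - (real i + 1) * (real D - real i) * f i)"
    by (simp add: right_diff_distrib sum_subtractf)
  also have "\<dots> = (\<Sum>i\<le>D. (2 * real i - real D) * f i)"
    by (intro sum.cong refl) (simp add: algebra_simps)
  finally show ?thesis .
qed

lemma binomial_step: "(Suc i) * (n choose Suc i) = (n - i) * (n choose i)"
  by (simp only: binomial_absorption binomial_absorb_comp)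

text \<open>The constants i + 1 and d k - i are the velocities of the coefficients under the two
  shears of the variables. Adjointness then asks for (i + 1) w (i + 1) = (d k - i) w i, which the
  binomial coefficients solve. Cases 7 and 8 are \<open>w_adjoint\<close> and
  \<open>wt_commutator\<close>.\<close>

interpretation forms: sl2_module "Theta r d" "steps r d" "\<lambda>(k, i). (k, Suc i)" "\<lambda>(k, i). real i + 1"
  "\<lambda>(k, i). real (d k) - real i" "\<lambda>(k, i). real (d k choose i)" "wt d"
proof (unfold_locales, goal_cases)
  case (7 x)
  then obtain k i where x: "x = (k, i)" "i < d k" by (auto simp: steps_def)
  have "real ((Suc i) * (d k choose Suc i)) = real ((d k - i) * (d k choose i))"
    by (simp only: binomial_step)
  then show ?case using x by (simp add: algebra_simps of_nat_diff)
next
  case (8 m)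
  have "(\<Sum>x\<in>steps r d. (case x of (k, i) \<Rightarrow> real i + 1) * (case x of (k, i) \<Rightarrow> real (d k) - real i) *
      (real (m (case x of (k, i) \<Rightarrow> (k, Suc i))) - real (m x))) =
      (\<Sum>k=1..r. \<Sum>i<d k. (real i + 1) * (real (d k) - real i) * (real (m (k, Suc i)) - real (m (k, i))))"
    unfolding steps_def by (subst sum.Sigma) (auto intro!: sum.cong)
  also have "\<dots> = (\<Sum>k=1..r. \<Sum>i\<le>d k. (2 * real i - real (d k)) * real (m (k, i)))"
    by (intro sum.cong refl sl2_weight_identity)
  also have "\<dots> = (\<Sum>x\<in>Theta r d. of_int (wt d x) * real (m x))"
    unfolding Theta_Sigma by (subst sum.Sigma) (auto intro!: sum.cong simp: wt_def)
  finally show ?case .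
qed (auto simp: Theta_Sigma steps_def wt_def inj_on_def zero_less_binomial_iff)

lemma exponents_eq: "exponents r d n = degs (Theta r d) n"
  by (simp add: exponents_def degs_def)

lemma finite_Theta: "finite (Theta r d)"
  by (simp add: Theta_Sigma)

text \<open>Coefficients of the forms \<open>f(z\<^sub>1 + s z\<^sub>2, z\<^sub>2)\<close> and \<open>f(z\<^sub>1, z\<^sub>2 + s z\<^sub>1)\<close>.\<close>

definition shear_up :: "(nat \<Rightarrow> nat) \<Rightarrow> (nat \<times> nat \<Rightarrow> complex) \<Rightarrow> complex \<Rightarrow> nat \<times> nat \<Rightarrow> complex" where
  "shear_up d c s = (\<lambda>(k, i). \<Sum>j\<le>d k. of_nat (j choose i) * s ^ (j - i) * c (k, j))"

definition shear_low :: "(nat \<Rightarrow> nat) \<Rightarrow> (nat \<times> nat \<Rightarrow> complex) \<Rightarrow> complex \<Rightarrow> nat \<times> nat \<Rightarrow> complex" where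
  "shear_low d c s = (\<lambda>(k, i). \<Sum>j\<le>i. of_nat ((d k - j) choose (i - j)) * s ^ (i - j) * c (k, j))"

lemma shear_up_0: "x \<in> Theta r d \<Longrightarrow> shear_up d c 0 x = c x"
proof -
  assume "x \<in> Theta r d"
  then obtain k i where x: "x = (k, i)" "i \<le> d k" by (auto simp: Theta_Sigma)
  have "(\<Sum>j\<le>d k. of_nat (j choose i) * 0 ^ (j - i) * c (k, j)) = (\<Sum>j\<le>d k. if j = i then c (k, j) else 0)"
    by (intro sum.cong) (auto simp: power_0_left binomial_eq_0)
  then show ?thesis using x by (simp add: shear_up_def)
qed

lemma shear_low_0: "shear_low d c 0 x = c x"
proof -
  obtain k i where x: "x = (k, i)" by force
  have "(\<Sum>j\<le>i. of_nat ((d k - j) choose (i - j)) * 0 ^ (i - j) * c (k, j)) = (\<Sum>j\<le>i. if j = i then c (k, j) else 0)"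
    by (intro sum.cong) (auto simp: power_0_left)
  then show ?thesis using x by (simp add: shear_low_def)
qed

lemma shear_up_deriv:
  "((\<lambda>s. shear_up d c s (k, i)) has_field_derivative of_real (real i + 1) * shear_up d c s (k, Suc i)) (at s)"
proof -
  have deriv: "((\<lambda>s. shear_up d c s (k, i)) has_field_derivative
      (\<Sum>j\<le>d k. of_nat (j choose i) * (of_nat (j - i) * s ^ (j - i - 1)) * c (k, j))) (at s)"
    unfolding shear_up_def by (auto intro!: derivative_eq_intros sum.cong)
  have eq: "of_nat (j choose i) * (of_nat (j - i) * s ^ (j - i - 1)) * c (k, j) =
      of_real (real i + 1) * (of_nat (j choose Suc i) * s ^ (j - Suc i) * c (k, j))" for j
  proof -
    have "complex_of_nat (Suc i * (j choose Suc i)) = of_nat ((j - i) * (j choose i))"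
      by (simp only: binomial_step)
    then have "of_real (real i + 1) * complex_of_nat (j choose Suc i) = of_nat (j - i) * of_nat (j choose i)"
      unfolding of_nat_mult by (simp add: add.commute)
    then show ?thesis by (simp only: mult.assoc[symmetric]) (simp add: mult_ac)
  qed
  show ?thesis using deriv unfolding eq shear_up_def prod.case sum_distrib_left .
qed

lemma shear_up_deriv_top: "((\<lambda>s. shear_up d c s (k, d k)) has_field_derivative 0) (at s)"
  using shear_up_deriv[of d c k "d k" s] by (simp add: shear_up_def)

lemma shear_low_deriv:
  "((\<lambda>s. shear_low d c s (k, Suc i)) has_field_derivative
     of_real (real (d k) - real i) * shear_low d c s (k, i)) (at s)" if "i < d k"
proof -
  have "((\<lambda>s. shear_low d c s (k, Suc i)) has_field_derivative
      (\<Sum>j\<le>Suc i. of_nat ((d k - j) choose (Suc i - j)) * (of_nat (Suc i - j) * s ^ (Suc i - j - 1)) * c (k, j))) (at s)"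
    unfolding shear_low_def prod.case by (rule DERIV_sum) (auto intro!: derivative_eq_intros)
  also have "(\<Sum>j\<le>Suc i. of_nat ((d k - j) choose (Suc i - j)) * (of_nat (Suc i - j) * s ^ (Suc i - j - 1)) * c (k, j)) =
      (\<Sum>j\<le>i. of_nat ((d k - j) choose (Suc i - j)) * (of_nat (Suc i - j) * s ^ (Suc i - j - 1)) * c (k, j))"
    by simp
  also have "\<dots> = (\<Sum>j\<le>i. of_real (real (d k) - real i) * (of_nat ((d k - j) choose (i - j)) * s ^ (i - j) * c (k, j)))"
  proof (rule sum.cong[OF refl])
    fix j assume "j \<in> {..i}"
    then have j: "Suc i - j = Suc (i - j)" "d k - j - (i - j) = d k - i" by auto
    have "complex_of_nat (Suc (i - j) * ((d k - j) choose Suc (i - j))) = of_nat ((d k - i) * ((d k - j) choose (i - j)))"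
      by (simp only: binomial_step j)
    then have "of_real (real (d k) - real i) * complex_of_nat ((d k - j) choose (i - j)) =
        of_nat (Suc (i - j)) * of_nat ((d k - j) choose Suc (i - j))"
      unfolding of_nat_mult using that by (simp add: of_nat_diff eq_commute)
    then show "of_nat ((d k - j) choose (Suc i - j)) * (of_nat (Suc i - j) * s ^ (Suc i - j - 1)) * c (k, j) =
        of_real (real (d k) - real i) * (of_nat ((d k - j) choose (i - j)) * s ^ (i - j) * c (k, j))"
      unfolding j by (simp only: mult.assoc[symmetric]) (simp add: mult_ac)
  qed
  finally show ?thesis by (simp add: shear_low_def sum_distrib_left)
qed

lemma shear_low_deriv_bottom: "((\<lambda>s. shear_low d c s (k, 0)) has_field_derivative 0) (at s)"
  by (simp add: shear_low_def)

lemma poly_ev_shear_up_deriv: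
  "((\<lambda>s. poly_ev (Theta r d) n q (shear_up d c s)) has_field_derivative
     poly_ev (Theta r d) n (forms.raise r d q) (shear_up d c s)) (at s)"
proof (rule forms.poly_ev_raise_deriv)
  fix x assume "x \<in> Theta r d - steps r d"
  then obtain k where "x = (k, d k)" by (fastforce simp: Theta_Sigma steps_def not_less)
  then show "((\<lambda>s. shear_up d c s x) has_field_derivative 0) (at s)" using shear_up_deriv_top by simp
qed (use shear_up_deriv in \<open>auto simp: steps_def\<close>)

lemma poly_ev_shear_low_deriv:
  "((\<lambda>s. poly_ev (Theta r d) n q (shear_low d c s)) has_field_derivative
     poly_ev (Theta r d) n (forms.lower r d q) (shear_low d c s)) (at s)"
proof (rule forms.poly_ev_lower_deriv)
  fix x assume x: "x \<in> Theta r d - (\<lambda>(k, i). (k, Suc i)) ` steps r d"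
  obtain k i where ki: "x = (k, i)" by force
  have "i = 0"
  proof (rule ccontr)
    assume "i \<noteq> 0"
    then have "x = (\<lambda>(k, i). (k, Suc i)) (k, i - 1)" "(k, i - 1) \<in> steps r d"
      using x ki by (auto simp: Theta_Sigma steps_def)
    then show False using x by blast
  qed
  then show "((\<lambda>s. shear_low d c s x) has_field_derivative 0) (at s)" using shear_low_deriv_bottom ki by simp
qed (use shear_low_deriv in \<open>auto simp: steps_def\<close>)

lemma poly_ev_0: "poly_ev S n 0 c = 0"
  by (simp add: poly_ev_def)

lemma constant_if_deriv_0:
  fixes f :: "complex \<Rightarrow> complex"
  assumes "\<And>x. (f has_field_derivative 0) (at x)"
  shows "f x = f y"
  using has_field_derivative_zero_constant[of UNIV f] assms by auto

text \<open>The derivative at s = 0 evaluates \<open>raise q\<close> at an arbitrary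
  \<open>c\<close>. Conversely, if \<open>raise q = 0\<close> then the derivative vanishes along the
  whole curve, which starts at \<open>c\<close>.\<close>

lemma shear_up_invariant_iff:
  assumes "q \<in> supp_in (degs (Theta r d) n)"
  shows "(\<forall>c s. poly_ev (Theta r d) n q (shear_up d c s) = poly_ev (Theta r d) n q c) \<longleftrightarrow> forms.raise r d q = 0"
proof
  assume inv: "\<forall>c s. poly_ev (Theta r d) n q (shear_up d c s) = poly_ev (Theta r d) n q c"
  have "forms.raise r d q \<in> supp_in (degs (Theta r d) n)"
    by (rule forms.raise_supp_in[OF assms])
  moreover have "poly_ev (Theta r d) n (forms.raise r d q) c = 0" for c
  proof -
    have "((\<lambda>s. poly_ev (Theta r d) n q (shear_up d c s)) has_field_derivative 0) (at 0)"
      using inv by simp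
    then have "poly_ev (Theta r d) n (forms.raise r d q) (shear_up d c 0) = 0"
      using poly_ev_shear_up_deriv DERIV_unique by blast
    then show ?thesis using poly_ev_cong[of "Theta r d" "shear_up d c 0" c] shear_up_0 by metis
  qed
  ultimately show "forms.raise r d q = 0" using poly_ev_eq_0[OF finite_Theta] by blast
next
  assume "forms.raise r d q = 0"
  then have "poly_ev (Theta r d) n q (shear_up d c s) = poly_ev (Theta r d) n q (shear_up d c 0)" for c s
    using poly_ev_shear_up_deriv[of r d n q c]
    by (intro constant_if_deriv_0[of "\<lambda>s. poly_ev (Theta r d) n q (shear_up d c s)"]) (simp add: poly_ev_0)
  then show "\<forall>c s. poly_ev (Theta r d) n q (shear_up d c s) = poly_ev (Theta r d) n q c"
    using poly_ev_cong[of "Theta r d" "shear_up d _ 0"] shear_up_0 by metis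
qed

lemma shear_low_invariant_iff:
  assumes "q \<in> supp_in (degs (Theta r d) n)"
  shows "(\<forall>c s. poly_ev (Theta r d) n q (shear_low d c s) = poly_ev (Theta r d) n q c) \<longleftrightarrow> forms.lower r d q = 0"
proof
  assume inv: "\<forall>c s. poly_ev (Theta r d) n q (shear_low d c s) = poly_ev (Theta r d) n q c"
  have "forms.lower r d q \<in> supp_in (degs (Theta r d) n)"
    by (rule forms.lower_supp_in[OF assms])
  moreover have "poly_ev (Theta r d) n (forms.lower r d q) c = 0" for c
  proof -
    have "((\<lambda>s. poly_ev (Theta r d) n q (shear_low d c s)) has_field_derivative 0) (at 0)"
      using inv by simp
    then have "poly_ev (Theta r d) n (forms.lower r d q) (shear_low d c 0) = 0"
      using poly_ev_shear_low_deriv DERIV_unique by blast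
    moreover have "shear_low d c 0 = c" by (rule ext) (rule shear_low_0)
    ultimately show ?thesis by simp
  qed
  ultimately show "forms.lower r d q = 0" using poly_ev_eq_0[OF finite_Theta] by blast
next
  assume "forms.lower r d q = 0"
  then have "poly_ev (Theta r d) n q (shear_low d c s) = poly_ev (Theta r d) n q (shear_low d c 0)" for c s
    using poly_ev_shear_low_deriv[of r d n q c]
    by (intro constant_if_deriv_0[of "\<lambda>s. poly_ev (Theta r d) n q (shear_low d c s)"]) (simp add: poly_ev_0)
  then show "\<forall>c s. poly_ev (Theta r d) n q (shear_low d c s) = poly_ev (Theta r d) n q c"
    using shear_low_0[of d] by (metis ext)
qed

section \<open>Generation of SL2 by shears, and their action on forms\<close>

definition umat :: "complex \<Rightarrow> complex^2^2" where "umat s = vector [vector [1, s], vector [0, 1]]"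
definition lmat :: "complex \<Rightarrow> complex^2^2" where "lmat s = vector [vector [1, 0], vector [s, 1]]"

lemma umat_mv: "(umat s *v z) $ 1 = z $ 1 + s * z $ 2" "(umat s *v z) $ 2 = z $ 2"
  by (simp_all add: umat_def matrix_vector_mult_def sum_2)

lemma lmat_mv: "(lmat s *v z) $ 1 = z $ 1" "(lmat s *v z) $ 2 = z $ 2 + s * z $ 1"
  by (simp_all add: lmat_def matrix_vector_mult_def sum_2)

lemma umat_SL2: "umat s \<in> SL2" and lmat_SL2: "lmat s \<in> SL2"
  by (simp_all add: SL2_def umat_def lmat_def det_2)

lemma mat2_eqI:
  fixes A B :: "complex^2^2"
  assumes "A $ 1 $ 1 = B $ 1 $ 1" "A $ 1 $ 2 = B $ 1 $ 2" "A $ 2 $ 1 = B $ 2 $ 1" "A $ 2 $ 2 = B $ 2 $ 2"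
  shows "A = B"
  using assms by (simp add: vec_eq_iff forall_2)

lemma mat2_mult: "(A ** B) $ i $ j = A $ i $ 1 * B $ 1 $ j + A $ i $ 2 * B $ 2 $ (j::2)"
  for A B :: "complex^2^2"
  by (simp add: matrix_matrix_mult_def sum_2)

text \<open>A matrix with lower left entry c \<noteq> 0 is an upper, a lower and an upper shear, the
  middle one having parameter c. If that entry is 0, the upper left entry is not, and multiplication
  by \<open>lmat 1\<close> makes the first case applicable.\<close>

lemma SL2_generated:
  assumes Q: "\<And>A B. Q A \<Longrightarrow> Q B \<Longrightarrow> Q (A ** B)" "\<And>s. Q (umat s)" "\<And>s. Q (lmat s)" and g: "g \<in> SL2"
  shows "Q g"
proof -
  have *: "Q h" if h: "h \<in> SL2" "h $ 2 $ 1 \<noteq> 0" for h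
  proof -
    define c where "c = h $ 2 $ 1"
    have det: "h $ 1 $ 1 * h $ 2 $ 2 - h $ 1 $ 2 * c = 1" and "c \<noteq> 0"
      using h by (auto simp: SL2_def det_2 c_def)
    then have "h $ 1 $ 2 = (h $ 1 $ 1 * h $ 2 $ 2 - 1) / c" by (simp add: field_simps)
    then have "h = (umat ((h $ 1 $ 1 - 1) / c) ** lmat c) ** umat ((h $ 2 $ 2 - 1) / c)"
      using \<open>c \<noteq> 0\<close> by (intro mat2_eqI) (simp_all add: mat2_mult umat_def lmat_def c_def[symmetric] field_simps,
          metis distrib_left mult.right_neutral)
    then show ?thesis using Q by metis
  qed
  show ?thesis
  proof (cases "g $ 2 $ 1 = 0")
    case True
    then have "g $ 1 $ 1 \<noteq> 0" using g by (auto simp: SL2_def det_2)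
    then have "(lmat 1 ** g) $ 2 $ 1 \<noteq> 0" using True by (simp add: mat2_mult lmat_def)
    moreover have "lmat 1 ** g \<in> SL2" using lmat_SL2[of 1] g by (simp add: SL2_def det_mul)
    ultimately have "Q (lmat (-1) ** (lmat 1 ** g))" using * Q by metis
    moreover have "lmat (-1) ** (lmat 1 ** g) = g"
      by (intro mat2_eqI) (simp_all add: mat2_mult lmat_def)
    ultimately show ?thesis by simp
  qed (use * g in blast)
qed

lemma matrix_inv_SL2:
  assumes "g \<in> SL2"
  shows "matrix_inv g \<in> SL2" "matrix_inv (matrix_inv g) = g"
proof -
  have inv: "invertible g" using assms by (simp add: SL2_def invertible_det_nz)
  have matrix_inv: "matrix_inv A ** A = mat 1" "A ** matrix_inv A = mat 1" if "invertible A" for A :: "complex^2^2"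
    using someI_ex[OF that[unfolded invertible_def]] by (simp_all add: matrix_inv_def)
  note eq = matrix_inv[OF inv]
  have "det (matrix_inv g) * det g = 1" using eq by (metis det_I det_mul)
  then show "matrix_inv g \<in> SL2" using assms by (simp add: SL2_def)
  have "invertible (matrix_inv g)" using eq by (auto simp: invertible_def)
  then show "matrix_inv (matrix_inv g) = g"
    using matrix_inv[of "matrix_inv g"] eq by (metis matrix_mul_assoc matrix_mul_lid matrix_mul_rid)
qed

lemma binary_form_shear_up:
  "binary_form (d k) (\<lambda>i. shear_up d c s (k, i)) z = binary_form (d k) (\<lambda>i. c (k, i)) (umat s *v z)"
proof -
  have "binary_form (d k) (\<lambda>i. c (k, i)) (umat s *v z) =
      (\<Sum>j\<le>d k. \<Sum>i\<le>j. of_nat (j choose i) * s ^ (j - i) * c (k, j) * z $ 1 ^ i * z $ 2 ^ (d k - i))"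
    unfolding binary_form_def umat_mv
  proof (rule sum.cong[OF refl])
    fix j assume "j \<in> {..d k}"
    then have "z $ 2 ^ (j - i) * z $ 2 ^ (d k - j) = z $ 2 ^ (d k - i)" if "i \<le> j" for i
      using that by (simp flip: power_add)
    then show "c (k, j) * (z $ 1 + s * z $ 2) ^ j * z $ 2 ^ (d k - j) =
        (\<Sum>i\<le>j. of_nat (j choose i) * s ^ (j - i) * c (k, j) * z $ 1 ^ i * z $ 2 ^ (d k - i))"
      by (auto simp: binomial_ring sum_distrib_left sum_distrib_right power_mult_distrib mult_ac intro!: sum.cong)
  qed
  also have "\<dots> = (\<Sum>j\<le>d k. \<Sum>i\<le>d k. of_nat (j choose i) * s ^ (j - i) * c (k, j) * z $ 1 ^ i * z $ 2 ^ (d k - i))"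
    by (intro sum.cong refl sum.mono_neutral_left) (auto simp: binomial_eq_0)
  also have "\<dots> = binary_form (d k) (\<lambda>i. shear_up d c s (k, i)) z"
    unfolding binary_form_def shear_up_def by (subst sum.swap) (simp add: sum_distrib_right)
  finally show ?thesis by simp
qed

lemma binary_form_shear_low:
  "binary_form (d k) (\<lambda>i. shear_low d c s (k, i)) z = binary_form (d k) (\<lambda>i. c (k, i)) (lmat s *v z)"
proof -
  let ?D = "d k"
  let ?t = "\<lambda>j i. of_nat ((?D - j) choose (i - j)) * s ^ (i - j) * c (k, j) * z $ 1 ^ i * z $ 2 ^ (?D - i)"
  have "binary_form ?D (\<lambda>i. c (k, i)) (lmat s *v z) = (\<Sum>j\<le>?D. \<Sum>i\<in>{j..?D}. ?t j i)"
    unfolding binary_form_def lmat_mv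
  proof (rule sum.cong[OF refl])
    fix j assume j: "j \<in> {..?D}"
    have "c (k, j) * z $ 1 ^ j * (z $ 2 + s * z $ 1) ^ (?D - j) =
        (\<Sum>l\<le>?D - j. of_nat ((?D - j) choose l) * s ^ l * c (k, j) * (z $ 1 ^ j * z $ 1 ^ l) * z $ 2 ^ (?D - j - l))"
      unfolding add.commute[of "z $ 2"]
      by (simp add: binomial_ring sum_distrib_left power_mult_distrib mult_ac)
    also have "\<dots> = (\<Sum>i\<in>{j..?D}. ?t j i)"
      using j by (intro sum.reindex_bij_witness[of _ "\<lambda>i. i - j" "\<lambda>l. l + j"])
        (auto simp: power_add mult_ac add.commute[of j])
    finally show "c (k, j) * z $ 1 ^ j * (z $ 2 + s * z $ 1) ^ (?D - j) = (\<Sum>i\<in>{j..?D}. ?t j i)" .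
  qed
  also have "\<dots> = (\<Sum>i\<le>?D. \<Sum>j\<le>i. ?t j i)"
    unfolding sum.Sigma[OF finite_atMost ballI[OF finite_atLeastAtMost]] sum.Sigma[OF finite_atMost ballI[OF finite_atMost]]
    by (intro sum.reindex_bij_witness[of _ prod.swap prod.swap]) auto
  also have "\<dots> = binary_form ?D (\<lambda>i. shear_low d c s (k, i)) z"
    unfolding binary_form_def shear_low_def by (simp add: sum_distrib_right)
  finally show ?thesis by simp
qed

lemma rep_vec_shear_up: "rep_vec r d (shear_up d c s) = (\<lambda>k z. rep_vec r d c k (umat s *v z))"
  using binary_form_shear_up by (auto simp: rep_vec_def fun_eq_iff)

lemma rep_vec_shear_low: "rep_vec r d (shear_low d c s) = (\<lambda>k z. rep_vec r d c k (lmat s *v z))"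
  using binary_form_shear_low by (auto simp: rep_vec_def fun_eq_iff)

lemma rep_vec_inj:
  assumes "rep_vec r d c = rep_vec r d c'" "x \<in> Theta r d"
  shows "c x = c' x"
proof -
  obtain k i where x: "x = (k, i)" "1 \<le> k" "k \<le> r" "i \<le> d k" using assms(2) by (auto simp: Theta_def)
  have "(\<Sum>j\<le>d k. c (k, j) * y ^ j) = (\<Sum>j\<le>d k. c' (k, j) * y ^ j)" for y
    using fun_cong[OF fun_cong[OF assms(1), of k], of "vector [y, 1]"] x by (simp add: rep_vec_def binary_form_def)
  then have "(\<Sum>j\<le>d k. (c (k, j) - c' (k, j)) * y ^ j) = 0" for y
    by (simp add: left_diff_distrib sum_subtractf)
  then have "c (k, i) - c' (k, i) = 0"
    using zero_polynom_imp_zero_coeffs[of "\<lambda>j. c (k, j) - c' (k, j)" "d k" i] x(4) by simp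
  then show ?thesis using x by simp
qed

text \<open>The coefficients of \<open>F\<close> are unique on \<open>Theta\<close> and arbitrary
  elsewhere, hence the choice; \<open>poly_ev\<close> reads them on \<open>Theta\<close>
  alone.\<close>

definition poly_fun ::
    "nat \<Rightarrow> (nat \<Rightarrow> nat) \<Rightarrow> nat \<Rightarrow> ((nat \<times> nat \<Rightarrow> nat) \<Rightarrow> complex) \<Rightarrow> (nat \<Rightarrow> complex^2 \<Rightarrow> complex) \<Rightarrow> complex" where
  "poly_fun r d n q F =
    (if F \<in> rep_space r d then poly_ev (Theta r d) n q (SOME c. rep_vec r d c = F) else 0)"

lemma poly_fun_rep_vec: "poly_fun r d n q (rep_vec r d c) = poly_ev (Theta r d) n q c"
proof -
  have "rep_vec r d (SOME c'. rep_vec r d c' = rep_vec r d c) = rep_vec r d c" by (rule someI[of _ c]) simp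
  then have "poly_ev (Theta r d) n q (SOME c'. rep_vec r d c' = rep_vec r d c) = poly_ev (Theta r d) n q c"
    using rep_vec_inj by (intro poly_ev_cong) blast
  then show ?thesis by (simp add: poly_fun_def rep_space_def)
qed

lemma poly_fun_eqI:
  assumes "\<And>F. F \<notin> rep_space r d \<Longrightarrow> p F = 0" "\<And>c. p (rep_vec r d c) = poly_ev (Theta r d) n q c"
  shows "p = poly_fun r d n q"
proof
  fix F show "p F = poly_fun r d n q F"
    using assms by (cases "F \<in> rep_space r d") (auto simp: rep_space_def poly_fun_rep_vec, auto simp: poly_fun_def rep_space_def)
qed

lemma linear_poly_fun:
  "Vector_Spaces.linear (\<lambda>(c::complex) p F. c * p F) (\<lambda>(c::complex) p F. c * p F) (poly_fun r d n)"
  by (rule linear_funI)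
    (auto simp: poly_fun_def poly_ev_def fun_eq_iff distrib_right sum.distrib sum_distrib_left mult.assoc)

lemma hom_poly_funs_eq: "hom_poly_funs r d n = poly_fun r d n ` supp_in (degs (Theta r d) n)"
proof (intro equalityI subsetI)
  fix p assume "p \<in> hom_poly_funs r d n"
  then obtain q where p: "\<And>F. F \<notin> rep_space r d \<Longrightarrow> p F = 0"
    "\<And>c. p (rep_vec r d c) = (\<Sum>m\<in>exponents r d n. q m * (\<Prod>x\<in>Theta r d. c x ^ m x))"
    by (auto simp: hom_poly_funs_def)
  define q' where "q' m = (if m \<in> degs (Theta r d) n then q m else 0)" for m
  have "p = poly_fun r d n q'"
    by (rule poly_fun_eqI) (auto simp: p poly_ev_def exponents_eq q'_def)
  moreover have "q' \<in> supp_in (degs (Theta r d) n)" by (auto simp: q'_def supp_in_def)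
  ultimately show "p \<in> poly_fun r d n ` supp_in (degs (Theta r d) n)" by blast
next
  fix p assume "p \<in> poly_fun r d n ` supp_in (degs (Theta r d) n)"
  then obtain q where p: "p = poly_fun r d n q" by blast
  have "\<forall>c. p (rep_vec r d c) = (\<Sum>m\<in>exponents r d n. q m * (\<Prod>x\<in>Theta r d. c x ^ m x))"
    by (simp add: p poly_fun_rep_vec poly_ev_def exponents_eq)
  then show "p \<in> hom_poly_funs r d n" unfolding hom_poly_funs_def by (auto simp: p poly_fun_def)
qed

lemma poly_fun_invariant_iff:
  assumes q: "q \<in> supp_in (degs (Theta r d) n)"
  shows "(\<forall>g\<in>SL2. \<forall>F\<in>rep_space r d. poly_fun r d n q (sl2_act g F) = poly_fun r d n q F) \<longleftrightarrow>
    forms.raise r d q = 0 \<and> forms.lower r d q = 0"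
proof
  assume inv: "\<forall>g\<in>SL2. \<forall>F\<in>rep_space r d. poly_fun r d n q (sl2_act g F) = poly_fun r d n q F"
  have inv': "poly_fun r d n q (\<lambda>k z. F k (h *v z)) = poly_fun r d n q F" if "h \<in> SL2" "F \<in> rep_space r d" for h F
    using inv[rule_format, of "matrix_inv h" F] matrix_inv_SL2[of h] that by (simp add: sl2_act_def)
  have "poly_ev (Theta r d) n q (shear_up d c s) = poly_ev (Theta r d) n q c" for c s
    using inv'[OF umat_SL2, of "rep_vec r d c" s] by (simp add: rep_space_def poly_fun_rep_vec flip: rep_vec_shear_up)
  moreover have "poly_ev (Theta r d) n q (shear_low d c s) = poly_ev (Theta r d) n q c" for c s
    using inv'[OF lmat_SL2, of "rep_vec r d c" s] by (simp add: rep_space_def poly_fun_rep_vec flip: rep_vec_shear_low)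
  ultimately show "forms.raise r d q = 0 \<and> forms.lower r d q = 0"
    using shear_up_invariant_iff[OF q] shear_low_invariant_iff[OF q] by blast
next
  assume "forms.raise r d q = 0 \<and> forms.lower r d q = 0"
  then have up: "\<And>c s. poly_ev (Theta r d) n q (shear_up d c s) = poly_ev (Theta r d) n q c"
    and low: "\<And>c s. poly_ev (Theta r d) n q (shear_low d c s) = poly_ev (Theta r d) n q c"
    using shear_up_invariant_iff[OF q] shear_low_invariant_iff[OF q] by blast+
  \<comment> \<open>Membership in the space is part of \<open>Q\<close> so that it composes:
    \<open>Q B\<close> gets applied to the family obtained by substituting \<open>A\<close>.\<close>
  define Q where "Q h \<longleftrightarrow> (\<forall>F\<in>rep_space r d. (\<lambda>k z. F k (h *v z)) \<in> rep_space r d \<and>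
    poly_fun r d n q (\<lambda>k z. F k (h *v z)) = poly_fun r d n q F)" for h
  have "Q h" if "h \<in> SL2" for h
  proof (rule SL2_generated[OF _ _ _ that])
    fix A B assume AB: "Q A" "Q B"
    show "Q (A ** B)" unfolding Q_def
    proof
      fix F assume F: "F \<in> rep_space r d"
      define G where "G = (\<lambda>k z. F k (A *v z))"
      have "G \<in> rep_space r d" "poly_fun r d n q G = poly_fun r d n q F" using AB(1) F by (auto simp: Q_def G_def)
      moreover have "(\<lambda>k z. F k ((A ** B) *v z)) = (\<lambda>k z. G k (B *v z))"
        by (simp add: G_def matrix_vector_mul_assoc)
      ultimately show "(\<lambda>k z. F k ((A ** B) *v z)) \<in> rep_space r d \<and>
          poly_fun r d n q (\<lambda>k z. F k ((A ** B) *v z)) = poly_fun r d n q F"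
        using AB(2) by (simp add: Q_def)
    qed
  qed (auto simp: Q_def rep_space_def poly_fun_rep_vec up low simp flip: rep_vec_shear_up rep_vec_shear_low)
  then show "\<forall>g\<in>SL2. \<forall>F\<in>rep_space r d. poly_fun r d n q (sl2_act g F) = poly_fun r d n q F"
    using matrix_inv_SL2(1) unfolding Q_def sl2_act_def by blast
qed

lemma poly_fun_eq_0:
  assumes "q \<in> supp_in (degs (Theta r d) n)" "poly_fun r d n q = 0"
  shows "q = 0"
proof (rule poly_ev_eq_0[OF finite_Theta assms(1)])
  fix c show "poly_ev (Theta r d) n q c = 0"
    using poly_fun_rep_vec[of r d n q c] assms(2) by simp
qed

theorem hilbert_function_eq:
  "hilbert_function r d n + card {m \<in> degs (Theta r d) n. forms.weight r d m = 2} =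
   card {m \<in> degs (Theta r d) n. forms.weight r d m = 0}"
proof -
  define K where "K = {q \<in> forms.homog r d n 0. forms.raise r d q = 0}"
  have K: "K = {q \<in> supp_in (degs (Theta r d) n). forms.raise r d q = 0 \<and> forms.lower r d q = 0}"
    unfolding K_def by (rule forms.raise_lower_kernel[symmetric])
  have "invariant_polys r d n = poly_fun r d n ` K"
    unfolding invariant_polys_def hom_poly_funs_eq K using poly_fun_invariant_iff[of _ r d n] by blast
  moreover have "fun_vs.dim K = fun_vs.dim (poly_fun r d n ` K)"
  proof -
    have sub: "fun_vs.subspace K"
    proof -
      have "K = supp_in {m \<in> degs (Theta r d) n. forms.weight r d m = 0} \<inter> {q. forms.raise r d q = 0}"
        by (auto simp: K_def forms.homog_eq_supp_in)
      then show ?thesis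
        using fun_vs.subspace_inter[OF subspace_supp_in
            module_hom.subspace_kernel[OF forms.linear_raise[unfolded linear_iff_module_hom]]] by simp
    qed
    have fin: "finite (degs (Theta r d) n)" by (simp add: finite_degs finite_Theta)
    have "K \<subseteq> supp_in (degs (Theta r d) n)" unfolding K by blast
    then have "K \<subseteq> fun_vs.span ((\<lambda>x y. if y = x then 1 else 0) ` degs (Theta r d) n)"
      using supp_in_basis(1)[OF fin] by blast
    note * = fun_vs_pair.dim_kernel_plus_image[OF linear_poly_fun sub this supp_in_basis(2)[OF fin], of r d n]
    have "{x \<in> K. poly_fun r d n x = 0} = {0}"
      using poly_fun_eq_0 fun_vs.subspace_0[OF sub] module_hom.zero[OF linear_poly_fun[unfolded linear_iff_module_hom]]
      by (auto simp: K)
    moreover have "fun_vs.dim {0 :: (nat \<times> nat \<Rightarrow> nat) \<Rightarrow> complex} = 0"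
      by (rule fun_vs.dim_unique[of "{}"]) (auto simp: fun_vs.independent_empty)
    ultimately show ?thesis using * by simp
  qed
  ultimately show ?thesis
    using forms.dim_raise_kernel[of r d n] unfolding hilbert_function_def K_def by simp
qed

section \<open>The Molien-Weyl integral\<close>

text \<open>With all coefficients 1, \<open>poly_ev\<close> is the complete homogeneous symmetric
  polynomial. Sorting its monomials by the power of \<open>y x\<close> gives a Cauchy
  product.\<close>

lemma poly_ev_insert:
  assumes "finite S" "x \<notin> S"
  shows "poly_ev (insert x S) n (\<lambda>_. 1) y = (\<Sum>i\<le>n. y x ^ i * poly_ev S (n - i) (\<lambda>_. 1) y)"
proof -
  have sum_upd: "(\<Sum>z\<in>S. (m(x := i)) z) = (\<Sum>z\<in>S. m z)" for m :: "'a \<Rightarrow> nat" and i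
    using assms by (intro sum.cong) auto
  have prod_upd: "(\<Prod>z\<in>S. y z ^ (m(x := i)) z) = (\<Prod>z\<in>S. y z ^ m z)" for m :: "'a \<Rightarrow> nat" and i
    using assms by (intro prod.cong) auto
  have "(\<Sum>i\<le>n. y x ^ i * poly_ev S (n - i) (\<lambda>_. 1) y) =
      (\<Sum>(i, m)\<in>Sigma {..n} (\<lambda>i. degs S (n - i)). y x ^ i * (\<Prod>z\<in>S. y z ^ m z))"
    unfolding poly_ev_def sum_distrib_left using assms by (subst sum.Sigma) (auto simp: finite_degs)
  also have "\<dots> = (\<Sum>m\<in>degs (insert x S) n. \<Prod>z\<in>insert x S. y z ^ m z)"
    by (rule sum.reindex_bij_witness[of _ "\<lambda>m. (m x, m(x := 0))" "\<lambda>(i, m). m(x := i)"])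
      (use assms in \<open>auto simp: degs_def fun_eq_iff sum_upd[unfolded fun_upd_def] prod_upd[unfolded fun_upd_def] fun_upd_def\<close>)
  finally show ?thesis by (simp add: poly_ev_def)
qed

text \<open>Each variable contributes one geometric series. Absolute convergence is carried through
  the induction because the Cauchy product needs it.\<close>

lemma poly_ev_sums:
  fixes y :: "'a \<Rightarrow> complex"
  assumes "finite S" "\<And>x. x \<in> S \<Longrightarrow> norm (y x) < 1"
  shows "summable (\<lambda>n. norm (poly_ev S n (\<lambda>_. 1) y)) \<and>
    (\<lambda>n. poly_ev S n (\<lambda>_. 1) y) sums (\<Prod>x\<in>S. 1 / (1 - y x))"
  using assms
proof (induction S)
  case empty
  have "degs ({} :: 'a set) n = (if n = 0 then {\<lambda>_. 0} else {})" for n :: nat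
    by (auto simp: degs_def)
  then have eq: "poly_ev {} n (\<lambda>_. 1) y = (if n = 0 then 1 else 0)" for n by (simp add: poly_ev_def)
  show ?case unfolding eq using sums_single[of 0 "\<lambda>_. 1::complex"] summable_single[of 0 "\<lambda>_. 1::real"]
    by (auto simp: if_distrib cong: if_cong)
next
  case (insert x S)
  define h where "h n = poly_ev S n (\<lambda>_. 1) y" for n
  have S: "summable (\<lambda>n. norm (h n))" "h sums (\<Prod>x\<in>S. 1 / (1 - y x))"
    using insert unfolding h_def by auto
  have g: "summable (\<lambda>n. norm (y x ^ n))" "(\<lambda>n. y x ^ n) sums (1 / (1 - y x))"
    using insert.prems by (auto simp: norm_power geometric_sums intro!: summable_geometric)
  have rec: "poly_ev (insert x S) n (\<lambda>_. 1) y = (\<Sum>i\<le>n. y x ^ i * h (n - i))" for n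
    using poly_ev_insert insert.hyps by (simp add: h_def)
  have "summable (\<lambda>n. norm (\<Sum>i\<le>n. y x ^ i * h (n - i)))"
  proof (rule summable_comparison_test'[OF summable_Cauchy_product])
    show "summable (\<lambda>n. norm (norm (y x ^ n)))" "summable (\<lambda>n. norm (norm (h n)))" using S g by auto
    show "norm (norm (\<Sum>i\<le>n. y x ^ i * h (n - i))) \<le> (\<Sum>i\<le>n. norm (y x ^ i) * norm (h (n - i)))" for n
      by (simp add: norm_mult[symmetric] sum_norm_le)
  qed
  moreover have "(\<lambda>n. \<Sum>i\<le>n. y x ^ i * h (n - i)) sums (1 / (1 - y x) * (\<Prod>x\<in>S. 1 / (1 - y x)))"
    using Cauchy_product_sums[OF g(1) S(1)] g(2) S(2) by (simp add: sums_iff)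
  ultimately show ?case unfolding rec using insert.hyps by simp
qed

lemma poly_ev_scale: "poly_ev S n (\<lambda>_. 1) (\<lambda>x. t * y x) = t ^ n * poly_ev S n (\<lambda>_. 1) y"
  unfolding poly_ev_def by (auto simp: degs_def power_mult_distrib prod.distrib sum_distrib_left power_sum intro!: sum.cong)

lemma poly_ev_ones: "poly_ev S n (\<lambda>_. 1) (\<lambda>_. 1) = of_nat (card (degs S n))"
  by (simp add: poly_ev_def)

lemma contour_integral_powi_unit_circle:
  "((\<lambda>z. z powi k) has_contour_integral (if k = -1 then 2 * pi * \<i> else 0)) (circlepath 0 1)"
proof (cases "k = -1")
  case True
  have "((\<lambda>z. 1 / (z - 0)) has_contour_integral (2 * pi * \<i> * 1)) (circlepath 0 1)"
    using Cauchy_integral_circlepath_simple[of "\<lambda>_. 1" 0 1 0] by simp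
  then show ?thesis using True by (simp add: power_int_minus field_simps)
next
  case False
  have "((\<lambda>z. z powi (k + 1) / of_int (k + 1)) has_field_derivative z powi k) (at z within - {0})"
    if "z \<in> - {0}" for z :: complex
  proof -
    have "((\<lambda>z. z powi (k + 1)) has_field_derivative of_int (k + 1) * z powi (k + 1 - 1) * 1) (at z within - {0})"
      using that by (intro DERIV_power_int) auto
    from DERIV_cdivide[OF this, of "of_int (k + 1)"] show ?thesis using False
      by (simp del: of_int_add) 
  qed
  then have "((\<lambda>z. z powi k) has_contour_integral 0) (circlepath 0 1)"
    by (rule Cauchy_theorem_primitive) auto
  then show ?thesis using False by simp
qed

definition weyl_integrand :: "nat \<Rightarrow> (nat \<Rightarrow> nat) \<Rightarrow> complex \<Rightarrow> complex \<Rightarrow> complex" where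
  "weyl_integrand r d t z = (1 - z\<^sup>2) / (z * (\<Prod>x\<in>Theta r d. 1 - t * z powi (- wt d x)))"

lemma powi_weight:
  fixes z :: complex
  assumes "z \<noteq> 0"
  shows "(\<Prod>x\<in>Theta r d. (z powi (- wt d x)) ^ m x) = z powi (- forms.weight r d m)"
proof -
  have *: "(\<Prod>x\<in>A. z powi (f x)) = z powi (\<Sum>x\<in>A. f x)" if "finite A" for A and f :: "nat \<times> nat \<Rightarrow> int"
    using that by induction (use assms in \<open>auto simp: power_int_add\<close>)
  show ?thesis
    by (simp add: power_int_mult[symmetric] *[OF finite_Theta] forms.weight_def sum_negf flip: power_int_of_nat)
qed

text \<open>
  The contour integral extracts the constant coefficient, that is, the number of monomials of
  weight 0 minus the number of those of weight 2.
\<close>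

lemma hilbert_series_contour_integral:
  assumes "norm t < 1"
  shows "(\<lambda>n. of_nat (hilbert_function r d n) * t ^ n) sums
    (contour_integral (circlepath 0 1) (weyl_integrand r d t) / (2 * pi * \<i>))"
proof -
  define D where "D n = degs (Theta r d) n" for n
  have finD: "finite (D n)" for n by (simp add: D_def finite_degs finite_Theta)
  define w where "w = forms.weight r d"
  define f where "f n z = t ^ n * (\<Sum>m\<in>D n. z powi (- 1 - w m) - z powi (1 - w m))" for n z
  define M where "M n = 2 * (norm t ^ n * real (card (D n)))" for n
  have f_eq: "f n z = (1 - z\<^sup>2) / z * poly_ev (Theta r d) n (\<lambda>_. 1) (\<lambda>x. t * z powi (- wt d x))" if "z \<noteq> 0" for n z
  proof -
    have "z powi (- 1 - w m) - z powi (1 - w m) = (1 - z\<^sup>2) / z * z powi (- w m)" for m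
    proof -
      have "z powi (- 1 - w m) = z powi (-1) * z powi (- w m)" "z powi (1 - w m) = z * z powi (- w m)"
        using that power_int_add[of z "-1" "- w m"] power_int_add[of z 1 "- w m"] by simp_all
      then show ?thesis using that by (simp add: power_int_minus field_simps power2_eq_square)
    qed
    then show ?thesis
      unfolding poly_ev_scale f_def poly_ev_def powi_weight[OF that] D_def w_def
      by (simp add: sum_distrib_left mult_ac)
  qed
  have bound: "norm (f n z) \<le> M n" if "z \<in> sphere 0 1" for n z
  proof -
    have "norm (z powi (- 1 - w m) - z powi (1 - w m)) \<le> 2" for m
      using norm_triangle_ineq4[of "z powi (- 1 - w m)" "z powi (1 - w m)"] that by (simp add: norm_power_int)
    then have "norm (\<Sum>m\<in>D n. z powi (- 1 - w m) - z powi (1 - w m)) \<le> real (card (D n)) * 2"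
      by (intro sum_norm_bound) auto
    then have "norm t ^ n * norm (\<Sum>m\<in>D n. z powi (- 1 - w m) - z powi (1 - w m)) \<le> norm t ^ n * (real (card (D n)) * 2)"
      by (intro mult_left_mono) auto
    then show ?thesis by (simp add: f_def M_def norm_mult norm_power mult_ac)
  qed
  \<comment> \<open>With every variable equal to \<open>t\<close> the n-th term is
    \<open>t ^ n\<close> times the number of monomials, which is half of the majorant
    \<open>M n\<close> up to the norm.\<close>
  have "summable (\<lambda>n. norm (poly_ev (Theta r d) n (\<lambda>_. 1) (\<lambda>x. t * 1)))"
    using poly_ev_sums[OF finite_Theta, of r d "\<lambda>_. t"] assms by simp
  then have "summable M"
    unfolding poly_ev_scale poly_ev_ones M_def D_def by (intro summable_mult) (simp add: norm_mult norm_power)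
  then have "uniform_limit (sphere 0 1) (\<lambda>n z. \<Sum>i<n. f i z) (\<lambda>z. suminf (\<lambda>i. f i z)) sequentially"
    using bound by (intro Weierstrass_m_test)
  moreover have "suminf (\<lambda>i. f i z) = weyl_integrand r d t z" if "z \<in> sphere 0 1" for z
  proof -
    have "z \<noteq> 0" using that by auto
    have "norm (t * z powi (- wt d x)) < 1" for x using that assms by (simp add: norm_mult norm_power_int)
    then have "(\<lambda>n. poly_ev (Theta r d) n (\<lambda>_. 1) (\<lambda>x. t * z powi (- wt d x))) sums (\<Prod>x\<in>Theta r d. 1 / (1 - t * z powi (- wt d x)))"
      using poly_ev_sums[OF finite_Theta, of r d "\<lambda>x. t * z powi (- wt d x)"] by blast
    from sums_mult[OF this, of "(1 - z\<^sup>2) / z"] show ?thesis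
      unfolding f_eq[OF \<open>z \<noteq> 0\<close>] weyl_integrand_def by (simp add: sums_iff prod_dividef)
  qed
  ultimately have ul: "uniform_limit (sphere 0 1) (\<lambda>n z. \<Sum>i<n. f i z) (weyl_integrand r d t) sequentially"
    using uniform_limit_cong'[of "sphere 0 1" "\<lambda>n z. \<Sum>i<n. f i z" "\<lambda>n z. \<Sum>i<n. f i z"
        "\<lambda>z. suminf (\<lambda>i. f i z)" "weyl_integrand r d t" sequentially] by blast
  have integral_f: "(f n has_contour_integral (2 * pi * \<i> * (of_nat (hilbert_function r d n) * t ^ n))) (circlepath 0 1)" for n
  proof -
    have "(f n has_contour_integral (t ^ n * (\<Sum>m\<in>D n.
        (if - 1 - w m = - 1 then 2 * pi * \<i> else 0) - (if 1 - w m = - 1 then 2 * pi * \<i> else 0)))) (circlepath 0 1)"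
      unfolding f_def
      by (intro has_contour_integral_lmul has_contour_integral_sum has_contour_integral_diff
          contour_integral_powi_unit_circle finD)
    also have "(\<Sum>m\<in>D n. (if - 1 - w m = - 1 then 2 * pi * \<i> else 0) - (if 1 - w m = - 1 then 2 * pi * \<i> else 0)) =
        2 * pi * \<i> * (of_nat (card {m \<in> D n. w m = 0}) - of_nat (card {m \<in> D n. w m = 2}))"
    proof -
      have card: "(\<Sum>m\<in>D n. if w m = k then 2 * pi * \<i> else 0) = 2 * pi * \<i> * of_nat (card {m \<in> D n. w m = k})" for k
        using finD[of n] by (simp add: sum.If_cases Int_def)
      have "(- 1 - w m = - 1) = (w m = 0)" "(1 - w m = - 1) = (w m = 2)" for m by auto
      then show ?thesis unfolding sum_subtractf right_diff_distrib card[symmetric] by presburger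
    qed
    also have "of_nat (card {m \<in> D n. w m = 0}) - of_nat (card {m \<in> D n. w m = 2}) = complex_of_nat (hilbert_function r d n)"
      unfolding D_def w_def hilbert_function_eq[of r d n, symmetric] by simp
    finally show ?thesis by (simp add: mult_ac)
  qed
  have int: "((\<lambda>z. \<Sum>i<n. f i z) has_contour_integral (\<Sum>i<n. 2 * pi * \<i> * (of_nat (hilbert_function r d i) * t ^ i))) (circlepath 0 1)" for n
    by (intro has_contour_integral_sum integral_f) auto
  have "(\<lambda>n. contour_integral (circlepath 0 1) (\<lambda>z. \<Sum>i<n. f i z)) \<longlonglongrightarrow> contour_integral (circlepath 0 1) (weyl_integrand r d t)"
    using int by (intro contour_integral_uniform_limit_circlepath(2)[OF _ ul] always_eventually)
      (auto intro: has_contour_integral_integrable)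
  then have "(\<lambda>i. 2 * pi * \<i> * (of_nat (hilbert_function r d i) * t ^ i)) sums contour_integral (circlepath 0 1) (weyl_integrand r d t)"
    unfolding sums_def contour_integral_unique[OF int] .
  from sums_divide[OF this, of "2 * pi * \<i>"] show ?thesis by simp
qed

section \<open>The poles of the Weyl integrand in the unit disc\<close>

definition cluster_points :: "nat \<Rightarrow> (nat \<Rightarrow> nat) \<Rightarrow> complex \<Rightarrow> complex set" where
  "cluster_points r d t = {z. \<exists>X\<in>Lambda r d. z powi wt d X = t}"

lemma Lambda_eq: "Lambda r d = {x \<in> Theta r d. wt d x > 0}"
  by (auto simp: Lambda_def Theta_def wt_def)

lemma finite_Lambda: "finite (Lambda r d)"
  by (simp add: Lambda_eq finite_Theta)

text \<open>The residue theorem needs an open set around the closed unit disc. On this slightly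
  larger disc the factors of nonpositive weight, 1 - t z^n, still have no zero.\<close>

lemma root_ball_exists:
  fixes t :: complex
  assumes "norm t < 1"
  obtains R where "R > 1" "\<And>n z. n \<le> N \<Longrightarrow> norm z < R \<Longrightarrow> norm (t * z ^ n) < 1"
proof -
  have "((\<lambda>R. norm t * R ^ N) \<longlongrightarrow> norm t * 1 ^ N) (at_right (1::real))"
    by (intro tendsto_intros)
  then have "eventually (\<lambda>R. norm t * R ^ N < 1) (at_right (1::real))"
    using assms by (intro order_tendstoD) auto
  then obtain b where b: "b > 1" "\<And>R. R > 1 \<Longrightarrow> R < b \<Longrightarrow> norm t * R ^ N < 1"
    by (auto simp: eventually_at_right_field)
  define R where "R = (1 + b) / 2"
  have R: "R > 1" "norm t * R ^ N < 1" using b by (auto simp: R_def)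
  have "norm (t * z ^ n) < 1" if "n \<le> N" "norm z < R" for n z
  proof -
    have "norm z ^ n \<le> R ^ n" using that by (intro power_mono) auto
    also have "\<dots> \<le> R ^ N" using that R by (intro power_increasing) auto
    finally have "norm t * norm z ^ n \<le> norm t * R ^ N" by (intro mult_left_mono) auto
    then show ?thesis using R by (simp add: norm_mult norm_power)
  qed
  then show ?thesis using that R by blast
qed

lemma weyl_integrand_residues:
  assumes t: "norm t < 1" "t \<noteq> 0" and "Lambda r d \<noteq> {}" and fin: "finite (cluster_points r d t)"
  shows "contour_integral (circlepath 0 1) (weyl_integrand r d t) =
    2 * pi * \<i> * (\<Sum>p\<in>cluster_points r d t. residue (weyl_integrand r d t) p)"
proof -
  \<comment> \<open>The factors as polynomials: those of positive weight are multiplied by the power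
    of \<open>z\<close> that clears the denominator.\<close>
  define g where "g x z = (if wt d x > 0 then z ^ nat (wt d x) - t else 1 - t * z ^ nat (- wt d x))" for x and z :: complex
  define A where "A = (\<Sum>x\<in>Lambda r d. nat (wt d x))"
  \<comment> \<open>The cleared powers of \<open>z\<close> add up to \<open>A\<close>. One of them
    cancels the factor 1 / z of the integrand, so that \<open>G\<close> has no pole at 0.\<close>
  have "A \<ge> 1"
  proof -
    obtain X where "X \<in> Lambda r d" using assms(3) by blast
    then have "nat (wt d X) \<le> A" "nat (wt d X) \<ge> 1"
      unfolding A_def by (auto intro!: member_le_sum simp: finite_Theta Lambda_eq)
    then show ?thesis by simp
  qed
  define G where "G z = (1 - z\<^sup>2) * z ^ (A - 1) / (\<Prod>x\<in>Theta r d. g x z)" for z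
  have FG: "weyl_integrand r d t z = G z" if "z \<noteq> 0" for z
  proof -
    have "1 - t * z powi (- wt d x) = g x z / (if wt d x > 0 then z ^ nat (wt d x) else 1)" for x
      using that by (auto simp: g_def power_int_def field_simps)
    then have "(\<Prod>x\<in>Theta r d. 1 - t * z powi (- wt d x)) =
        (\<Prod>x\<in>Theta r d. g x z) / (\<Prod>x\<in>Theta r d. if wt d x > 0 then z ^ nat (wt d x) else 1)"
      by (simp add: prod_dividef)
    also have "(\<Prod>x\<in>Theta r d. if wt d x > 0 then z ^ nat (wt d x) else 1) = z ^ A"
      unfolding A_def Lambda_eq power_sum by (simp add: prod.inter_filter finite_Theta)
    also have "z ^ A = z * z ^ (A - 1)" using \<open>A \<ge> 1\<close> by (simp flip: power_Suc)
    finally show ?thesis using that by (simp add: weyl_integrand_def G_def)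
  qed
  define N where "N = Max (insert 0 ((\<lambda>x. nat (- wt d x)) ` Theta r d))"
  obtain R where R: "R > 1" "\<And>n z. n \<le> N \<Longrightarrow> norm z < R \<Longrightarrow> norm (t * z ^ n) < 1"
    using root_ball_exists[OF t(1)] by blast
  have g_nz: "g x z \<noteq> 0" if "x \<in> Theta r d" "z \<in> ball 0 R - cluster_points r d t" for x z
  proof (cases "wt d x > 0")
    case True
    then have "z powi wt d x \<noteq> t" using that unfolding cluster_points_def Lambda_eq by blast
    then show ?thesis using True by (simp add: g_def power_int_def)
  next
    case False
    have "nat (- wt d x) \<le> N" using that by (simp add: N_def finite_Theta)
    then have "norm (t * z ^ nat (- wt d x)) < 1" using R(2) that by simp
    then show ?thesis using False by (auto simp: g_def)
  qed
  have pts: "norm p < 1 \<and> p \<noteq> 0" if p: "p \<in> cluster_points r d t" for p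
  proof -
    obtain X where X: "X \<in> Lambda r d" "p powi wt d X = t" using p by (auto simp: cluster_points_def)
    then have "wt d X > 0" by (simp add: Lambda_eq)
    then have pw: "p ^ nat (wt d X) = t" "nat (wt d X) > 0" using X by (auto simp: power_int_def)
    have "\<not> norm p \<ge> 1"
    proof
      assume "norm p \<ge> 1"
      then have "norm t \<ge> 1" using pw(1) one_le_power[of "norm p" "nat (wt d X)"] by (simp flip: norm_power)
      then show False using t by simp
    qed
    then show ?thesis using pw t by auto
  qed
  have "contour_integral (circlepath 0 1) (weyl_integrand r d t) = contour_integral (circlepath 0 1) G"
    by (intro contour_integral_eq FG) auto
  also have "\<dots> = 2 * pi * \<i> * (\<Sum>p\<in>cluster_points r d t. winding_number (circlepath 0 1) p * residue G p)"
  proof (rule Residue_theorem[OF open_ball convex_connected[OF convex_ball] fin])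
    show "G holomorphic_on ball 0 R - cluster_points r d t"
    proof -
      have "(\<lambda>z. g x z) holomorphic_on A" for x A
        by (cases "wt d x > 0") (auto simp: g_def intro!: holomorphic_intros)
      then show ?thesis
        unfolding G_def using g_nz by (intro holomorphic_intros) (auto simp: finite_Theta)
    qed
    show "path_image (circlepath 0 1) \<subseteq> ball 0 R - cluster_points r d t"
      using R(1) pts by fastforce
    show "\<forall>z. z \<notin> ball 0 R \<longrightarrow> winding_number (circlepath 0 1) z = 0"
    proof safe
      fix z :: complex assume "z \<notin> ball 0 R"
      then show "winding_number (circlepath 0 1) z = 0"
        using R(1) by (intro winding_number_zero_outside[of _ "ball 0 R"]) auto
    qed
  qed auto
  also have "(\<Sum>p\<in>cluster_points r d t. winding_number (circlepath 0 1) p * residue G p) =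
      (\<Sum>p\<in>cluster_points r d t. residue (weyl_integrand r d t) p)"
  proof (rule sum.cong[OF refl])
    fix p assume p: "p \<in> cluster_points r d t"
    have "eventually (\<lambda>z. z \<in> - {0}) (at p)"
      using pts[OF p] by (intro eventually_at_in_open') auto
    then have "residue (weyl_integrand r d t) p = residue G p"
      by (intro residue_cong) (auto elim!: eventually_mono simp: FG)
    then show "winding_number (circlepath 0 1) p * residue G p = residue (weyl_integrand r d t) p"
      using pts[OF p] by (simp add: winding_number_circlepath)
  qed
  finally show ?thesis .
qed

section \<open>Residues at a cluster of perturbed poles\<close>

text \<open>Continuity jointly in the parameter and the point. The size \<open>e\<close> is governed
  by \<open>eventually\<close> so that finitely many such conditions can be intersected into one
  radius.\<close>

lemma eventually_box:
  fixes f :: "'a::metric_space \<times> 'b::metric_space \<Rightarrow> 'c::topological_space"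
  assumes "isCont f (a, z0)" "open T" "f (a, z0) \<in> T"
  shows "\<forall>\<^sub>F e in at_right 0. \<forall>b z. dist b a < e \<longrightarrow> dist z z0 < e \<longrightarrow> f (b, z) \<in> T"
proof -
  have "(f \<longlongrightarrow> f (a, z0)) (nhds (a, z0))"
    using assms(1) by (simp add: isCont_def tendsto_at_iff_tendsto_nhds)
  from topological_tendstoD[OF this assms(2,3)] obtain d where d: "d > 0" "\<And>y. dist y (a, z0) < d \<Longrightarrow> f y \<in> T"
    by (auto simp: eventually_nhds_metric)
  have "\<forall>b z. dist b a < e \<longrightarrow> dist z z0 < e \<longrightarrow> f (b, z) \<in> T" if "0 < e" "e < d / 2" for e
  proof safe
    fix b z assume "dist b a < e" "dist z z0 < e"
    then have "dist (b, z) (a, z0) < d"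
      using sqrt_sum_squares_le_sum[of "dist b a" "dist z z0"] that by (simp add: dist_Pair_Pair)
    then show "f (b, z) \<in> T" by (rule d)
  qed
  then show ?thesis using d(1) by (auto simp: eventually_at_right_field intro!: exI[of _ "d / 2"])
qed

lemma norm_unit_root:
  assumes "\<alpha> > 0" "\<zeta> powi \<alpha> = 1"
  shows "norm (\<zeta> :: complex) = 1"
proof -
  have "\<zeta> ^ nat \<alpha> = 1" using assms by (simp add: power_int_def)
  then show ?thesis using power_eq_1_iff[of \<zeta> "nat \<alpha>"] assms(1) by simp
qed

text \<open>
  The summand of the limit formula: the residue at \<open>\<zeta> exp (l / b X)\<close> of the integrand in which
  \<open>z powi (- a x) * t\<close> is replaced by \<open>\<zeta> powi (- a x) * exp (l - b x * w)\<close>, with \<open>w\<close> the branch of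
  \<open>log (z / \<zeta>)\<close> that equals \<open>l / \<alpha>\<close> at \<open>z0 = \<zeta> exp (l / \<alpha>)\<close>.
\<close>

definition cluster_term ::
    "complex \<Rightarrow> 'x set \<Rightarrow> ('x \<Rightarrow> int) \<Rightarrow> complex \<Rightarrow> ('x \<Rightarrow> real) \<Rightarrow> 'x \<Rightarrow> complex" where
  "cluster_term l S a \<zeta> b X = (1 - \<zeta> ^ 2 * rpow l (2 / b X)) /
     (of_real (b X) * (\<Prod>x\<in>S - {X}. 1 - \<zeta> powi (- a x) * rpow l ((b X - b x) / b X)))"

context
  fixes l \<zeta> :: complex and \<alpha> :: int and z0 :: complex
  assumes Re_l: "Re l < 0" and \<alpha>_pos: "\<alpha> > 0" and \<zeta>: "\<zeta> powi \<alpha> = 1"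
  defines "z0 \<equiv> \<zeta> * exp (l / of_int \<alpha>)"
begin

definition local_log :: "complex \<Rightarrow> complex" where
  "local_log z = Ln (z / z0) + l / of_int \<alpha>"

lemma norm_\<zeta>: "norm \<zeta> = 1"
  by (rule norm_unit_root[OF \<alpha>_pos \<zeta>])

lemma z0_nz: "z0 \<noteq> 0"
  using norm_\<zeta> by (auto simp: z0_def)

text \<open>Within distance \<open>norm z0\<close> of \<open>z0\<close> the quotient z / z0 has
  positive real part, so z avoids 0 and Ln (z / z0) is holomorphic.\<close>

lemma ball_z0:
  assumes "z \<in> ball z0 (norm z0)"
  shows "z \<noteq> 0" "z / z0 \<notin> \<real>\<^sub>\<le>\<^sub>0"
proof -
  have "norm (1 - z / z0) * norm z0 < 1 * norm z0"
    using assms z0_nz by (simp add: dist_norm left_diff_distrib flip: norm_mult)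
  then have "norm (1 - z / z0) < 1" using z0_nz by (subst (asm) mult_less_cancel_right) auto
  then have "Re (z / z0) > 0" using abs_Re_le_cmod[of "1 - z / z0"] by simp
  then show "z \<noteq> 0" "z / z0 \<notin> \<real>\<^sub>\<le>\<^sub>0" by (auto simp: complex_nonpos_Reals_iff)
qed

lemma local_log_deriv:
  assumes "z \<in> ball z0 (norm z0)"
  shows "(local_log has_field_derivative 1 / z) (at z)"
proof -
  have "((\<lambda>z. Ln (z / z0) + l / of_int \<alpha>) has_field_derivative 1 / z) (at z)"
    using ball_z0[OF assms] z0_nz by (auto intro!: derivative_eq_intros simp: field_simps)
  then show ?thesis by (simp add: local_log_def[abs_def])
qed

lemma local_log_z0: "local_log z0 = l / of_int \<alpha>"
  using z0_nz by (simp add: local_log_def)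

lemma local_log_continuous: "continuous_on (ball z0 (norm z0)) local_log"
  using local_log_deriv DERIV_isCont continuous_at_imp_continuous_on by blast

lemma isCont_factor:
  "isCont (\<lambda>p. l - of_real (fst p) * local_log (snd p)) (b, z0)"
proof -
  have "isCont local_log z0" using local_log_deriv[of z0] z0_nz by (auto intro: DERIV_isCont)
  then have "isCont (\<lambda>p. local_log (snd p)) (b, z0)"
    by (intro isCont_o2[where g = local_log and f = snd]) auto
  then show ?thesis by (intro continuous_intros)
qed

text \<open>At the centre the subtracted term has modulus exp (Re l (1 - k / \<alpha>)), which
  differs from 1 because Re l < 0 and k \<noteq> \<alpha>.\<close>

lemma factor_nonzero:
  assumes "k \<noteq> \<alpha>"
  shows "\<forall>\<^sub>F e in at_right 0. \<forall>b z. dist b (of_int k) < e \<longrightarrow> dist z z0 < e \<longrightarrow>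
    1 - \<zeta> powi (- k) * exp (l - of_real b * local_log z) \<noteq> 0"
proof -
  let ?f = "\<lambda>p. 1 - \<zeta> powi (- k) * exp (l - of_real (fst p) * local_log (snd p))"
  have "norm (\<zeta> powi (- k) * exp (l - of_int k * (l / of_int \<alpha>))) = exp (Re l - real_of_int k * (Re l / real_of_int \<alpha>))"
    by (simp add: norm_mult norm_power_int norm_\<zeta>)
  moreover have "Re l - real_of_int k * (Re l / real_of_int \<alpha>) \<noteq> 0"
    using assms Re_l \<alpha>_pos by (auto simp: field_simps)
  ultimately have "norm (\<zeta> powi (- k) * exp (l - of_int k * (l / of_int \<alpha>))) \<noteq> 1" by simp
  then have "?f (of_int k, z0) \<in> - {0}" by (auto simp: local_log_z0)
  then have "\<forall>\<^sub>F e in at_right 0. \<forall>b z. dist b (of_int k) < e \<longrightarrow> dist z z0 < e \<longrightarrow> ?f (b, z) \<in> - {0}"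
    by (intro eventually_box continuous_intros isCont_factor) auto
  then show ?thesis by simp
qed

text \<open>Below the bound 2 pi the exponential takes the value 1 only at 0; this makes the zero in
  \<open>factor_zero_iff\<close> unique.\<close>

lemma factor_near:
  "\<forall>\<^sub>F e in at_right 0. \<forall>b z. dist b (of_int \<alpha>) < e \<longrightarrow> dist z z0 < e \<longrightarrow>
    norm (l - of_real b * local_log z) < 2 * pi"
proof -
  let ?f = "\<lambda>p. l - of_real (fst p) * local_log (snd p)"
  have "?f (of_int \<alpha>, z0) \<in> ball 0 (2 * pi)" using \<alpha>_pos by (simp add: local_log_z0)
  then have "\<forall>\<^sub>F e in at_right 0. \<forall>b z. dist b (of_int \<alpha>) < e \<longrightarrow> dist z z0 < e \<longrightarrow> ?f (b, z) \<in> ball 0 (2 * pi)"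
    by (intro eventually_box isCont_factor) auto
  then show ?thesis by simp
qed

text \<open>The bound pi on the imaginary part lets \<open>Ln\<close> invert the exponential in
  \<open>local_log_pole\<close>: the branch then has the value l / b at the displaced pole.\<close>

lemma pole_near:
  assumes "\<epsilon> > 0"
  shows "\<forall>\<^sub>F b in nhds (real_of_int \<alpha>). b > 0 \<and> \<bar>Im (l / of_real b - l / of_int \<alpha>)\<bar> < pi \<and>
    \<zeta> * exp (l / of_real b) \<in> ball z0 \<epsilon>"
proof (intro eventually_conj)
  have "\<forall>\<^sub>F b in nhds (real_of_int \<alpha>). b \<in> {0<..}"
    using \<alpha>_pos by (intro eventually_nhds_in_open) auto
  then show "\<forall>\<^sub>F b in nhds (real_of_int \<alpha>). b > 0" by simp
  have lim: "((\<lambda>b. l / complex_of_real b) \<longlongrightarrow> l / of_int \<alpha>) (nhds (real_of_int \<alpha>))"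
    using \<alpha>_pos tendsto_divide[OF tendsto_const tendsto_of_real[OF filterlim_ident], of "real_of_int \<alpha>" l] by simp
  have "((\<lambda>b. \<bar>Im (l / of_real b - l / of_int \<alpha>)\<bar>) \<longlongrightarrow> \<bar>Im (l / of_int \<alpha> - l / of_int \<alpha>)\<bar>) (nhds (real_of_int \<alpha>))"
    by (intro tendsto_intros lim)
  then show "\<forall>\<^sub>F b in nhds (real_of_int \<alpha>). \<bar>Im (l / of_real b - l / of_int \<alpha>)\<bar> < pi"
    by (rule order_tendstoD) simp
  have "((\<lambda>b. \<zeta> * exp (l / complex_of_real b)) \<longlongrightarrow> \<zeta> * exp (l / of_int \<alpha>)) (nhds (real_of_int \<alpha>))"
    by (intro tendsto_intros lim)
  then show "\<forall>\<^sub>F b in nhds (real_of_int \<alpha>). \<zeta> * exp (l / of_real b) \<in> ball z0 \<epsilon>"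
    using assms by (intro topological_tendstoD) (auto simp: z0_def)
qed

lemma local_log_pole:
  assumes "\<bar>Im (l / of_real b - l / of_int \<alpha>)\<bar> < pi"
  shows "local_log (\<zeta> * exp (l / of_real b)) = l / of_real b"
proof -
  have "\<zeta> * exp (l / of_real b) / z0 = exp (l / of_real b - l / of_int \<alpha>)"
    using z0_nz by (auto simp: z0_def exp_diff)
  moreover have "Ln (exp (l / of_real b - l / of_int \<alpha>)) = l / of_real b - l / of_int \<alpha>"
    using assms by (intro Ln_exp) auto
  ultimately show ?thesis by (simp add: local_log_def)
qed

lemma factor_zero_iff:
  assumes "norm (l - of_real b * local_log z) < 2 * pi" "b > 0" "z \<noteq> 0"
    and "\<bar>Im (l / of_real b - l / of_int \<alpha>)\<bar> < pi"
  shows "1 - \<zeta> powi (- \<alpha>) * exp (l - of_real b * local_log z) = 0 \<longleftrightarrow> z = \<zeta> * exp (l / of_real b)"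
proof
  assume "1 - \<zeta> powi (- \<alpha>) * exp (l - of_real b * local_log z) = 0"
  then have "exp (l - of_real b * local_log z) = 1" using \<zeta> by (simp add: power_int_minus)
  then obtain n where n: "Re (l - of_real b * local_log z) = 0" "Im (l - of_real b * local_log z) = of_int (2 * n) * pi"
    unfolding exp_eq_1 by blast
  have "\<bar>of_int (2 * n) * pi\<bar> < 2 * pi"
    using assms(1) abs_Im_le_cmod[of "l - of_real b * local_log z"] unfolding n(2) by linarith
  then have "\<bar>real_of_int n\<bar> < 1" by (simp add: abs_mult)
  then have "n = 0" by linarith
  then have "l - of_real b * local_log z = 0" using n by (simp add: complex_eq_iff)
  then have "local_log z = l / of_real b" using assms(2) by (simp add: field_simps)
  then have "Ln (z / z0) = l / of_real b - l / of_int \<alpha>" by (simp add: local_log_def algebra_simps)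
  then have "z / z0 = exp (l / of_real b - l / of_int \<alpha>)" using assms(3) z0_nz by (metis exp_Ln divide_eq_0_iff)
  then show "z = \<zeta> * exp (l / of_real b)" using z0_nz by (simp add: exp_diff z0_def field_simps)
next
  assume "z = \<zeta> * exp (l / of_real b)"
  then have "local_log z = l / of_real b" using local_log_pole assms(4) by simp
  then show "1 - \<zeta> powi (- \<alpha>) * exp (l - of_real b * local_log z) = 0"
    using \<zeta> assms(2) by (simp add: power_int_minus)
qed

context
  fixes S :: "'x set" and a :: "'x \<Rightarrow> int" and C :: "'x set"
  assumes S: "finite S"
  defines "C \<equiv> {x \<in> S. a x = \<alpha>}"
begin

definition factor :: "('x \<Rightarrow> real) \<Rightarrow> 'x \<Rightarrow> complex \<Rightarrow> complex" where
  "factor b x z = 1 - \<zeta> powi (- a x) * exp (l - of_real (b x) * local_log z)"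

definition family :: "('x \<Rightarrow> real) \<Rightarrow> complex \<Rightarrow> complex" where
  "family b z = (1 - z\<^sup>2) / (z * (\<Prod>x\<in>S. factor b x z))"

definition pole :: "('x \<Rightarrow> real) \<Rightarrow> 'x \<Rightarrow> complex" where
  "pole b x = \<zeta> * exp (l / of_real (b x))"

text \<open>One \<open>e\<close>, independent of \<open>b\<close>, limits both the displacement of
  the parameters and the disc. In this disc the factors of weight other than \<alpha> have no zero,
  and the others vanish at most at \<open>pole b x\<close>.\<close>

lemma cluster_radius:
  obtains e where "0 < e" "e \<le> norm z0"
    "\<And>b x z. x \<in> S - C \<Longrightarrow> dist (b x) (of_int (a x)) < e \<Longrightarrow> z \<in> ball z0 e \<Longrightarrow> factor b x z \<noteq> 0"
    "\<And>b x z. x \<in> C \<Longrightarrow> dist (b x) (of_int (a x)) < e \<Longrightarrow> z \<in> ball z0 e \<Longrightarrow>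
      b x > 0 \<and> local_log (pole b x) = l / of_real (b x) \<and> (factor b x z = 0 \<longleftrightarrow> z = pole b x)"
proof -
  obtain d where d: "d > 0" "\<And>b. dist b (real_of_int \<alpha>) < d \<Longrightarrow> b > 0 \<and> \<bar>Im (l / of_real b - l / of_int \<alpha>)\<bar> < pi"
    using pole_near[of 1] unfolding eventually_nhds_metric by auto
  have "\<forall>\<^sub>F e in at_right 0. \<forall>x\<in>S - C. \<forall>b z. dist b (of_int (a x)) < e \<longrightarrow> dist z z0 < e \<longrightarrow>
      1 - \<zeta> powi (- a x) * exp (l - of_real b * local_log z) \<noteq> 0"
    using S by (intro eventually_ball_finite ballI factor_nonzero) (auto simp: C_def)
  moreover have "\<forall>\<^sub>F e in at_right 0. e < min d (norm z0)"
    using d(1) z0_nz by (intro eventually_at_right_less[THEN eventually_mono] order_tendstoD) (auto intro: tendsto_ident_at)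
  moreover note factor_near
  ultimately have "\<forall>\<^sub>F e in at_right 0. e > 0 \<and> e < min d (norm z0) \<and>
     (\<forall>x\<in>S - C. \<forall>b z. dist b (of_int (a x)) < e \<longrightarrow> dist z z0 < e \<longrightarrow>
      1 - \<zeta> powi (- a x) * exp (l - of_real b * local_log z) \<noteq> 0) \<and>
     (\<forall>b z. dist b (of_int \<alpha>) < e \<longrightarrow> dist z z0 < e \<longrightarrow> norm (l - of_real b * local_log z) < 2 * pi)"
    by (intro eventually_conj eventually_at_right_less) auto
  then obtain e where e: "e > 0" "e < min d (norm z0)"
    "\<And>x b z. x\<in>S - C \<Longrightarrow> dist b (of_int (a x)) < e \<Longrightarrow> dist z z0 < e \<Longrightarrow>
      1 - \<zeta> powi (- a x) * exp (l - of_real b * local_log z) \<noteq> 0"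
    "\<And>b z. dist b (of_int \<alpha>) < e \<Longrightarrow> dist z z0 < e \<Longrightarrow> norm (l - of_real b * local_log z) < 2 * pi"
    using eventually_happens[of _ "at_right (0::real)"] trivial_limit_at_right_real[of 0] by blast
  show ?thesis
  proof
    show "0 < e" "e \<le> norm z0" using e by auto
    show "factor b x z \<noteq> 0" if "x \<in> S - C" "dist (b x) (of_int (a x)) < e" "z \<in> ball z0 e" for b x z
      using e(3)[of x "b x" z] that by (simp add: factor_def dist_commute)
    show "b x > 0 \<and> local_log (pole b x) = l / of_real (b x) \<and> (factor b x z = 0 \<longleftrightarrow> z = pole b x)"
      if x: "x \<in> C" "dist (b x) (of_int (a x)) < e" and z: "z \<in> ball z0 e" for b x z
    proof -
      have ax: "a x = \<alpha>" using x by (simp add: C_def)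
      then have b: "b x > 0" "\<bar>Im (l / of_real (b x) - l / of_int \<alpha>)\<bar> < pi"
        using d(2)[of "b x"] x e(2) by auto
      have "norm (l - of_real (b x) * local_log z) < 2 * pi"
        using e(4)[of "b x" z] x z ax by (simp add: dist_commute)
      moreover have "z \<noteq> 0" using ball_z0[of z] z e(2) by auto
      ultimately show ?thesis
        using factor_zero_iff[of "b x" z] local_log_pole[of "b x"] b ax by (simp add: factor_def pole_def)
    qed
  qed
qed

lemma factor_holomorphic: "e \<le> norm z0 \<Longrightarrow> factor b x holomorphic_on ball z0 e"
  unfolding factor_def[abs_def] holomorphic_on_open[OF open_ball]
  by (auto intro!: exI derivative_eq_intros local_log_deriv)

text \<open>For pairwise distinct parameters all poles in the disc are simple.\<close>

lemma residue_family:
  assumes e: "0 < e" "e \<le> norm z0" and X: "X \<in> C"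
    and far: "\<And>x z. x \<in> S - C \<Longrightarrow> z \<in> ball z0 e \<Longrightarrow> factor b x z \<noteq> 0"
    and near: "\<And>x z. x \<in> C \<Longrightarrow> z \<in> ball z0 e \<Longrightarrow> factor b x z = 0 \<longleftrightarrow> z = pole b x"
    and pole: "local_log (pole b X) = l / of_real (b X)" "b X > 0" "pole b X \<in> ball z0 e"
    and inj: "inj_on (pole b) C"
  shows "residue (family b) (pole b X) = cluster_term l S a \<zeta> b X"
proof -
  define p where "p = pole b X"
  have XS: "X \<in> S" "a X = \<alpha>" using X by (auto simp: C_def)
  have finC: "finite C" using S by (simp add: C_def)
  have p: "p \<in> ball z0 e" "p \<in> ball z0 (norm z0)" "p \<noteq> 0" using pole e ball_z0(1)[of p] by (auto simp: p_def)
  have nz: "factor b x p \<noteq> 0" if "x \<in> S - {X}" for x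
    using that far[of x p] near[of x p] p(1) inj X by (cases "x \<in> C") (auto simp: p_def dest: inj_onD)
  have val: "factor b x p = 1 - \<zeta> powi (- a x) * rpow l ((b X - b x) / b X)" for x
  proof -
    have "l - of_real (b x) * (l / of_real (b X)) = of_real ((b X - b x) / b X) * l"
      using pole(2) by (simp add: field_simps)
    then show ?thesis using pole(1) by (simp add: factor_def rpow_def p_def)
  qed
  have psq: "p\<^sup>2 = \<zeta> ^ 2 * rpow l (2 / b X)"
    by (simp add: p_def pole_def rpow_def power_mult_distrib flip: exp_of_nat_mult) 
  show ?thesis
    unfolding p_def[symmetric]
  proof (rule residue_simple')
    show "open (ball z0 e - pole b ` (C - {X}))" using finC by (intro open_Diff finite_imp_closed) auto
    show "p \<in> ball z0 e - pole b ` (C - {X})" using p X inj by (auto simp: p_def dest: inj_onD)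
    show "family b holomorphic_on ball z0 e - pole b ` (C - {X}) - {p}"
      unfolding family_def[abs_def]
    proof (intro holomorphic_intros holomorphic_on_subset[OF factor_holomorphic[OF e(2)]])
      fix z assume z: "z \<in> ball z0 e - pole b ` (C - {X}) - {p}"
      then have "factor b x z \<noteq> 0" if "x \<in> S" for x
        using far[of x z] near[of x z] that by (cases "x \<in> C") (auto simp: p_def)
      moreover have "z \<noteq> 0" using z ball_z0(1)[of z] e by auto
      ultimately show "z * (\<Prod>x\<in>S. factor b x z) \<noteq> 0" using S by simp
    qed auto
    \<comment> \<open>This derivative at the simple zero supplies the factor \<open>b X\<close> in
      the denominator of the summand; its \<open>p\<close> cancels the factor 1 / z of the
      integrand.\<close>
    have "((\<lambda>z. factor b X z) has_field_derivative of_real (b X) / p) (at p)"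
    proof -
      have "(factor b X has_field_derivative - (\<zeta> powi (- a X) * (exp (l - of_real (b X) * local_log p) * - (of_real (b X) * (1 / p))))) (at p)"
        unfolding factor_def[abs_def] by (auto intro!: derivative_eq_intros local_log_deriv p)
      moreover have "exp (l - of_real (b X) * local_log p) = 1" using pole by (simp add: p_def)
      ultimately show ?thesis using \<zeta> XS by (simp add: power_int_minus)
    qed
    moreover have "factor b X p = 0" using near[OF X] p by (simp add: p_def)
    ultimately have "((\<lambda>z. factor b X z / (z - p)) \<longlongrightarrow> of_real (b X) / p) (at p)"
      by (simp add: has_field_derivative_iff)
    then have inv: "((\<lambda>z. inverse (factor b X z / (z - p))) \<longlongrightarrow> inverse (of_real (b X) / p)) (at p)"
      using pole(2) p by (intro tendsto_inverse) auto
    have cont: "(factor b x \<longlongrightarrow> factor b x p) (at p)" for x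
      using holomorphic_on_imp_continuous_on[OF factor_holomorphic[OF e(2)]] p(1) continuous_on_interior[of "ball z0 e"]
      by (auto simp: isCont_def)
    have "(\<Prod>x\<in>S - {X}. factor b x p) \<noteq> 0" using nz S by simp
    then have "((\<lambda>z. (1 - z\<^sup>2) / (z * (\<Prod>x\<in>S - {X}. factor b x z)) * inverse (factor b X z / (z - p))) \<longlongrightarrow>
        (1 - p\<^sup>2) / (p * (\<Prod>x\<in>S - {X}. factor b x p)) * inverse (of_real (b X) / p)) (at p)"
      using p by (intro tendsto_mult[OF _ inv] tendsto_intros cont) auto
    moreover have "(1 - z\<^sup>2) / (z * (\<Prod>x\<in>S - {X}. factor b x z)) * inverse (factor b X z / (z - p)) = family b z * (z - p)" for z
      unfolding family_def using S XS by (simp add: prod.remove[of S X])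
    moreover have "(1 - p\<^sup>2) / (p * (\<Prod>x\<in>S - {X}. factor b x p)) * inverse (of_real (b X) / p) = cluster_term l S a \<zeta> b X"
      unfolding psq val cluster_term_def using p by simp
    ultimately show "((\<lambda>z. family b z * (z - p)) \<longlongrightarrow> cluster_term l S a \<zeta> b X) (at p)" by simp
  qed
qed

text \<open>The poles are already told apart by their moduli exp (Re l / b x).\<close>

lemma pole_inj:
  assumes "\<And>x y. x \<in> C \<Longrightarrow> y \<in> C \<Longrightarrow> b x = b y \<Longrightarrow> x = y" "\<And>x. x \<in> C \<Longrightarrow> b x > 0"
  shows "inj_on (pole b) C"
proof (rule inj_onI)
  fix x y assume xy: "x \<in> C" "y \<in> C" "pole b x = pole b y"
  have "norm (pole b z) = exp (Re l / b z)" for z by (simp add: pole_def norm_mult norm_\<zeta>)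
  then have "Re l / b x = Re l / b y" using xy(3) by (metis exp_inj_iff)
  then have "b x = b y" using Re_l assms(2) xy by (auto simp: field_simps)
  then show "x = y" using assms(1) xy by blast
qed

text \<open>At integer parameters the branch disappears: since \<zeta> exp (local_log z) = z, the
  integral powers recombine to powers of z.\<close>

lemma family_center:
  assumes "\<And>x. x \<in> S \<Longrightarrow> b x = of_int (a x)" "z \<in> ball z0 (norm z0)"
  shows "family b z = (1 - z\<^sup>2) / (z * (\<Prod>x\<in>S. 1 - exp l * z powi (- a x)))"
proof -
  have "\<zeta> powi (- k) * exp (l - of_int k * local_log z) = exp l * z powi (- k)" for k
  proof -
    have "exp (local_log z) = (z / z0) * exp (l / of_int \<alpha>)"
      using ball_z0[OF assms(2)] z0_nz by (simp add: local_log_def exp_add)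
    then have *: "\<zeta> * exp (local_log z) = z" using z0_nz by (simp add: z0_def)
    have "exp (l - of_int k * local_log z) = exp l * exp (local_log z) powi (- k)"
      using exp_power_int[of "local_log z" "- k"] by (simp add: mult_exp_exp)
    then have "\<zeta> powi (- k) * exp (l - of_int k * local_log z) = exp l * (\<zeta> * exp (local_log z)) powi (- k)"
      by (simp add: power_int_mult_distrib)
    then show ?thesis unfolding * .
  qed
  then show ?thesis unfolding family_def factor_def using assms(1) by simp
qed

lemma contour_family_continuous:
  assumes \<epsilon>: "0 < \<epsilon>" "\<epsilon> < norm z0"
    and nz: "\<And>b x z. b \<in> U \<Longrightarrow> x \<in> S \<Longrightarrow> z \<in> sphere z0 \<epsilon> \<Longrightarrow> factor b x z \<noteq> 0"
  shows "continuous_on U (\<lambda>b. contour_integral (circlepath z0 \<epsilon>) (family b))"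
proof -
  define g where "g = circlepath z0 \<epsilon>"
  have g: "g \<theta> \<in> sphere z0 \<epsilon>" if "\<theta> \<in> {0..1}" for \<theta>
    using path_image_circlepath_nonneg[of \<epsilon> z0] \<epsilon> that unfolding g_def path_image_def by auto
  have g_ball: "g \<theta> \<in> ball z0 (norm z0)" if "\<theta> \<in> {0..1}" for \<theta>
    using g[OF that] \<epsilon> by auto
  have cont_g: "continuous_on (U \<times> cbox 0 1) (\<lambda>p. g (snd p))"
    unfolding g_def circlepath by (intro continuous_intros)
  have "continuous_on (U \<times> cbox 0 1) (\<lambda>p. local_log (g (snd p)))"
    by (rule continuous_on_compose2[OF local_log_continuous cont_g]) (use g_ball in auto)
  moreover have "continuous_on (U \<times> cbox 0 1) (\<lambda>p. fst p x)" for x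
    by (rule continuous_on_compose2[OF continuous_on_product_coordinates continuous_on_fst[OF continuous_on_id]]) auto
  ultimately have cont_f: "continuous_on (U \<times> cbox 0 1) (\<lambda>p. factor (fst p) x (g (snd p)))" for x
    unfolding factor_def by (intro continuous_intros)
  have "continuous_on (U \<times> cbox 0 1) (\<lambda>p. family (fst p) (g (snd p)) * (2 * pi * \<i> * \<epsilon> * exp (2 * of_real pi * \<i> * of_real (snd p))))"
    unfolding family_def
  proof (intro continuous_intros cont_g cont_f ballI)
    fix p :: "('x \<Rightarrow> real) \<times> real" assume p: "p \<in> U \<times> cbox 0 1"
    then have "g (snd p) \<in> sphere z0 \<epsilon>" "g (snd p) \<noteq> 0" using g[of "snd p"] g_ball[of "snd p"] ball_z0(1) by auto
    then show "g (snd p) * (\<Prod>x\<in>S. factor (fst p) x (g (snd p))) \<noteq> 0" using nz p S by auto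
  qed
  then have "continuous_on U (\<lambda>b. integral (cbox 0 1) (\<lambda>\<theta>. family b (g \<theta>) * (2 * pi * \<i> * \<epsilon> * exp (2 * of_real pi * \<i> * of_real \<theta>))))"
    by (intro integral_continuous_on_param) (simp add: case_prod_unfold)
  moreover have "contour_integral g (family b) = integral (cbox 0 1) (\<lambda>\<theta>. family b (g \<theta>) * (2 * pi * \<i> * \<epsilon> * exp (2 * of_real pi * \<i> * of_real \<theta>)))" for b
    unfolding contour_integral_integral cbox_interval
    by (intro integral_cong) (simp add: g_def vector_derivative_circlepath)
  ultimately show ?thesis unfolding g_def by simp
qed

text \<open>For \<open>b\<close> in \<open>P\<close> the integral over the fixed circle is the sum
  of residues at simple poles. At \<open>b0\<close> the same integral is the residue at the pole
  \<open>z0\<close>, whatever its order.\<close>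

lemma cluster_sum_tendsto:
  assumes b0: "\<And>x. x \<in> S \<Longrightarrow> b0 x = of_int (a x)"
    and P: "\<And>b x y. b \<in> P \<Longrightarrow> x \<in> C \<Longrightarrow> y \<in> C \<Longrightarrow> b x = b y \<Longrightarrow> x = y"
  shows "((\<lambda>b. \<Sum>X\<in>C. cluster_term l S a \<zeta> b X) \<longlongrightarrow>
    residue (\<lambda>z. (1 - z\<^sup>2) / (z * (\<Prod>x\<in>S. 1 - exp l * z powi (- a x)))) z0) (at b0 within P)"
proof -
  let ?F = "\<lambda>z. (1 - z\<^sup>2) / (z * (\<Prod>x\<in>S. 1 - exp l * z powi (- a x)))"
  obtain e where e: "0 < e" "e \<le> norm z0"
    "\<And>b x z. x \<in> S - C \<Longrightarrow> dist (b x) (of_int (a x)) < e \<Longrightarrow> z \<in> ball z0 e \<Longrightarrow> factor b x z \<noteq> 0"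
    "\<And>b x z. x \<in> C \<Longrightarrow> dist (b x) (of_int (a x)) < e \<Longrightarrow> z \<in> ball z0 e \<Longrightarrow>
      b x > 0 \<and> local_log (pole b x) = l / of_real (b x) \<and> (factor b x z = 0 \<longleftrightarrow> z = pole b x)"
    using cluster_radius by metis
  \<comment> \<open>The circle has to lie inside the disc of radius \<open>e\<close>, where the
    zeros of the factors are known; the poles are kept inside the circle.\<close>
  define \<epsilon> where "\<epsilon> = e / 2"
  have \<epsilon>: "0 < \<epsilon>" "\<epsilon> < e" using e by (auto simp: \<epsilon>_def)
  obtain \<delta> where \<delta>: "\<delta> > 0" "\<And>b. dist b (real_of_int \<alpha>) < \<delta> \<Longrightarrow> \<zeta> * exp (l / of_real b) \<in> ball z0 \<epsilon>"
    using pole_near[OF \<epsilon>(1)] unfolding eventually_nhds_metric by auto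
  \<comment> \<open>Finitely many coordinates are constrained, so \<open>U\<close> is open in the
    product topology.\<close>
  define U where "U = {b. \<forall>x\<in>S. dist (b x) (real_of_int (a x)) < min \<delta> e}"
  have C: "x \<in> S \<and> a x = \<alpha>" if "x \<in> C" for x using that by (simp add: C_def)
  have finC: "finite C" using S by (simp add: C_def)
  have pole: "pole b x \<in> ball z0 \<epsilon>" if "b \<in> U" "x \<in> C" for b x
    using \<delta>(2)[of "b x"] that C[of x] by (auto simp: U_def pole_def)
  have far: "factor b x z \<noteq> 0" if "b \<in> U" "x \<in> S - C" "z \<in> ball z0 e" for b x z
    using e(3)[of x b z] that by (auto simp: U_def)
  have near: "b x > 0 \<and> local_log (pole b x) = l / of_real (b x) \<and> (factor b x z = 0 \<longleftrightarrow> z = pole b x)"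
    if "b \<in> U" "x \<in> C" "z \<in> ball z0 e" for b x z
    using e(4)[of x b z] that C[of x] by (auto simp: U_def)
  have holo: "family b holomorphic_on ball z0 e - pole b ` C" if "b \<in> U" for b
    unfolding family_def[abs_def]
  proof (intro holomorphic_intros holomorphic_on_subset[OF factor_holomorphic[OF e(2)]])
    fix z assume z: "z \<in> ball z0 e - pole b ` C"
    then have "factor b x z \<noteq> 0" if "x \<in> S" for x
      using far[of b x z] near[of b x z] that \<open>b \<in> U\<close> by (cases "x \<in> C") auto
    moreover have "z \<noteq> 0" using z ball_z0(1)[of z] e(2) by auto
    ultimately show "z * (\<Prod>x\<in>S. factor b x z) \<noteq> 0" using S by simp
  qed auto
  have integral: "contour_integral (circlepath z0 \<epsilon>) (family b) = 2 * pi * \<i> * (\<Sum>p\<in>pole b ` C. residue (family b) p)"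
    if b: "b \<in> U" for b
  proof -
    have "contour_integral (circlepath z0 \<epsilon>) (family b) =
        2 * pi * \<i> * (\<Sum>p\<in>pole b ` C. winding_number (circlepath z0 \<epsilon>) p * residue (family b) p)"
    proof (rule Residue_theorem[OF open_ball convex_connected[OF convex_ball] finite_imageI[OF finC] holo[OF b]])
      show "path_image (circlepath z0 \<epsilon>) \<subseteq> ball z0 e - pole b ` C"
        using pole[OF b] \<epsilon> by (force simp: dist_commute)
      show "\<forall>z. z \<notin> ball z0 e \<longrightarrow> winding_number (circlepath z0 \<epsilon>) z = 0"
      proof safe
        fix z :: complex assume "z \<notin> ball z0 e"
        then show "winding_number (circlepath z0 \<epsilon>) z = 0"
          using \<epsilon> by (intro winding_number_zero_outside[of _ "ball z0 e"]) auto
      qed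
    qed auto
    also have "(\<Sum>p\<in>pole b ` C. winding_number (circlepath z0 \<epsilon>) p * residue (family b) p) =
        (\<Sum>p\<in>pole b ` C. residue (family b) p)"
    proof (rule sum.cong[OF refl])
      fix p assume "p \<in> pole b ` C"
      then have "p \<in> ball z0 \<epsilon>" using pole[OF b] by blast
      then show "winding_number (circlepath z0 \<epsilon>) p * residue (family b) p = residue (family b) p"
        by (simp add: winding_number_circlepath dist_norm norm_minus_commute)
    qed
    finally show ?thesis .
  qed
  have "open U"
  proof -
    have "U = (\<Inter>x\<in>S. {b. dist (b x) (real_of_int (a x)) < min \<delta> e})" by (auto simp: U_def)
    moreover have "open {b. dist (b x) (real_of_int (a x)) < min \<delta> e}" for x
      by (intro open_Collect_less continuous_intros continuous_on_product_coordinates)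
    ultimately show ?thesis using S by (simp add: open_INT)
  qed
  have b0U: "b0 \<in> U" using b0 \<delta>(1) e(1) by (simp add: U_def)
  have sphere: "factor b x z \<noteq> 0" if "b \<in> U" "x \<in> S" "z \<in> sphere z0 \<epsilon>" for b x z
  proof -
    have "z \<in> ball z0 e" using that \<epsilon> by auto
    moreover have "z \<noteq> pole b x" if "x \<in> C" using pole[of b x] \<open>b \<in> U\<close> \<open>z \<in> sphere z0 \<epsilon>\<close> that by auto
    ultimately show ?thesis using far[of b x z] near[of b x z] that by blast
  qed
  have "continuous_on U (\<lambda>b. contour_integral (circlepath z0 \<epsilon>) (family b))"
    using \<epsilon> e(2) sphere by (intro contour_family_continuous) auto
  then have "((\<lambda>b. contour_integral (circlepath z0 \<epsilon>) (family b)) \<longlongrightarrow> contour_integral (circlepath z0 \<epsilon>) (family b0)) (at b0)"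
    using b0U at_within_open[OF b0U \<open>open U\<close>] unfolding continuous_on_def by metis
  then have "((\<lambda>b. contour_integral (circlepath z0 \<epsilon>) (family b)) \<longlongrightarrow> contour_integral (circlepath z0 \<epsilon>) (family b0)) (at b0 within P)"
    by (rule tendsto_within_subset) simp
  then have lim: "((\<lambda>b. contour_integral (circlepath z0 \<epsilon>) (family b) / (2 * pi * \<i>)) \<longlongrightarrow>
      contour_integral (circlepath z0 \<epsilon>) (family b0) / (2 * pi * \<i>)) (at b0 within P)"
    by (intro tendsto_intros) auto
  have "contour_integral (circlepath z0 \<epsilon>) (family b0) / (2 * pi * \<i>) = residue ?F z0"
  proof -
    have z0: "z0 \<in> ball z0 e" using e by simp
    have poles: "pole b0 x = z0" if "x \<in> C" for x
      using b0 C[OF that] by (simp add: pole_def z0_def)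
    have "contour_integral (circlepath z0 \<epsilon>) (family b0) / (2 * pi * \<i>) = residue (family b0) z0"
    \<comment> \<open>If \<alpha> is not among the weights, the integrand is holomorphic near
      \<open>z0\<close> and both sides are 0.\<close>
    proof (cases "C = {}")
      case True
      then have "residue (family b0) z0 = 0"
        using residue_holo[OF open_ball z0, of "family b0"] holo[OF b0U] by simp
      then show ?thesis using integral[OF b0U] True by simp
    next
      case False
      then have "pole b0 ` C = {z0}" using poles by auto
      then show ?thesis using integral[OF b0U] by simp
    qed
    also have "eventually (\<lambda>z. z \<in> ball z0 e) (at z0)" using z0 by (intro eventually_at_in_open') auto
    then have "residue (family b0) z0 = residue ?F z0"
      using family_center[OF b0] e(2) by (intro residue_cong) (auto elim!: eventually_mono)
    finally show ?thesis .
  qed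
  moreover have "\<forall>\<^sub>F b in at b0 within P. contour_integral (circlepath z0 \<epsilon>) (family b) / (2 * pi * \<i>) =
      (\<Sum>X\<in>C. cluster_term l S a \<zeta> b X)"
  proof -
    have "\<forall>\<^sub>F b in at b0 within P. b \<in> U"
      using topological_tendstoD[OF tendsto_ident_at \<open>open U\<close> b0U] .
    moreover have "\<forall>\<^sub>F b in at b0 within P. b \<in> P" by (simp add: eventually_at_filter)
    ultimately show ?thesis
    proof eventually_elim
      case (elim b)
      have z0: "z0 \<in> ball z0 e" using e by simp
      have inj: "inj_on (pole b) C"
        using P[OF elim(2)] near[OF elim(1) _ z0] by (intro pole_inj) auto
      have "residue (family b) (pole b X) = cluster_term l S a \<zeta> b X" if X: "X \<in> C" for X
        using far[OF elim(1)] near[OF elim(1)] near[OF elim(1) X z0] pole[OF elim(1) X] \<epsilon>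
        by (intro residue_family[OF e(1,2) X _ _ _ _ _ inj]) auto
      then show ?case using integral[OF elim(1)] by (simp add: sum.reindex[OF inj])
    qed
  qed
  ultimately show ?thesis using Lim_transform_eventually[OF lim] by simp
qed

end

end

section \<open>Limits of the residue sums\<close>

lemma finite_unit_roots: "\<alpha> > 0 \<Longrightarrow> finite (unit_roots \<alpha>)"
  using finite_roots_unity[of "nat \<alpha>", where 'a = complex] by (simp add: unit_roots_def power_int_def)

lemma cluster_points_eq:
  "cluster_points r d (exp l) =
    (\<lambda>(\<alpha>, \<zeta>). \<zeta> * exp (l / of_int \<alpha>)) ` Sigma (wt d ` Lambda r d) unit_roots"
proof (intro equalityI subsetI)
  fix p assume "p \<in> cluster_points r d (exp l)"
  then obtain X where X: "X \<in> Lambda r d" "p powi wt d X = exp l" by (auto simp: cluster_points_def)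
  then have pos: "wt d X > 0" by (simp add: Lambda_eq)
  have "(p * exp (- (l / of_int (wt d X)))) powi wt d X = p powi wt d X * exp (of_int (wt d X) * - (l / of_int (wt d X)))"
    by (simp only: power_int_mult_distrib exp_power_int mult.commute)
  also have "\<dots> = 1" using X pos by (simp flip: exp_add)
  finally have "p * exp (- (l / of_int (wt d X))) \<in> unit_roots (wt d X)" by (simp add: unit_roots_def)
  then have "(wt d X, p * exp (- (l / of_int (wt d X)))) \<in> Sigma (wt d ` Lambda r d) unit_roots" using X by auto
  then show "p \<in> (\<lambda>(\<alpha>, \<zeta>). \<zeta> * exp (l / of_int \<alpha>)) ` Sigma (wt d ` Lambda r d) unit_roots"
    by (rule rev_image_eqI) (simp add: mult.assoc flip: exp_add)
next
  fix p assume "p \<in> (\<lambda>(\<alpha>, \<zeta>). \<zeta> * exp (l / of_int \<alpha>)) ` Sigma (wt d ` Lambda r d) unit_roots"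
  then obtain X \<zeta> where X: "X \<in> Lambda r d" "\<zeta> \<in> unit_roots (wt d X)" "p = \<zeta> * exp (l / of_int (wt d X))"
    by auto
  then have pos: "wt d X > 0" by (simp add: Lambda_eq)
  have "p powi wt d X = \<zeta> powi wt d X * exp (of_int (wt d X) * (l / of_int (wt d X)))"
    unfolding X(3) by (simp only: power_int_mult_distrib exp_power_int mult.commute)
  then show "p \<in> cluster_points r d (exp l)" using X pos by (auto simp: cluster_points_def unit_roots_def)
qed

text \<open>The modulus exp (Re l / \<alpha>) determines \<alpha>, and then the point determines
  \<zeta>. So the sum over pairs counts every pole once.\<close>

lemma cluster_points_inj:
  assumes "Re l < 0"
  shows "inj_on (\<lambda>(\<alpha>, \<zeta>). \<zeta> * exp (l / of_int \<alpha>)) (Sigma (wt d ` Lambda r d) unit_roots)"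
proof (rule inj_onI, clarsimp)
  fix X \<zeta> X' \<zeta>'
  assume X: "X \<in> Lambda r d" "\<zeta> \<in> unit_roots (wt d X)" "X' \<in> Lambda r d" "\<zeta>' \<in> unit_roots (wt d X')"
    and eq: "\<zeta> * exp (l / of_int (wt d X)) = \<zeta>' * exp (l / of_int (wt d X'))"
  have pos: "wt d X > 0" "wt d X' > 0" using X by (auto simp: Lambda_eq)
  then have "norm \<zeta> = 1" "norm \<zeta>' = 1" using X norm_unit_root by (auto simp: unit_roots_def)
  then have "exp (Re l / real_of_int (wt d X)) = exp (Re l / real_of_int (wt d X'))"
    using arg_cong[OF eq, of norm] by (simp add: norm_mult)
  then have "wt d X = wt d X'" using assms pos by (simp add: field_simps)
  then show "wt d X = wt d X' \<and> \<zeta> = \<zeta>'" using eq by simp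
qed

text \<open>The root \<zeta> = 1 is available for every weight, and for it equal parameters make a
  factor of the denominator vanish. Hence admissible parameters have simple poles.\<close>

lemma params_Theta_distinct:
  assumes "b \<in> params_Theta r d l" "X \<in> Lambda r d" "x \<in> Theta r d" "b X = b x"
  shows "X = x"
proof (rule ccontr)
  assume "X \<noteq> x"
  then have "denom_Theta r d l b X 1 = 0"
    using assms finite_Theta by (auto simp: denom_Theta_def rpow_def intro!: bexI[of _ x])
  moreover have "1 \<in> unit_roots (wt d X)" by (simp add: unit_roots_def)
  ultimately show False using assms by (auto simp: params_Theta_def)
qed

lemma sum_Theta_clusters:
  "sum_Theta r d l b = (\<Sum>\<alpha>\<in>wt d ` Lambda r d. \<Sum>\<zeta>\<in>unit_roots \<alpha>.
     \<Sum>X\<in>{x \<in> Theta r d. wt d x = \<alpha>}. cluster_term l (Theta r d) (wt d) \<zeta> b X)"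
proof -
  let ?T = "cluster_term l (Theta r d) (wt d)"
  have "sum_Theta r d l b = (\<Sum>X\<in>Lambda r d. \<Sum>\<zeta>\<in>unit_roots (wt d X). ?T \<zeta> b X)"
    by (simp add: sum_Theta_def cluster_term_def denom_Theta_def)
  also have "\<dots> = (\<Sum>\<alpha>\<in>wt d ` Lambda r d. \<Sum>X\<in>{x \<in> Lambda r d. wt d x = \<alpha>}. \<Sum>\<zeta>\<in>unit_roots (wt d X). ?T \<zeta> b X)"
    by (rule sum.group[symmetric]) (auto simp: finite_Lambda)
  also have "\<dots> = (\<Sum>\<alpha>\<in>wt d ` Lambda r d. \<Sum>\<zeta>\<in>unit_roots \<alpha>. \<Sum>X\<in>{x \<in> Theta r d. wt d x = \<alpha>}. ?T \<zeta> b X)"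
  proof (rule sum.cong[OF refl])
    fix \<alpha> assume "\<alpha> \<in> wt d ` Lambda r d"
    then have "{x \<in> Lambda r d. wt d x = \<alpha>} = {x \<in> Theta r d. wt d x = \<alpha>}" by (auto simp: Lambda_eq)
    then show "(\<Sum>X\<in>{x \<in> Lambda r d. wt d x = \<alpha>}. \<Sum>\<zeta>\<in>unit_roots (wt d X). ?T \<zeta> b X) =
        (\<Sum>\<zeta>\<in>unit_roots \<alpha>. \<Sum>X\<in>{x \<in> Theta r d. wt d x = \<alpha>}. ?T \<zeta> b X)"
      by (subst sum.swap) (auto intro!: sum.cong)
  qed
  finally show ?thesis .
qed

lemma sum_Theta_tendsto:
  assumes l: "Re l < 0" and "Lambda r d \<noteq> {}"
  shows "(sum_Theta r d l \<longlongrightarrow> Hilb r d (exp l)) (at (base_params d (Theta r d)) within params_Theta r d l)"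
proof -
  let ?W = "weyl_integrand r d (exp l)"
  have pos: "\<alpha> > 0" if "\<alpha> \<in> wt d ` Lambda r d" for \<alpha> using that by (auto simp: Lambda_eq)
  have fin: "finite (cluster_points r d (exp l))"
    unfolding cluster_points_eq using pos by (intro finite_imageI finite_SigmaI finite_unit_roots) (auto simp: finite_Lambda)
  have "(sum_Theta r d l \<longlongrightarrow> (\<Sum>\<alpha>\<in>wt d ` Lambda r d. \<Sum>\<zeta>\<in>unit_roots \<alpha>. residue ?W (\<zeta> * exp (l / of_int \<alpha>))))
      (at (base_params d (Theta r d)) within params_Theta r d l)"
    unfolding sum_Theta_clusters[abs_def] weyl_integrand_def[abs_def]
  proof (intro tendsto_sum cluster_sum_tendsto[OF l])
    fix \<alpha> \<zeta> assume "\<alpha> \<in> wt d ` Lambda r d" "\<zeta> \<in> unit_roots \<alpha>"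
    then show "\<alpha> > 0" "\<zeta> powi \<alpha> = 1" using pos by (auto simp: unit_roots_def)
    fix b x y
    assume "b \<in> params_Theta r d l" "x \<in> {x \<in> Theta r d. wt d x = \<alpha>}" "y \<in> {x \<in> Theta r d. wt d x = \<alpha>}" "b x = b y"
    then show "x = y" using params_Theta_distinct[of b r d l x y] \<open>\<alpha> > 0\<close> by (auto simp: Lambda_eq)
  qed (auto simp: finite_Theta base_params_def)
  also have "(\<Sum>\<alpha>\<in>wt d ` Lambda r d. \<Sum>\<zeta>\<in>unit_roots \<alpha>. residue ?W (\<zeta> * exp (l / of_int \<alpha>))) =
      (\<Sum>p\<in>cluster_points r d (exp l). residue ?W p)"
    unfolding cluster_points_eq sum.reindex[OF cluster_points_inj[OF l]]
    using pos finite_unit_roots by (subst sum.Sigma) (auto simp: finite_Lambda intro!: sum.cong)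
  also have "\<dots> = contour_integral (circlepath 0 1) ?W / (2 * pi * \<i>)"
    using weyl_integrand_residues[OF _ _ assms(2) fin] l by simp
  also have "\<dots> = Hilb r d (exp l)"
    unfolding Hilb_def using hilbert_series_contour_integral[of "exp l" r d] l by (simp add: sums_iff)
  finally show ?thesis .
qed

section \<open>The symmetry of the weights and the formula over \<open>Lambda\<close>\<close>

definition mirror :: "(nat \<Rightarrow> nat) \<Rightarrow> nat \<times> nat \<Rightarrow> nat \<times> nat" where
  "mirror d = (\<lambda>(k, i). (k, d k - i))"

lemma mirror:
  assumes "x \<in> Theta r d"
  shows "mirror d x \<in> Theta r d" "mirror d (mirror d x) = x" "wt d (mirror d x) = - wt d x"
  using assms by (auto simp: mirror_def Theta_def wt_def)

text \<open>
  At parameters that are odd under \<open>mirror\<close>, the products over \<open>Theta\<close> become the products over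
  \<open>Lambda\<close> of the first formula.
\<close>

definition odd_extension ::
    "nat \<Rightarrow> (nat \<Rightarrow> nat) \<Rightarrow> (nat \<times> nat \<Rightarrow> real) \<Rightarrow> nat \<times> nat \<Rightarrow> real" where
  "odd_extension r d b = restrict (\<lambda>x. if wt d x > 0 then b x else if wt d x < 0 then - b (mirror d x) else 0) (Theta r d)"

lemma card_weight_0: "card {x \<in> Theta r d. wt d x = 0} = num_even r d"
proof -
  have "bij_betw (\<lambda>k. (k, d k div 2)) {k \<in> {1..r}. even (d k)} {x \<in> Theta r d. wt d x = 0}"
    by (rule bij_betwI[where g = fst]) (auto simp: Theta_def wt_def, presburger)
  then show ?thesis unfolding num_even_def by (simp add: bij_betw_same_card)
qed

text \<open>The mirror image of \<open>X\<close> contributes 1 - t^2, because \<zeta> powi (wt d X)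
  = 1 and (b X + b X) / b X = 2. Each index of weight 0 contributes 1 - t, and every other index of
  \<open>Lambda\<close> pairs with its mirror image to a \<open>beta\<close>.\<close>

lemma denom_Theta_odd_extension:
  assumes X: "X \<in> Lambda r d" and \<zeta>: "\<zeta> \<in> unit_roots (wt d X)"
  shows "denom_Theta r d l (odd_extension r d b) X \<zeta> = denom_Lambda r d (exp l) l b X \<zeta>"
proof (cases "b X = 0")
  case True
  then show ?thesis using X by (simp add: denom_Theta_def denom_Lambda_def odd_extension_def Lambda_eq)
next
  case False
  define b' where "b' = odd_extension r d b"
  define \<phi> where "\<phi> x = 1 - \<zeta> powi (- wt d x) * rpow l ((b' X - b' x) / b' X)" for x
  let ?L = "Lambda r d" and ?Z = "{x \<in> Theta r d. wt d x = 0}"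
  have bX: "b' x = b x" if "x \<in> ?L" for x using that by (simp add: b'_def odd_extension_def Lambda_eq)
  have bm: "b' (mirror d x) = - b x" if "x \<in> ?L" for x
    using that mirror[of x r d] by (simp add: b'_def odd_extension_def Lambda_eq)
  have mX: "mirror d X \<in> Theta r d" "wt d (mirror d X) < 0" using X mirror[of X r d] by (auto simp: Lambda_eq)
  have inj: "inj_on (mirror d) ?L"
    by (rule inj_on_inverseI[of _ "mirror d"]) (use mirror(2) in \<open>auto simp: Lambda_eq\<close>)
  have Theta: "Theta r d - {X} = (?L - {X}) \<union> (mirror d ` ?L \<union> ?Z)"
  proof (intro equalityI subsetI)
    fix x assume x: "x \<in> Theta r d - {X}"
    have "x \<in> mirror d ` ?L" if "wt d x < 0"
      using x that mirror[of x r d] by (intro image_eqI[of _ _ "mirror d x"]) (auto simp: Lambda_eq)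
    then show "x \<in> (?L - {X}) \<union> (mirror d ` ?L \<union> ?Z)" using x by (cases "wt d x" "0::int" rule: linorder_cases) (auto simp: Lambda_eq)
  next
    fix x assume "x \<in> (?L - {X}) \<union> (mirror d ` ?L \<union> ?Z)"
    then show "x \<in> Theta r d - {X}" using X mirror(1,3)[of _ r d] by (auto simp: Lambda_eq)
  qed
  have fin: "finite (?L - {X})" "finite (mirror d ` ?L)" "finite ?Z" by (auto simp: finite_Lambda finite_Theta)
  have disj: "(?L - {X}) \<inter> (mirror d ` ?L \<union> ?Z) = {}" "mirror d ` ?L \<inter> ?Z = {}"
    using mirror(3)[of _ r d] by (auto simp: Lambda_eq)
  have "(\<Prod>x\<in>Theta r d - {X}. \<phi> x) = (\<Prod>x\<in>?L - {X}. \<phi> x) * ((\<Prod>x\<in>mirror d ` ?L. \<phi> x) * (\<Prod>x\<in>?Z. \<phi> x))"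
    unfolding Theta prod.union_disjoint[OF fin(1) finite_UnI[OF fin(2,3)] disj(1)]
      prod.union_disjoint[OF fin(2,3) disj(2)] ..
  also have "(\<Prod>x\<in>mirror d ` ?L. \<phi> x) = \<phi> (mirror d X) * (\<Prod>x\<in>?L - {X}. \<phi> (mirror d x))"
    using X by (simp add: prod.reindex[OF inj] prod.remove[OF finite_Lambda X])
  also have "\<phi> (mirror d X) = 1 - (exp l)\<^sup>2"
    using \<zeta> X mirror(3)[of X r d] False
    by (simp add: \<phi>_def bX bm unit_roots_def Lambda_eq rpow_def flip: exp_double)
  also have "(\<Prod>x\<in>?Z. \<phi> x) = (1 - exp l) ^ num_even r d"
  proof -
    have "\<phi> x = 1 - exp l" if "x \<in> ?Z" for x
      using that False X by (simp add: \<phi>_def bX rpow_def) (simp add: b'_def odd_extension_def)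
    then show ?thesis by (simp add: card_weight_0)
  qed
  also have "(\<Prod>x\<in>?L - {X}. \<phi> x) * ((1 - (exp l)\<^sup>2) * (\<Prod>x\<in>?L - {X}. \<phi> (mirror d x)) * (1 - exp l) ^ num_even r d) =
      (1 - (exp l)\<^sup>2) * (1 - exp l) ^ num_even r d * (\<Prod>x\<in>?L - {X}. \<phi> x * \<phi> (mirror d x))"
    by (simp add: prod.distrib mult_ac)
  also have "(\<Prod>x\<in>?L - {X}. \<phi> x * \<phi> (mirror d x)) = (\<Prod>x\<in>?L - {X}. beta d l b X x \<zeta>)"
  proof (rule prod.cong[OF refl])
    fix x assume x: "x \<in> ?L - {X}"
    then show "\<phi> x * \<phi> (mirror d x) = beta d l b X x \<zeta>"
      using X mirror(3)[of x r d] by (simp add: \<phi>_def beta_def bX bm) (simp add: Lambda_eq)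
  qed
  finally show ?thesis
    unfolding denom_Theta_def denom_Lambda_def b'_def[symmetric] \<phi>_def bX[OF X] by (simp add: mult.assoc)
qed

lemma sum_Lambda_eq: "sum_Lambda r d (exp l) l b = sum_Theta r d l (odd_extension r d b)"
  unfolding sum_Lambda_def sum_Theta_def
proof (intro sum.cong refl)
  fix X \<zeta> assume X: "X \<in> Lambda r d" and \<zeta>: "\<zeta> \<in> unit_roots (wt d X)"
  have "odd_extension r d b X = b X" using X by (simp add: odd_extension_def Lambda_eq)
  then show "(1 - \<zeta>\<^sup>2 * rpow l (2 / b X)) / denom_Lambda r d (exp l) l b X \<zeta> =
      (1 - \<zeta>\<^sup>2 * rpow l (2 / odd_extension r d b X)) / denom_Theta r d l (odd_extension r d b) X \<zeta>"
    by (simp add: denom_Theta_odd_extension[OF X \<zeta>])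
qed

lemma odd_extension_params:
  assumes "b \<in> params_Lambda r d (exp l) l"
  shows "odd_extension r d b \<in> params_Theta r d l"
  using assms denom_Theta_odd_extension unfolding params_Lambda_def params_Theta_def
  by (auto simp: odd_extension_def)

lemma odd_extension_base: "odd_extension r d (base_params d (Lambda r d)) = base_params d (Theta r d)"
proof
  fix x show "odd_extension r d (base_params d (Lambda r d)) x = base_params d (Theta r d) x"
    using mirror[of x r d] by (auto simp: odd_extension_def base_params_def Lambda_eq)
qed

text \<open>The filter \<open>at\<close> omits its centre, so the extension must not reach the base
  point of \<open>Theta\<close> from elsewhere. Extensionality settles the coordinates outside
  \<open>Lambda\<close>.\<close>

lemma odd_extension_eq_baseD:
  assumes "b \<in> extensional (Lambda r d)" "odd_extension r d b = base_params d (Theta r d)"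
  shows "b = base_params d (Lambda r d)"
proof
  fix x show "b x = base_params d (Lambda r d) x"
    using fun_cong[OF assms(2), of x] extensional_arb[OF assms(1), of x]
    by (cases "x \<in> Lambda r d") (auto simp: odd_extension_def base_params_def Lambda_eq split: if_splits)
qed

lemma odd_extension_filterlim:
  "filterlim (odd_extension r d) (at (base_params d (Theta r d)) within params_Theta r d l)
     (at (base_params d (Lambda r d)) within params_Lambda r d (exp l) l)"
  unfolding filterlim_at
proof
  let ?F = "at (base_params d (Lambda r d)) within params_Lambda r d (exp l) l"
  have "\<forall>\<^sub>F b in ?F. b \<in> params_Lambda r d (exp l) l \<and> b \<noteq> base_params d (Lambda r d)"
    by (simp add: eventually_at_filter)
  then show "\<forall>\<^sub>F b in ?F. odd_extension r d b \<in> params_Theta r d l \<and> odd_extension r d b \<noteq> base_params d (Theta r d)"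
    by eventually_elim (use odd_extension_params odd_extension_eq_baseD in \<open>auto simp: params_Lambda_def\<close>)
  have "continuous_on UNIV (odd_extension r d)"
  proof (rule continuous_on_coordinatewise_then_product)
    fix x
    show "continuous_on UNIV (\<lambda>b. odd_extension r d b x)"
      by (cases "x \<in> Theta r d"; cases "wt d x > 0"; cases "wt d x < 0")
        (auto simp: odd_extension_def intro!: continuous_intros)
  qed
  then have "(odd_extension r d \<longlongrightarrow> odd_extension r d (base_params d (Lambda r d))) (at (base_params d (Lambda r d)))"
    by (simp add: continuous_on_def)
  then show "(odd_extension r d \<longlongrightarrow> base_params d (Theta r d)) ?F"
    unfolding odd_extension_base by (rule tendsto_within_subset) simp
qed

section \<open>Admissible parameters arbitrarily close to the base point\<close>

lemma filterlim_at_not_bot: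
  assumes "filterlim f G F" "F \<noteq> bot"
  shows "G \<noteq> bot"
  using assms by (auto simp: filterlim_def filtermap_bot_iff bot_unique)

text \<open>A root of unity times t^s has modulus exp (s Re l), which is 1 only for s = 0. The
  exponents in \<open>beta\<close> are nonzero when the parameters are positive and
  distinct.\<close>

lemma params_LambdaI:
  assumes l: "Re l < 0" and ext: "b \<in> extensional (Lambda r d)"
    and pos: "\<And>x. x \<in> Lambda r d \<Longrightarrow> b x > 0"
    and inj: "inj_on b (Lambda r d)"
  shows "b \<in> params_Lambda r d (exp l) l"
proof -
  have "denom_Lambda r d (exp l) l b X \<zeta> \<noteq> 0" if X: "X \<in> Lambda r d" and \<zeta>: "\<zeta> \<in> unit_roots (wt d X)" for X \<zeta>
  proof -
    have "norm \<zeta> = 1" using X \<zeta> norm_unit_root by (auto simp: unit_roots_def Lambda_eq)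
    then have nz: "\<zeta> powi k * rpow l s \<noteq> 1" if "s \<noteq> 0" for k s
    proof -
      have "norm (\<zeta> powi k * rpow l s) = exp (s * Re l)"
        using \<open>norm \<zeta> = 1\<close> by (simp add: norm_mult norm_power_int rpow_def)
      then have "norm (\<zeta> powi k * rpow l s) \<noteq> 1" using l that by simp
      then show ?thesis by auto
    qed
    have "norm (exp l) < 1" using l by simp
    then have "norm ((exp l)\<^sup>2) < 1" by (simp flip: exp_double)
    then have "(exp l)\<^sup>2 \<noteq> 1" "exp l \<noteq> 1" using \<open>norm (exp l) < 1\<close> by auto
    moreover have "beta d l b X x \<zeta> \<noteq> 0" if x: "x \<in> Lambda r d - {X}" for x
    proof -
      have "b X > 0" "b x > 0" "b X \<noteq> b x" using x X pos inj by (auto dest: inj_onD)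
      then show ?thesis unfolding beta_def by (simp add: nz)
    qed
    ultimately show ?thesis
      unfolding denom_Lambda_def using pos[OF X] finite_Lambda[of r d] by auto
  qed
  then show ?thesis using ext by (simp add: params_Lambda_def)
qed

lemma params_Lambda_not_bot:
  assumes l: "Re l < 0" and ne: "Lambda r d \<noteq> {}"
  shows "at (base_params d (Lambda r d)) within params_Lambda r d (exp l) l \<noteq> bot"
proof -
  \<comment> \<open>A curve into the base point. The injective encoding separates indices of equal
    weight, and the added 1 moves every coordinate off its base value.\<close>
  define c where "c \<tau> = restrict (\<lambda>x. of_int (wt d x) + \<tau> * (real (prod_encode x) + 1)) (Lambda r d)" for \<tau>
  have "filterlim c (at (base_params d (Lambda r d)) within params_Lambda r d (exp l) l) (at_right 0)"
    unfolding filterlim_at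
  proof
    have "continuous_on UNIV c"
    proof (rule continuous_on_coordinatewise_then_product)
      fix x show "continuous_on UNIV (\<lambda>\<tau>. c \<tau> x)"
        by (cases "x \<in> Lambda r d") (auto simp: c_def intro!: continuous_intros)
    qed
    then have "(c \<longlongrightarrow> c 0) (at 0)" by (simp add: continuous_on_def)
    moreover have "c 0 = base_params d (Lambda r d)" by (simp add: c_def base_params_def)
    ultimately show "(c \<longlongrightarrow> base_params d (Lambda r d)) (at_right 0)"
      using tendsto_within_subset[of c _ 0 UNIV] by simp
    \<comment> \<open>Equal weights are separated for every \<tau> > 0, different weights for small
      \<tau> by continuity.\<close>
    have "\<forall>\<^sub>F \<tau> in at_right 0. c \<tau> x \<noteq> c \<tau> y" if "x \<in> Lambda r d" "y \<in> Lambda r d" "x \<noteq> y" for x y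
    proof (cases "wt d x = wt d y")
      case True
      have "\<forall>\<^sub>F \<tau> in at_right (0::real). \<tau> > 0" by (rule eventually_at_right_less)
      then show ?thesis by eventually_elim (use that True in \<open>auto simp: c_def inj_eq[OF inj_prod_encode]\<close>)
    next
      case False
      have "((\<lambda>\<tau>. c \<tau> x - c \<tau> y) \<longlongrightarrow>
          (of_int (wt d x) + 0 * (real (prod_encode x) + 1)) - (of_int (wt d y) + 0 * (real (prod_encode y) + 1))) (at_right 0)"
        using that by (simp only: c_def restrict_apply' ) (intro tendsto_intros)
      then have "\<forall>\<^sub>F \<tau> in at_right 0. c \<tau> x - c \<tau> y \<noteq> 0"
        by (rule tendsto_imp_eventually_ne) (use False in auto)
      then show ?thesis by eventually_elim simp
    qed
    then have "\<forall>\<^sub>F \<tau> in at_right 0. \<forall>x\<in>Lambda r d. \<forall>y\<in>Lambda r d - {x}. c \<tau> x \<noteq> c \<tau> y"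
      by (intro eventually_ball_finite ballI) (auto simp: finite_Lambda)
    moreover have "\<forall>\<^sub>F \<tau> in at_right (0::real). \<tau> > 0" by (rule eventually_at_right_less)
    ultimately show "\<forall>\<^sub>F \<tau> in at_right 0. c \<tau> \<in> params_Lambda r d (exp l) l \<and> c \<tau> \<noteq> base_params d (Lambda r d)"
    proof eventually_elim
      case (elim \<tau>)
      have "c \<tau> x > 0" if "x \<in> Lambda r d" for x
        using that elim(2) by (auto simp: c_def Lambda_eq intro!: add_pos_nonneg)
      moreover have "inj_on (c \<tau>) (Lambda r d)" using elim(1) by (intro inj_onI) blast
      ultimately have "c \<tau> \<in> params_Lambda r d (exp l) l"
        using l by (intro params_LambdaI) (auto simp: c_def)
      moreover obtain X where "X \<in> Lambda r d" using ne by blast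
      then have "c \<tau> X \<noteq> base_params d (Lambda r d) X" using elim(2) by (auto simp: c_def base_params_def add_eq_0_iff)
      ultimately show ?case by auto
    qed
  qed
  then show ?thesis by (rule filterlim_at_not_bot) simp
qed

text \<open>A summand of degree 0 consists of constant forms, and the constant 1 in that component
  is a nonzero fixed vector.\<close>

lemma rep_fixed_trivial_degrees:
  assumes "rep_fixed r d = {0}" "1 \<le> k" "k \<le> r"
  shows "d k \<ge> 1"
proof (rule ccontr)
  assume "\<not> d k \<ge> 1"
  then have "d k = 0" by simp
  define F where "F = rep_vec r d (\<lambda>x. if x = (k, 0) then 1 else 0)"
  have F: "F = (\<lambda>k' z. if k' = k then 1 else 0)"
    using assms(2,3) \<open>d k = 0\<close> by (auto simp: F_def rep_vec_def binary_form_def fun_eq_iff)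
  have "F \<in> rep_fixed r d" by (auto simp: rep_fixed_def rep_space_def F_def) (auto simp: sl2_act_def F F_def[symmetric])
  then have "F k 0 = 0" using assms(1) by simp
  then show False by (simp add: F)
qed

text \<open>The conditions \<open>\<noteq> bot\<close> keep the limits from being vacuous, and
  summability makes \<open>Hilb\<close> the actual value of the power series. Choosing
  \<open>l\<close> with exp l = t chooses the branch of log t.\<close>

theorem theorem3p2:
  fixes r :: nat and d :: "nat \<Rightarrow> nat" and t l :: complex
  assumes "r \<ge> 1"
    and "rep_fixed r d = {0}"
    and "0 < norm t" and "norm t < 1"
    and "exp l = t"
  shows "summable (\<lambda>n. of_nat (hilbert_function r d n) * t ^ n) \<and>
    at (base_params d (Lambda r d)) within params_Lambda r d t l \<noteq> bot \<and>
    (sum_Lambda r d t l \<longlongrightarrow> Hilb r d t)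
      (at (base_params d (Lambda r d)) within params_Lambda r d t l) \<and>
    at (base_params d (Theta r d)) within params_Theta r d l \<noteq> bot \<and>
    (sum_Theta r d l \<longlongrightarrow> Hilb r d t)
      (at (base_params d (Theta r d)) within params_Theta r d l)"
proof -
  have l: "Re l < 0" using assms(4,5) by (metis norm_exp_eq_Re exp_less_one_iff)
  \<comment> \<open>A form of positive degree provides the positive weight \<open>d 1\<close>, so
    there is at least one cluster of poles.\<close>
  have "d 1 \<ge> 1" using rep_fixed_trivial_degrees[OF assms(2), of 1] assms(1) by simp
  then have "(1, d 1) \<in> Lambda r d" using assms(1) by (auto simp: Lambda_def)
  then have ne: "Lambda r d \<noteq> {}" by blast
  have Theta: "(sum_Theta r d l \<longlongrightarrow> Hilb r d (exp l)) (at (base_params d (Theta r d)) within params_Theta r d l)"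
    by (rule sum_Theta_tendsto[OF l ne])
  have "((\<lambda>b. sum_Theta r d l (odd_extension r d b)) \<longlongrightarrow> Hilb r d (exp l))
      (at (base_params d (Lambda r d)) within params_Lambda r d (exp l) l)"
    by (rule filterlim_compose[OF Theta odd_extension_filterlim])
  moreover have "sum_Lambda r d (exp l) l = (\<lambda>b. sum_Theta r d l (odd_extension r d b))"
    by (rule ext) (rule sum_Lambda_eq)
  ultimately have "(sum_Lambda r d (exp l) l \<longlongrightarrow> Hilb r d (exp l))
      (at (base_params d (Lambda r d)) within params_Lambda r d (exp l) l)"
    by simp
  moreover have "summable (\<lambda>n. of_nat (hilbert_function r d n) * (exp l) ^ n)"
    using hilbert_series_contour_integral[of "exp l" r d] l by (auto simp: sums_iff)
  moreover have "at (base_params d (Theta r d)) within params_Theta r d l \<noteq> bot"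
    by (rule filterlim_at_not_bot[OF odd_extension_filterlim params_Lambda_not_bot[OF l ne]])
  ultimately show ?thesis
    using params_Lambda_not_bot[OF l ne] Theta unfolding assms(5) by blast
qed

end
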